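(* Let $T,N\in\mathbb N$, $\ell_1,\dots,\ell_T>0$, and let $\boldsymbol\pi_{T,D}=\pi_T^{\otimes D}$ be as in the context. Assume that the density $\pi_T$ is twice continuously differentiable and that for all $s,t\in[T]$ the function $\partial_s\partial_t\log\pi_T$ is Lipschitz-continuous and bounded and $\pi_T(|\partial_t\log\pi_T|^4)<\infty$. Then for any $t\in[T]$, $$\lim_{D\to\infty}\bigl|\widetilde{\mathrm{ESJD}}{}^N_{T,D}(t)-\ell_t\,\tilde\alpha^N_T(t)\bigr|=0,$$ where $\widetilde{\mathrm{ESJD}}{}^N_{T,D}(t)=\mathbb E\bigl[\|\mathbf X_t'-\mathbf X_t\|_2^2\bigr]$ with $\mathbf X_{1:T}\sim\boldsymbol\pi_{T,D}$ and $\mathbf X'_{1:T}$ the new state produced by one RW-EHMM update started from $\mathbf X_{1:T}$, and $\tilde\alpha^N_T(t)$ is the probability of $\{K_t\ne0\}$ under the limiting law $\widetilde{\mathbb P}^N_T$.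
   Context: Notation: $[n]=\{1,\dots,n\}$, $[n]_0=\{0,\dots,n\}$; $\partial_t$ is the derivative with respect to $x_t$; $\pi_T(\varphi)=\int\varphi\,\pi_T$; $\|\cdot\|_2$ is the Euclidean norm; $\mathbf 1_N$ is the all-ones vector and $I_N$ the identity. Quantities with time index $0$ are ignored. Model. $M_1$ is a probability measure on $\mathbb R$ with Lebesgue density $m_1$; for $t\ge2$, $M_t$ is a Markov kernel on $\mathbb R$ with transition density $m_t(x,y)$; $G_t:\mathbb R\to(0,\infty)$ is measurable. $\pi_T$ is the probability measure (and its density) on $\mathbb R^T$ given by $\pi_T(x_{1:T})\propto m_1(x_1)G_1(x_1)\prod_{t=2}^T m_t(x_{t-1},x_t)G_t(x_t)$. For $D\in\mathbb N$, $\mathbf x_t=(x_{t,1},\dots,x_{t,D})\in\mathbb R^D$, the target is $\boldsymbol\pi_{T,D}(\mathbf x_{1:T})=\prod_{d=1}^D\pi_T(x_{1,d},\dots,x_{T,d})$ on $(\mathbb R^D)^T$. Let $\Sigma=\tfrac12(I_N+\mathbf 1_N\mathbf 1_N^{\mathsf T})$. One RW-EHMM update from $\mathbf x_{1:T}$: set $\mathbf Z_t^0=\mathbf x_t$; independently for all $t\in[T]$, $d\in[D]$ sample $U_{t,d}^{1:N}\sim \mathrm N(0,\Sigma)$ and set $Z_{t,d}^n=x_{t,d}+\sqrt{\ell_t/D}\,U_{t,d}^n$, $\mathbf Z_t^n=(Z_{t,1}^n,\dots,Z_{t,D}^n)$ for $n\in[N]$. Then sample $K_{1:T}=k_{1:T}\in[N]_0^T$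 with probability $\boldsymbol\pi_{T,D}(\mathbf Z_1^{k_1},\dots,\mathbf Z_T^{k_T})\big/\sum_{l_{1:T}\in[N]_0^T}\boldsymbol\pi_{T,D}(\mathbf Z_1^{l_1},\dots,\mathbf Z_T^{l_T})$. The new state is $(\mathbf Z_1^{K_1},\dots,\mathbf Z_T^{K_T})$. (The resulting Markov kernel leaves $\boldsymbol\pi_{T,D}$ invariant.) Limiting law $\widetilde{\mathbb P}^N_T$. Let $\mathcal I_{t|T}=\pi_T([\partial_t\log\pi_T]^2)=-\pi_T(\partial_t^2\log\pi_T)$. Sample independently for $t\in[T]$ vectors $V_t=(V_t^1,\dots,V_t^N)\sim \mathrm N(-\tfrac12\ell_t\mathcal I_{t|T}\mathbf 1_N,\ \ell_t\mathcal I_{t|T}\Sigma)$, and given these sample $K_1,\dots,K_T$ conditionally independently with $K_t=k\in[N]_0$ having probability $\Psi^k(\{V_t^m\}_{m=1}^N)$, where $\Psi^k(\{h^m\}_{m=1}^N)=e^{h^k}/(1+\sum_{m=1}^N e^{h^m})$ with $h^0:=0$. *)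

theory Defs
  imports "HOL-Probability.Probability"
begin

text \<open>
  The horizon \<open>T\<close> and the number \<open>N\<close> of proposals are fixed throughout and are represented by
  finite index types: time points are elements of a finite linearly ordered type \<open>'t\<close>
  (order-isomorphic to \<open>{1..T}\<close>), proposal labels \<open>1..N\<close> are elements of a finite type \<open>'n\<close>, and
  \<open>{0..N}\<close> is \<open>'n option\<close>, where \<open>None\<close> stands for \<open>0\<close>. The dimension \<open>D\<close>, which tends to
  infinity, is a natural number.
\<close>

section \<open>Calculus and Gaussian laws\<close>

definition partial :: "'t::finite \<Rightarrow> (real^'t \<Rightarrow> real) \<Rightarrow> real^'t \<Rightarrow> real" where
  "partial t f x = deriv (\<lambda>h. f (x + h *\<^sub>R axis t 1)) 0"

definition twice_continuously_differentiable ::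
    "('a::real_normed_vector \<Rightarrow> 'b::real_normed_vector) \<Rightarrow> bool" where
  "twice_continuously_differentiable f \<longleftrightarrow>
     (\<exists>(f' :: 'a \<Rightarrow> 'a \<Rightarrow>\<^sub>L 'b) (f'' :: 'a \<Rightarrow> 'a \<Rightarrow>\<^sub>L 'a \<Rightarrow>\<^sub>L 'b).
        (\<forall>x. (f has_derivative blinfun_apply (f' x)) (at x)) \<and>
        (\<forall>x. (f' has_derivative blinfun_apply (f'' x)) (at x)) \<and>
        continuous_on UNIV f'')"

text \<open>The normal law with mean \<open>\<mu>\<close> and covariance matrix \<open>S\<close>, for positive definite \<open>S\<close>.\<close>

definition multivariate_normal :: "real^'n \<Rightarrow> real^'n^'n \<Rightarrow> (real^'n::finite) measure" where
  "multivariate_normal \<mu> S = density lborel (\<lambda>x. ennreal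
     (exp (- ((x - \<mu>) \<bullet> (matrix_inv S *v (x - \<mu>))) / 2) / sqrt ((2 * pi) ^ CARD('n) * det S)))"

definition Sigma_N :: "real^'n^'n::finite" where
  "Sigma_N = (1/2) *\<^sub>R (mat 1 + (\<chi> i j. 1))"

section \<open>The model\<close>

definition first_time :: "'t::{finite,linorder}" where
  "first_time = Min UNIV"

definition prev_time :: "'t::{finite,linorder} \<Rightarrow> 't" where
  "prev_time t = Max {s. s < t}"

definition unnormalised_density ::
    "(real \<Rightarrow> real) \<Rightarrow> ('t \<Rightarrow> real \<Rightarrow> real \<Rightarrow> real) \<Rightarrow> ('t \<Rightarrow> real \<Rightarrow> real)
     \<Rightarrow> real^'t::{finite,linorder} \<Rightarrow> real" where
  "unnormalised_density m1 m G x =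
     m1 (x $ first_time) * G first_time (x $ first_time) *
     (\<Prod>t\<in>UNIV - {first_time}. m t (x $ prev_time t) (x $ t) * G t (x $ t))"

definition target_density ::
    "(real \<Rightarrow> real) \<Rightarrow> ('t \<Rightarrow> real \<Rightarrow> real \<Rightarrow> real) \<Rightarrow> ('t \<Rightarrow> real \<Rightarrow> real)
     \<Rightarrow> real^'t::{finite,linorder} \<Rightarrow> real" where
  "target_density m1 m G x =
     unnormalised_density m1 m G x / (\<integral>y. unnormalised_density m1 m G y \<partial>lborel)"

text \<open>In the remaining definitions \<open>p\<close> is the normalised density of the target at dimension 1.\<close>

definition target_measure :: "(real^'t::finite \<Rightarrow> real) \<Rightarrow> (real^'t) measure" where
  "target_measure p = density lborel (\<lambda>x. ennreal (p x))"

text \<open>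
  A state in \<open>(\<real>\<^sup>D)\<^sup>T\<close> is stored with its coordinates grouped by \<open>d\<close>: \<open>x d $ t\<close> is \<open>x\<^sub>t\<^sub>,\<^sub>d\<close>.
\<close>

definition state_space :: "nat \<Rightarrow> (nat \<Rightarrow> real^'t::finite) measure" where
  "state_space D = PiM {1..D} (\<lambda>_. borel)"

definition target_density_D ::
    "(real^'t::finite \<Rightarrow> real) \<Rightarrow> nat \<Rightarrow> (nat \<Rightarrow> real^'t) \<Rightarrow> real" where
  "target_density_D p D x = (\<Prod>d\<in>{1..D}. p (x d))"

definition target_measure_D ::
    "(real^'t::finite \<Rightarrow> real) \<Rightarrow> nat \<Rightarrow> (nat \<Rightarrow> real^'t) measure" where
  "target_measure_D p D = PiM {1..D} (\<lambda>_. target_measure p)"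

section \<open>The random-walk embedded HMM update\<close>

text \<open>The noise \<open>U\<close> (with \<open>u (t, d) $ n\<close> for \<open>U\<^sub>t\<^sub>,\<^sub>d\<^sup>n\<close>), with general proposal covariance \<open>S\<close>.\<close>

definition noise_law :: "real^'n^'n::finite \<Rightarrow> nat \<Rightarrow> ('t::finite \<times> nat \<Rightarrow> real^'n) measure" where
  "noise_law S D = PiM (UNIV \<times> {1..D}) (\<lambda>_. multivariate_normal 0 S)"

definition proposal ::
    "('t \<Rightarrow> real) \<Rightarrow> nat \<Rightarrow> (nat \<Rightarrow> real^'t) \<Rightarrow> ('t \<times> nat \<Rightarrow> real^'n) \<Rightarrow>
     't::finite \<Rightarrow> nat \<Rightarrow> 'n::finite option \<Rightarrow> real" where
  "proposal l D x u t d k =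
     (case k of None \<Rightarrow> x d $ t
      | Some n \<Rightarrow> x d $ t + sqrt (l t / real D) * u (t, d) $ n)"

definition selected_path ::
    "('t \<Rightarrow> real) \<Rightarrow> nat \<Rightarrow> (nat \<Rightarrow> real^'t) \<Rightarrow> ('t \<times> nat \<Rightarrow> real^'n) \<Rightarrow>
     ('t::finite \<Rightarrow> 'n::finite option) \<Rightarrow> nat \<Rightarrow> real^'t" where
  "selected_path l D x u k = (\<lambda>d\<in>{1..D}. \<chi> t. proposal l D x u t d (k t))"

definition selection_pmf ::
    "('t \<Rightarrow> real) \<Rightarrow> (real^'t::finite \<Rightarrow> real) \<Rightarrow> nat \<Rightarrow> (nat \<Rightarrow> real^'t) \<Rightarrow>
     ('t \<times> nat \<Rightarrow> real^'n::finite) \<Rightarrow> ('t \<Rightarrow> 'n option) pmf" where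
  "selection_pmf l p D x u = embed_pmf (\<lambda>k.
     target_density_D p D (selected_path l D x u k) /
     (\<Sum>j\<in>UNIV. target_density_D p D (selected_path l D x u j)))"

definition rw_ehmm_update ::
    "real^'n^'n::finite \<Rightarrow> ('t \<Rightarrow> real) \<Rightarrow> (real^'t::finite \<Rightarrow> real) \<Rightarrow> nat \<Rightarrow>
     (nat \<Rightarrow> real^'t) \<Rightarrow> (nat \<Rightarrow> real^'t) measure" where
  "rw_ehmm_update S l p D x = do {
     u \<leftarrow> noise_law S D;
     k \<leftarrow> measure_pmf (selection_pmf l p D x u);
     return (state_space D) (selected_path l D x u k)
   }"

text \<open>The joint law of the stationary state \<open>X\<close> and the updated state \<open>X'\<close>.\<close>

definition stationary_pair_law ::
    "real^'n^'n::finite \<Rightarrow> ('t \<Rightarrow> real) \<Rightarrow> (real^'t::finite \<Rightarrow> real) \<Rightarrow> nat \<Rightarrow>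
     ((nat \<Rightarrow> real^'t) \<times> (nat \<Rightarrow> real^'t)) measure" where
  "stationary_pair_law S l p D = do {
     x \<leftarrow> target_measure_D p D;
     x' \<leftarrow> rw_ehmm_update S l p D x;
     return (state_space D \<Otimes>\<^sub>M state_space D) (x, x')
   }"

definition ESJD ::
    "real^'n^'n::finite \<Rightarrow> ('t \<Rightarrow> real) \<Rightarrow> (real^'t::finite \<Rightarrow> real) \<Rightarrow> nat \<Rightarrow> 't \<Rightarrow> real" where
  "ESJD S l p D t =
     (\<integral>z. (L2_set (\<lambda>d. snd z d $ t - fst z d $ t) {1..D})\<^sup>2 \<partial>stationary_pair_law S l p D)"

section \<open>The limiting law\<close>

definition info :: "(real^'t::finite \<Rightarrow> real) \<Rightarrow> 't \<Rightarrow> real" where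
  "info p t = (\<integral>x. (partial t (\<lambda>y. ln (p y)) x)\<^sup>2 \<partial>target_measure p)"

definition Psi :: "real^'n::finite \<Rightarrow> 'n option \<Rightarrow> real" where
  "Psi h k = exp (case k of None \<Rightarrow> 0 | Some n \<Rightarrow> h $ n) / (1 + (\<Sum>m\<in>UNIV. exp (h $ m)))"

text \<open>\<open>Pi_pmf UNIV None\<close> makes the labels conditionally independent; its default \<open>None\<close> is unused.\<close>

definition limit_law ::
    "real^'n^'n::finite \<Rightarrow> ('t \<Rightarrow> real) \<Rightarrow> (real^'t::finite \<Rightarrow> real) \<Rightarrow>
     (('t \<Rightarrow> real^'n) \<times> ('t \<Rightarrow> 'n option)) measure" where
  "limit_law S l p = do {
     v \<leftarrow> PiM UNIV (\<lambda>t. multivariate_normal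
            ((- (1/2) * l t * info p t) *\<^sub>R (\<chi> n. 1)) ((l t * info p t) *\<^sub>R S));
     k \<leftarrow> measure_pmf (Pi_pmf UNIV None (\<lambda>t. embed_pmf (Psi (v t))));
     return (PiM UNIV (\<lambda>_. borel) \<Otimes>\<^sub>M count_space UNIV) (v, k)
   }"

definition limit_acceptance ::
    "real^'n^'n::finite \<Rightarrow> ('t \<Rightarrow> real) \<Rightarrow> (real^'t::finite \<Rightarrow> real) \<Rightarrow> 't \<Rightarrow> real" where
  "limit_acceptance S l p t =
     measure (limit_law S l p) {z \<in> space (limit_law S l p). snd z t \<noteq> None}"

end

(*
  Write phi = ln p and let H k be the log-ratio of the target density at the candidate path k and at
  the current state, so that k is selected with probability softmax H k.

  A second-order Taylor expansion of phi, the law of large numbers for the Hessian terms, and the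
  identity E[d_t^2 phi] = - E[(d_t phi)^2] show that H k is, up to an L1 error of order 1 / sqrt D,
  the sum over the moved coordinates s of W_s^(k_s) - l_s I_s / 2, where
  W_s = sum over d of sqrt (l_s / D) * d_s phi (x_d) * U_(s,d).  No central limit theorem is needed:
  given the state x, the vectors W_s are independent and exactly normal, with covariance
  (l_s / D) * (sum over d of (d_s phi (x_d))^2) * Sigma, which converges to l_s I_s Sigma by the law
  of large numbers (here the fourth moments enter).  As softmax is Lipschitz, the selection
  probabilities may be compared in L1 with those of the limiting law, and the squared jump given k
  concentrates at l_t because sum over d of (U_(t,d)^n)^2 / D tends to 1.
*)
theory Submission
  imports Defs
begin

section \<open>Sums of independent random variables\<close>

text \<open>\<open>Sigma_N\<close> is the covariance of independent normals plus one shared normal,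
  so every Gaussian fact below reduces to rotation invariance of the standard normal law. Positivity
  of \<open>info p s\<close> matters twice: \<open>multivariate_normal\<close> is a normal law only
  for a nonsingular covariance, and the square root that turns the random variance into a scale is
  Lipschitz only away from 0. The correlation between two proposals at one time affects the law of
  W_s but not the second-order terms: a path picks one label per time, so only unit variances and
  products of independent noises at different times occur there. The limiting labels are independent
  across times because the limiting log-weight of a path is a sum over times, whose softmax
  factorises. The replacement of W_s by its limit is a statement about laws, not about random
  variables, so it is made after integrating over the noise with the state frozen; all other errors
  are small in L1 on the joint space of state and noise.\<close>

lemma (in prob_space) indep_sum_square:
  fixes Z :: "'i \<Rightarrow> 'a \<Rightarrow> real"
  assumes "finite I" "indep_vars (\<lambda>_. borel) Z I"
    and "\<And>i. i \<in> I \<Longrightarrow> integrable M (\<lambda>\<omega>. (Z i \<omega>)\<^sup>2)"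
    and "\<And>i. i \<in> I \<Longrightarrow> expectation (Z i) = 0"
  shows "integrable M (\<lambda>\<omega>. (\<Sum>i\<in>I. Z i \<omega>)\<^sup>2) \<and>
    expectation (\<lambda>\<omega>. (\<Sum>i\<in>I. Z i \<omega>)\<^sup>2) = (\<Sum>i\<in>I. expectation (\<lambda>\<omega>. (Z i \<omega>)\<^sup>2))"
  using assms
proof (induction I rule: finite_induct)
  case empty
  then show ?case by simp
next
  case (insert j I)
  have rv [measurable]: "\<And>i. i \<in> insert j I \<Longrightarrow> random_variable borel (Z i)"
    using insert.prems(1) by (auto simp: indep_vars_def)
  have int: "\<And>i. i \<in> insert j I \<Longrightarrow> integrable M (Z i)"
    using insert.prems(2) rv by (auto intro: square_integrable_imp_integrable)
  have IH: "integrable M (\<lambda>\<omega>. (\<Sum>i\<in>I. Z i \<omega>)\<^sup>2)"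
    "expectation (\<lambda>\<omega>. (\<Sum>i\<in>I. Z i \<omega>)\<^sup>2) = (\<Sum>i\<in>I. expectation (\<lambda>\<omega>. (Z i \<omega>)\<^sup>2))"
    using insert.IH[OF indep_vars_subset[OF insert.prems(1)]] insert.prems by auto
  have iv: "indep_var borel (Z j) borel (\<lambda>\<omega>. \<Sum>i\<in>I. Z i \<omega>)"
    by (rule indep_vars_sum[OF insert.hyps(1,2) insert.prems(1)])
  have intS: "integrable M (\<lambda>\<omega>. \<Sum>i\<in>I. Z i \<omega>)"
    using int by auto
  have c: "integrable M (\<lambda>\<omega>. Z j \<omega> * (\<Sum>i\<in>I. Z i \<omega>))"
    "expectation (\<lambda>\<omega>. Z j \<omega> * (\<Sum>i\<in>I. Z i \<omega>)) = 0"
    using indep_var_integrable[OF iv int intS] indep_var_lebesgue_integral[OF iv int intS]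
      insert.prems(3)[of j] by auto
  have eq: "(\<Sum>i\<in>insert j I. Z i \<omega>)\<^sup>2 = (Z j \<omega>)\<^sup>2 + 2 * (Z j \<omega> * (\<Sum>i\<in>I. Z i \<omega>)) + (\<Sum>i\<in>I. Z i \<omega>)\<^sup>2" for \<omega>
    using insert.hyps by (simp add: power2_sum algebra_simps)
  show ?case
    unfolding eq using IH c insert.prems(2)[of j] insert.hyps by simp
qed

text \<open>Variances of independent centred terms add, so the sum has second moment at most
  \<open>D * C\<close>. The bound is on a nonnegative integral, so that integrability of the error
  can later be deduced from it.\<close>

lemma (in prob_space) nn_integral_abs_average_le:
  fixes Z :: "nat \<Rightarrow> 'a \<Rightarrow> real"
  assumes D: "D > 0" and ind: "indep_vars (\<lambda>_. borel) Z {1..D}"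
    and sq: "\<And>d. d \<in> {1..D} \<Longrightarrow> integrable M (\<lambda>\<omega>. (Z d \<omega>)\<^sup>2)"
    and mean: "\<And>d. d \<in> {1..D} \<Longrightarrow> expectation (Z d) = 0"
    and var: "\<And>d. d \<in> {1..D} \<Longrightarrow> expectation (\<lambda>\<omega>. (Z d \<omega>)\<^sup>2) \<le> C"
  shows "(\<integral>\<^sup>+\<omega>. ennreal \<bar>(\<Sum>d\<in>{1..D}. Z d \<omega>) / real D\<bar> \<partial>M) \<le> ennreal ((1 + C) / sqrt (real D))"
proof -
  have rv [measurable]: "\<And>d. d \<in> {1..D} \<Longrightarrow> random_variable borel (Z d)"
    using ind by (auto simp: indep_vars_def)
  let ?S = "\<lambda>\<omega>. \<Sum>d\<in>{1..D}. Z d \<omega>"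
  have S: "integrable M (\<lambda>\<omega>. (?S \<omega>)\<^sup>2)" "expectation (\<lambda>\<omega>. (?S \<omega>)\<^sup>2) \<le> real D * C"
    using indep_sum_square[OF _ ind sq mean] sum_bounded_above[of "{1..D}" "\<lambda>d. expectation (\<lambda>\<omega>. (Z d \<omega>)\<^sup>2)" C] var
    by auto
  have C: "0 \<le> C"
    using order_trans[OF integral_nonneg_AE var[of 1]] D by auto
  let ?s = "sqrt (real D)"
  have s: "?s > 0" "?s * ?s = real D" using D by auto
  \<comment> \<open>The arithmetic-geometric inequality \<open>2 * |x| * sqrt D <= D + x^2\<close>
    stands in for Cauchy-Schwarz; its two summands produce the 1 and the \<open>C\<close> in
    \<open>1 + C\<close>.\<close>
  have ptw: "\<bar>?S \<omega> / real D\<bar> \<le> 1 / ?s + (?S \<omega>)\<^sup>2 / (real D * ?s)" for \<omega>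
  proof -
    have "2 * \<bar>x\<bar> * ?s \<le> ?s\<^sup>2 + x\<^sup>2" for x
      using zero_le_power2[of "\<bar>x\<bar> - ?s"] unfolding power2_diff power2_abs by linarith
    from this[of "?S \<omega>"] have "2 * \<bar>?S \<omega>\<bar> * ?s \<le> real D + (?S \<omega>)\<^sup>2"
      by simp
    then have "\<bar>?S \<omega>\<bar> * ?s \<le> real D + (?S \<omega>)\<^sup>2"
      using mult_nonneg_nonneg[OF abs_ge_zero[of "?S \<omega>"] less_imp_le[OF s(1)]] by linarith
    then have "(\<bar>?S \<omega>\<bar> * ?s) / (real D * ?s) \<le> (real D + (?S \<omega>)\<^sup>2) / (real D * ?s)"
      using D by (intro divide_right_mono) auto
    then show ?thesis using D by (simp add: add_divide_distrib abs_divide)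
  qed
  have int: "integrable M (\<lambda>\<omega>. 1 / ?s + (?S \<omega>)\<^sup>2 / (real D * ?s))"
    using S(1) by auto
  have "(\<integral>\<^sup>+\<omega>. ennreal \<bar>?S \<omega> / real D\<bar> \<partial>M) \<le> (\<integral>\<^sup>+\<omega>. ennreal (1 / ?s + (?S \<omega>)\<^sup>2 / (real D * ?s)) \<partial>M)"
    using ptw by (intro nn_integral_mono ennreal_leI)
  also have "\<dots> = ennreal (expectation (\<lambda>\<omega>. 1 / ?s + (?S \<omega>)\<^sup>2 / (real D * ?s)))"
    using int by (intro nn_integral_eq_integral) auto
  also have "expectation (\<lambda>\<omega>. 1 / ?s + (?S \<omega>)\<^sup>2 / (real D * ?s)) = 1 / ?s + expectation (\<lambda>\<omega>. (?S \<omega>)\<^sup>2) / (real D * ?s)"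
    using S(1) by (simp add: prob_space)
  also have "ennreal \<dots> \<le> ennreal (1 / ?s + real D * C / (real D * ?s))"
    using S(2) D by (intro ennreal_leI add_left_mono divide_right_mono) auto
  also have "1 / ?s + real D * C / (real D * ?s) = (1 + C) / ?s"
    using D by (simp add: add_divide_distrib)
  finally show ?thesis .
qed

text \<open>The joint law of the coordinates is the product measure itself and its marginals are the
  factors, which is the distributional criterion for independence. That criterion concerns nonempty
  index sets, hence the separate empty case.\<close>

lemma indep_vars_PiM_coordinates:
  assumes "\<And>i. i \<in> I \<Longrightarrow> prob_space (M i)"
  shows "prob_space.indep_vars (PiM I M) M (\<lambda>i \<omega>. \<omega> i) I"
proof (cases "I = {}")
  case True
  interpret prob_space "PiM I M" using assms by (rule prob_space_PiM)
  show ?thesis unfolding indep_vars_def indep_sets_def using True by auto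
next
  case False
  interpret prob_space "PiM I M" using assms by (rule prob_space_PiM)
  have "distr (PiM I M) (PiM I M) (\<lambda>x. \<lambda>i\<in>I. x i) = distr (PiM I M) (PiM I M) (\<lambda>x. x)"
    by (intro distr_cong) (auto simp: space_PiM PiE_def extensional_restrict)
  also have "\<dots> = PiM I M" by (rule distr_id)
  also have "\<dots> = PiM I (\<lambda>i. distr (PiM I M) (M i) (\<lambda>x. x i))"
    using assms by (intro PiM_cong refl distr_PiM_component[symmetric])
  finally show ?thesis
    by (subst indep_vars_iff_distr_eq_PiM'[OF False]) auto
qed

section \<open>Normal vectors with a common factor\<close>

text \<open>The type is an arbitrary Euclidean space because the law is used on \<open>real\<close>,
  on \<open>real^'n\<close> and on the product \<open>(real^'n) \<times> real\<close>.\<close>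

definition std_gauss :: "'a::euclidean_space measure" where
  "std_gauss = density lborel (\<lambda>x. ennreal (exp (- (norm x)\<^sup>2 / 2) / sqrt (2 * pi) ^ DIM('a)))"

lemma sets_std_gauss [simp, measurable_cong]: "sets std_gauss = sets borel"
  and space_std_gauss [simp]: "space std_gauss = UNIV"
  by (simp_all add: std_gauss_def)

lemma nn_integral_std_gauss:
  assumes [measurable]: "f \<in> borel_measurable (borel :: 'a::euclidean_space measure)"
  shows "(\<integral>\<^sup>+x. f x \<partial>std_gauss) =
    (\<integral>\<^sup>+x. ennreal (exp (- (norm (x::'a))\<^sup>2 / 2) / sqrt (2 * pi) ^ DIM('a)) * f x \<partial>lborel)"
  unfolding std_gauss_def by (subst nn_integral_density) auto

lemma std_gauss_real: "(std_gauss :: real measure) = density lborel std_normal_density"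
  unfolding std_gauss_def by (simp add: std_normal_density_def field_simps)

text \<open>The squared norm is the sum of the squared coordinates, so the density factorises along
  \<open>Basis\<close>. Total mass one and the one-dimensional marginals are read off from this
  form.\<close>

lemma std_gauss_eq_PiM:
  "(std_gauss :: 'a::euclidean_space measure) =
     distr (PiM Basis (\<lambda>_. std_gauss :: real measure)) borel (\<lambda>f. \<Sum>b\<in>Basis. f b *\<^sub>R b)"
proof -
  let ?S = "\<lambda>f::'a\<Rightarrow>real. \<Sum>b\<in>Basis. f b *\<^sub>R b"
  let ?g = "\<lambda>z::real. ennreal (exp (- z\<^sup>2 / 2) / sqrt (2 * pi))"
  have PS: "product_sigma_finite (\<lambda>_::'a. lborel :: real measure)" ..
  have PG: "PiM Basis (\<lambda>_::'a. std_gauss :: real measure) =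
      density (PiM Basis (\<lambda>_. lborel)) (\<lambda>f. \<Prod>b\<in>Basis. ?g (f b))" (is "_ = ?D")
  proof -
    have ps: "prob_space (std_gauss :: real measure)"
      unfolding std_gauss_real by (rule prob_space_normal_density) simp
    interpret P: product_prob_space "\<lambda>_::'a. std_gauss :: real measure"
      by (rule product_prob_spaceI) (rule ps)
    show ?thesis
    proof (rule P.PiM_eqI[symmetric])
      show "sets ?D = sets (Pi\<^sub>M Basis (\<lambda>_. std_gauss :: real measure))"
        by (simp) (rule sets_PiM_cong, auto)
      fix A :: "'a \<Rightarrow> real set" assume A: "\<And>i. i \<in> Basis \<Longrightarrow> A i \<in> sets std_gauss"
      have [measurable]: "\<And>i. i \<in> Basis \<Longrightarrow> A i \<in> sets borel" using A by auto
      have "emeasure ?D (Pi\<^sub>E Basis A) =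
          (\<integral>\<^sup>+f. (\<Prod>b\<in>Basis. ?g (f b)) * indicator (Pi\<^sub>E Basis A) f \<partial>PiM Basis (\<lambda>_. lborel))"
        by (subst emeasure_density) (auto intro!: sets_PiM_I_finite)
      also have "\<dots> = (\<integral>\<^sup>+f. (\<Prod>b\<in>Basis. ?g (f b) * indicator (A b) (f b)) \<partial>PiM Basis (\<lambda>_. lborel))"
        by (intro nn_integral_cong)
           (auto simp: space_PiM prod.distrib indicator_def PiE_iff prod_zero_iff split: if_splits)
      also have "\<dots> = (\<Prod>b\<in>Basis. \<integral>\<^sup>+z. ?g z * indicator (A b) z \<partial>lborel)"
        by (subst product_sigma_finite.product_nn_integral_prod[OF PS]) auto
      also have "\<dots> = (\<Prod>b\<in>Basis. emeasure std_gauss (A b))"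
        unfolding std_gauss_def by (intro prod.cong refl, subst emeasure_density) auto
      finally show "emeasure ?D (Pi\<^sub>E Basis A) = (\<Prod>b\<in>Basis. emeasure std_gauss (A b))" .
    qed simp
  qed
  show ?thesis
  proof (rule measure_eqI)
    fix A :: "'a set" assume "A \<in> sets std_gauss"
    then have [measurable]: "A \<in> sets borel" by simp
    have sq: "(norm (?S f))\<^sup>2 = (\<Sum>b\<in>Basis. (f b)\<^sup>2)" for f
      by (simp add: inner_sum_left inner_sum_right power2_norm_eq_inner
          inner_Basis if_distrib cong: if_cong) (simp add: power2_eq_square)
    have "emeasure std_gauss A =
      (\<integral>\<^sup>+x. ennreal (exp (- (norm x)\<^sup>2 / 2) / sqrt (2 * pi) ^ DIM('a)) * indicator A x \<partial>lborel)"
      unfolding std_gauss_def by (subst emeasure_density) auto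
    also have "\<dots> = (\<integral>\<^sup>+f. ennreal (exp (- (norm (?S f))\<^sup>2 / 2) / sqrt (2 * pi) ^ DIM('a)) * indicator A (?S f)
        \<partial>PiM Basis (\<lambda>_. lborel))"
      \<comment> \<open>Lebesgue measure on \<open>'a\<close> is by definition the image under
        \<open>?S\<close> of a product of one-dimensional Lebesgue measures, so the integral can be
        pulled back to coordinates.\<close>
      unfolding lborel_def[where 'a='a] lborel_eq_real by (subst nn_integral_distr) auto
    also have "\<dots> = (\<integral>\<^sup>+f. (\<Prod>b\<in>Basis. ?g (f b)) * indicator A (?S f) \<partial>PiM Basis (\<lambda>_. lborel))"
      by (simp add: sq prod_ennreal exp_sum prod_dividef sum_divide_distrib sum_negf[symmetric])
    also have "\<dots> = emeasure (distr ?D borel ?S) A"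
      by (subst emeasure_distr, simp, simp, subst emeasure_density)
         (auto intro!: nn_integral_cong simp: indicator_def)
    finally show "emeasure std_gauss A = emeasure (distr (Pi\<^sub>M Basis (\<lambda>_. std_gauss)) borel ?S) A"
      unfolding PG .
  qed simp
qed

lemma prob_space_std_gauss: "prob_space (std_gauss :: 'a::euclidean_space measure)"
proof -
  have ps: "prob_space (std_gauss :: real measure)"
    unfolding std_gauss_real by (rule prob_space_normal_density) simp
  show ?thesis
    by (subst std_gauss_eq_PiM, rule prob_space.prob_space_distr, rule prob_space_PiM, rule ps)
       (auto cong: measurable_cong_sets sets_PiM_cong)
qed

lemma distr_std_gauss_Basis:
  assumes "b \<in> Basis"
  shows "distr (std_gauss :: 'a::euclidean_space measure) borel (\<lambda>x. x \<bullet> b) = std_gauss"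
proof -
  have "distr (std_gauss :: 'a measure) borel (\<lambda>x. x \<bullet> b) =
      distr (PiM Basis (\<lambda>_. std_gauss :: real measure)) borel (\<lambda>f. (\<Sum>b\<in>Basis. f b *\<^sub>R b) \<bullet> b)"
    by (subst std_gauss_eq_PiM, subst distr_distr) (auto simp: o_def cong: measurable_cong_sets sets_PiM_cong)
  also have "(\<lambda>f. (\<Sum>b\<in>Basis. f b *\<^sub>R b) \<bullet> b) = (\<lambda>f::'a\<Rightarrow>real. f b)"
    using assms by (simp add: inner_sum_left inner_Basis if_distrib cong: if_cong)
  also have "distr (PiM Basis (\<lambda>_. std_gauss :: real measure)) borel (\<lambda>f::'a\<Rightarrow>real. f b) =
     distr (PiM Basis (\<lambda>_. std_gauss :: real measure)) std_gauss (\<lambda>f::'a\<Rightarrow>real. f b)"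
    by (rule distr_cong) auto
  also have "\<dots> = std_gauss"
    by (rule distr_PiM_component[OF prob_space_std_gauss assms])
  finally show ?thesis .
qed

text \<open>Squared norms and dimensions add on a product space. This splits the argument of
  \<open>common_factor\<close> into its vector part and its shared part.\<close>

lemma std_gauss_prod:
  "(std_gauss :: ('a::euclidean_space \<times> 'b::euclidean_space) measure) = std_gauss \<Otimes>\<^sub>M std_gauss"
proof -
  let ?f = "\<lambda>x::'a. ennreal (exp (- (norm x)\<^sup>2 / 2) / sqrt (2 * pi) ^ DIM('a))"
  let ?g = "\<lambda>x::'b. ennreal (exp (- (norm x)\<^sup>2 / 2) / sqrt (2 * pi) ^ DIM('b))"
  interpret B: prob_space "std_gauss :: 'b measure" by (rule prob_space_std_gauss)
  have sf: "sigma_finite_measure (density lborel ?g)"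
    using B.sigma_finite_measure_axioms unfolding std_gauss_def .
  have "(std_gauss :: 'a measure) \<Otimes>\<^sub>M (std_gauss :: 'b measure) = density (lborel \<Otimes>\<^sub>M lborel) (\<lambda>(x, y). ?f x * ?g y)"
    unfolding std_gauss_def by (rule pair_measure_density[OF _ _ sigma_finite_lborel sf]) measurable
  also have "\<dots> = density lborel (\<lambda>(x, y). ?f x * ?g y)"
    by (simp only: lborel_prod)
  also have "\<dots> = std_gauss"
    unfolding std_gauss_def
  proof (rule arg_cong[where f="density lborel"], rule ext)
    fix z :: "'a \<times> 'b"
    obtain x y where z: "z = (x, y)" by (cases z)
    have "- (norm z)\<^sup>2 / 2 = - (norm x)\<^sup>2 / 2 + - (norm y)\<^sup>2 / 2"
      by (simp add: z norm_prod_def)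
    then show "(case z of (x, y) \<Rightarrow> ?f x * ?g y) =
        ennreal (exp (- (norm z)\<^sup>2 / 2) / sqrt (2 * pi) ^ DIM('a \<times> 'b))"
      by (simp add: z exp_add[symmetric] power_add ennreal_mult[symmetric])
  qed
  finally show ?thesis ..
qed

lemma nn_integral_lborel_affine:
  fixes f :: "'a::euclidean_space \<Rightarrow> ennreal"
  assumes [measurable]: "f \<in> borel_measurable borel" and "c \<noteq> 0"
  shows "(\<integral>\<^sup>+x. f x \<partial>lborel) = ennreal (\<bar>c\<bar> ^ DIM('a)) * (\<integral>\<^sup>+x. f (t + c *\<^sub>R x) \<partial>lborel)"
  by (subst lborel_affine[OF \<open>c \<noteq> 0\<close>, of t])
     (simp add: nn_integral_density nn_integral_distr nn_integral_cmult ennreal_power)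

text \<open>A change of variables: with \<open>z = a x + b y\<close> in place of \<open>x\<close>,
  the joint density of \<open>y\<close> and \<open>z\<close> is the standard normal density of
  \<open>z\<close> times the conditional density of \<open>y\<close>, which is normal with mean
  \<open>b z\<close> and scale \<open>|a|\<close>. Solving for \<open>x\<close> requires
  \<open>a \<noteq> 0\<close>; otherwise \<open>b\<close> is 1 or -1 and the map is a reflection or
  the identity.\<close>

lemma std_gauss_rotate:
  fixes a b :: real
  assumes ab: "a\<^sup>2 + b\<^sup>2 = 1"
  shows "distr (std_gauss \<Otimes>\<^sub>M std_gauss) borel (\<lambda>(x, y). a *\<^sub>R x + b *\<^sub>R y) =
    (std_gauss :: 'a::euclidean_space measure)" (is "?D = _")
proof (cases "a = 0")
  case True
  interpret P: prob_space "std_gauss :: 'a measure" by (rule prob_space_std_gauss)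
  interpret PP: pair_prob_space "std_gauss :: 'a measure" "std_gauss :: 'a measure" ..
  have b: "\<bar>b\<bar> = 1" using ab True by (simp add: abs_square_eq_1[symmetric])
  show ?thesis
  proof (rule measure_eqI)
    fix A :: "'a set" assume "A \<in> sets (?D)"
    then have [measurable]: "A \<in> sets borel" by simp
    have "emeasure (?D) A
      = (\<integral>\<^sup>+z. indicator A z \<partial>?D)" by simp
    also have "\<dots> = (\<integral>\<^sup>+x. \<integral>\<^sup>+y. indicator A (b *\<^sub>R y) \<partial>(std_gauss :: 'a measure) \<partial>(std_gauss :: 'a measure))"
      using True by (subst nn_integral_distr) (auto simp: P.nn_integral_fst[symmetric])
    also have "\<dots> = (\<integral>\<^sup>+y. indicator A (b *\<^sub>R y) \<partial>(std_gauss :: 'a measure))"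
      by (simp add: P.emeasure_space_1[simplified])
    also have "\<dots> = (\<integral>\<^sup>+y. indicator A y \<partial>(std_gauss :: 'a measure))"
      apply (subst (1 2) nn_integral_std_gauss, simp, simp)
      apply (subst (2) nn_integral_lborel_affine[of _ b 0])
      using b by (auto simp: )
    finally show "emeasure (?D) A = emeasure std_gauss A"
      by simp
  qed simp
next
  case False
  interpret P: prob_space "std_gauss :: 'a measure" by (rule prob_space_std_gauss)
  interpret PP: pair_prob_space "std_gauss :: 'a measure" "std_gauss :: 'a measure" ..
  let ?\<phi> = "\<lambda>x::'a. exp (- (norm x)\<^sup>2 / 2) / sqrt (2 * pi) ^ DIM('a)"
  \<comment> \<open>Completing the square in \<open>y\<close>; \<open>a^2 + b^2 = 1\<close> is what
    makes the exponents agree. The second factor on the right is the conditional density of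
    \<open>y\<close> up to the Jacobian.\<close>
  have key: "?\<phi> ((1/a) *\<^sub>R (z - b *\<^sub>R y)) * ?\<phi> y = ?\<phi> z * ?\<phi> ((1/a) *\<^sub>R (y - b *\<^sub>R z))" for y z
  proof -
    have "(norm ((1/a) *\<^sub>R (z - b *\<^sub>R y)))\<^sup>2 + (norm y)\<^sup>2 = (norm z)\<^sup>2 + (norm ((1/a) *\<^sub>R (y - b *\<^sub>R z)))\<^sup>2"
    proof -
      have n: "(norm ((1/a) *\<^sub>R (z - b *\<^sub>R y)))\<^sup>2 = (z \<bullet> z - 2 * b * (z \<bullet> y) + b\<^sup>2 * (y \<bullet> y)) / a\<^sup>2" for z y :: 'a
      proof -
        have "(norm ((1/a) *\<^sub>R (z - b *\<^sub>R y)))\<^sup>2 = (norm (z - b *\<^sub>R y))\<^sup>2 / a\<^sup>2"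
          by (simp add: power_mult_distrib power_divide)
        also have "(norm (z - b *\<^sub>R y))\<^sup>2 = z \<bullet> z - 2 * b * (z \<bullet> y) + b\<^sup>2 * (y \<bullet> y)"
          unfolding power2_norm_eq_inner
          by (simp add: inner_diff_left inner_diff_right inner_commute power2_eq_square algebra_simps)
        finally show ?thesis .
      qed
      have arith: "(p - q + B * r) / A + r = p + (r - q + B * p) / A" if "A \<noteq> 0" "B = 1 - A" for p q r A B :: real
        using that(1) unfolding that(2) by (simp add: field_simps)
      show ?thesis unfolding n unfolding power2_norm_eq_inner
        using arith[of "a\<^sup>2" "b\<^sup>2" "z \<bullet> z" "2 * b * (z \<bullet> y)" "y \<bullet> y"] False ab by (simp add: inner_commute)
    qed
    then have "exp (- (norm ((1/a) *\<^sub>R (z - b *\<^sub>R y)))\<^sup>2 / 2) * exp (- (norm y)\<^sup>2 / 2) =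
        exp (- (norm z)\<^sup>2 / 2) * exp (- (norm ((1/a) *\<^sub>R (y - b *\<^sub>R z)))\<^sup>2 / 2)"
      unfolding exp_add[symmetric] by (simp add: field_simps)
    then show ?thesis by (simp add: mult.assoc)
  qed
  show ?thesis
  proof (rule measure_eqI)
    fix A :: "'a set" assume "A \<in> sets (?D)"
    then have [measurable]: "A \<in> sets borel" by simp
    let ?i = "indicator A :: 'a \<Rightarrow> ennreal"
    let ?c = "ennreal (\<bar>1/a\<bar> ^ DIM('a))"
    have "emeasure (?D) A
      = (\<integral>\<^sup>+z. ?i z \<partial>?D)" by simp
    also have "\<dots> = (\<integral>\<^sup>+y. \<integral>\<^sup>+x. ?i (a *\<^sub>R x + b *\<^sub>R y) \<partial>std_gauss \<partial>std_gauss)"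
      by (subst nn_integral_distr) (auto simp: PP.nn_integral_snd[symmetric])
    also have "\<dots> = (\<integral>\<^sup>+y. \<integral>\<^sup>+x. ennreal (?\<phi> y) * (ennreal (?\<phi> x) * ?i (a *\<^sub>R x + b *\<^sub>R y)) \<partial>lborel \<partial>lborel)"
      by (subst nn_integral_std_gauss, measurable, intro nn_integral_cong,
          subst nn_integral_std_gauss, measurable, subst nn_integral_cmult, auto)
    also have "\<dots> = (\<integral>\<^sup>+y. \<integral>\<^sup>+z. ?c *
        (ennreal (?\<phi> ((1/a) *\<^sub>R (z - b *\<^sub>R y)) * ?\<phi> y) * ?i z) \<partial>lborel \<partial>lborel)"
    proof (rule nn_integral_cong)
      fix y :: 'a
      show "(\<integral>\<^sup>+x. ennreal (?\<phi> y) * (ennreal (?\<phi> x) * ?i (a *\<^sub>R x + b *\<^sub>R y)) \<partial>lborel) =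
        (\<integral>\<^sup>+z. ?c *
        (ennreal (?\<phi> ((1/a) *\<^sub>R (z - b *\<^sub>R y)) * ?\<phi> y) * ?i z) \<partial>lborel)"
      proof -
        have e1: "- (b/a) *\<^sub>R y + (1/a) *\<^sub>R z = (1/a) *\<^sub>R (z - b *\<^sub>R y)" for z
          by (simp add: scaleR_diff_right)
        have e2: "a *\<^sub>R ((1/a) *\<^sub>R (z - b *\<^sub>R y)) + b *\<^sub>R y = z" for z
          using False by simp
        have "(\<integral>\<^sup>+x. ennreal (?\<phi> y) * (ennreal (?\<phi> x) * ?i (a *\<^sub>R x + b *\<^sub>R y)) \<partial>lborel) =
          ?c * (\<integral>\<^sup>+z. ennreal (?\<phi> y) * (ennreal (?\<phi> ((1/a) *\<^sub>R (z - b *\<^sub>R y))) * ?i z) \<partial>lborel)"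
          using False by (subst nn_integral_lborel_affine[of _ "1/a" "- (b/a) *\<^sub>R y"]) (simp_all only: e1 e2, simp_all)
        also have "\<dots> = (\<integral>\<^sup>+z. ?c *
          (ennreal (?\<phi> y) * (ennreal (?\<phi> ((1/a) *\<^sub>R (z - b *\<^sub>R y))) * ?i z)) \<partial>lborel)"
          by (rule nn_integral_cmult[symmetric]) simp
        also have "\<dots> = (\<integral>\<^sup>+z. ?c *
          (ennreal (?\<phi> ((1/a) *\<^sub>R (z - b *\<^sub>R y)) * ?\<phi> y) * ?i z) \<partial>lborel)"
          by (intro nn_integral_cong) (subst ennreal_mult, simp, simp, simp only: mult_ac)
        finally show ?thesis .
      qed
    qed
    also have "\<dots> = (\<integral>\<^sup>+y. \<integral>\<^sup>+z. ?c *
        (ennreal (?\<phi> z * ?\<phi> ((1/a) *\<^sub>R (y - b *\<^sub>R z))) * ?i z) \<partial>lborel \<partial>lborel)"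
      by (simp only: key)
    also have "\<dots> = (\<integral>\<^sup>+z. \<integral>\<^sup>+y. ?c *
        (ennreal (?\<phi> z * ?\<phi> ((1/a) *\<^sub>R (y - b *\<^sub>R z))) * ?i z) \<partial>lborel \<partial>lborel)"
      by (rule lborel_pair.Fubini') measurable
    also have "\<dots> = (\<integral>\<^sup>+z. ennreal (?\<phi> z) * ?i z \<partial>lborel)"
    proof (rule nn_integral_cong)
      fix z :: 'a
      \<comment> \<open>Substituting the affine map into the total mass of the standard normal shows
        that the conditional density of \<open>y\<close> integrates to one, which leaves the density
        of \<open>z\<close>.\<close>
      have "1 = (\<integral>\<^sup>+y. 1 \<partial>(std_gauss :: 'a measure))" by (simp add: P.emeasure_space_1[simplified])
      also have "\<dots> = (\<integral>\<^sup>+y. ennreal (?\<phi> y) \<partial>lborel)"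
        by (subst nn_integral_std_gauss) auto
      also have "\<dots> = ?c * (\<integral>\<^sup>+y. ennreal (?\<phi> ((1/a) *\<^sub>R (y - b *\<^sub>R z))) \<partial>lborel)"
        using False by (subst nn_integral_lborel_affine[of _ "1/a" "- (b/a) *\<^sub>R z"])
          (auto simp: scaleR_diff_right algebra_simps)
      finally have 1: "?c * (\<integral>\<^sup>+y. ennreal (?\<phi> ((1/a) *\<^sub>R (y - b *\<^sub>R z))) \<partial>lborel) = 1" ..
      have "(\<integral>\<^sup>+y. ?c *
        (ennreal (?\<phi> z * ?\<phi> ((1/a) *\<^sub>R (y - b *\<^sub>R z))) * ?i z) \<partial>lborel)
        = (\<integral>\<^sup>+y. (ennreal (?\<phi> z) * ?i z * ?c) * ennreal (?\<phi> ((1/a) *\<^sub>R (y - b *\<^sub>R z))) \<partial>lborel)"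
        by (rule nn_integral_cong, subst ennreal_mult, simp, simp) (simp only: mult_ac)
      also have "\<dots> = ennreal (?\<phi> z) * ?i z * (?c * (\<integral>\<^sup>+y. ennreal (?\<phi> ((1/a) *\<^sub>R (y - b *\<^sub>R z))) \<partial>lborel))"
        by (subst nn_integral_cmult) (auto simp: mult_ac)
      finally show "(\<integral>\<^sup>+y. ?c *
        (ennreal (?\<phi> z * ?\<phi> ((1/a) *\<^sub>R (y - b *\<^sub>R z))) * ?i z) \<partial>lborel) = ennreal (?\<phi> z) * ?i z"
        unfolding 1 by simp
    qed
    also have "\<dots> = emeasure std_gauss A"
      unfolding std_gauss_def by (subst emeasure_density) auto
    finally show "emeasure (?D) A = emeasure std_gauss A" .
  qed simp
qed

section \<open>Determinant, inverse and quadratic form of the identity plus the all-ones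
  matrix\<close>

lemma det_ones_row:
  fixes S :: "'n::finite set"
  assumes "finite S" "k \<notin> S"
  shows "det ((\<chi> i. if i = k then 1 else if i \<in> S then axis i 1 + 1 else axis i 1) :: real^'n^'n) = 1"
  using assms
proof (induction S rule: finite_induct)
  case empty
  have r: "row j (mat 1 :: real^'n^'n) = axis j 1" for j
    by (simp add: row_def mat_def axis_def vec_eq_iff eq_commute)
  \<comment> \<open>The all-ones row is row \<open>k\<close> of the identity plus the remaining unit
    rows, and adding to a row an element of the span of the others keeps the determinant.\<close>
  have "(\<Sum>j\<in>UNIV - {k}. axis j 1) \<in> vec.span {row j (mat 1 :: real^'n^'n) |j. j \<noteq> k}"
    by (intro vec.span_sum vec.span_base) (auto simp: r)
  from det_row_span[OF this] have d: "det ((\<chi> i. if i = k then row k (mat 1) + (\<Sum>j\<in>UNIV - {k}. axis j 1) else row i (mat 1)) :: real^'n^'n) = 1"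
    by simp
  have "row k (mat 1) + (\<Sum>j\<in>UNIV - {k}. axis j 1) = (1 :: real^'n)"
  proof -
    have "row k (mat 1) + (\<Sum>j\<in>UNIV - {k}. axis j 1) = (\<Sum>j\<in>UNIV. axis j (1::real) :: real^'n)"
      by (subst (2) sum.remove[of _ k]) (auto simp: r)
    also have "\<dots> = 1"
      by (simp add: vec_eq_iff axis_def)
    finally show ?thesis .
  qed
  with d have "det ((\<chi> i. if i = k then 1 else axis i 1) :: real^'n^'n) = 1"
    by (simp add: r cong: if_cong)
  then show ?case by (simp cong: if_cong)
next
  case (insert a S)
  let ?A = "(\<chi> i. if i = k then 1 else if i \<in> S then axis i 1 + 1 else axis i 1) :: real^'n^'n"
  have ak: "a \<noteq> k" using insert.prems by auto
  have r: "row i ?A = (if i = k then 1 else if i \<in> S then axis i 1 + 1 else axis i 1)" for i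
    by (simp add: row_def)
  \<comment> \<open>Row \<open>a\<close> acquires its all-ones part by adding row \<open>k\<close>,
    which consists of ones.\<close>
  have "(\<chi> i. if i = k then 1 else if i \<in> insert a S then axis i 1 + 1 else axis i 1) =
     (\<chi> i. if i = a then row a ?A + 1 *s row k ?A else row i ?A)"
    using ak insert.hyps unfolding r by (subst vec_eq_iff) auto
  then show ?case
    using det_row_operation[OF ak, of ?A 1] insert by simp
qed

text \<open>Rows receive their all-ones part one at a time. Linearity in the new row splits the
  determinant into the previous one and that of \<open>det_ones_row\<close>, so each row adds
  exactly 1. With \<open>S = UNIV\<close> the matrix is the identity plus all-ones.\<close>

lemma det_identity_plus_ones_rows:
  fixes S :: "'n::finite set"
  assumes "finite S"
  shows "det ((\<chi> i. if i \<in> S then axis i 1 + 1 else axis i 1) :: real^'n^'n) = 1 + real (card S)"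
  using assms
proof (induction S rule: finite_induct)
  case empty
  have "((\<chi> i. axis i 1) :: real^'n^'n) = mat 1"
    by (simp add: mat_def axis_def vec_eq_iff eq_commute)
  then show ?case by simp
next
  case (insert k S)
  let ?c = "\<lambda>i. if i \<in> S then axis i 1 + 1 else axis i 1 :: real^'n"
  have "(\<chi> i. if i \<in> insert k S then axis i 1 + 1 else axis i 1 :: real^'n^'n) =
      (\<chi> i. if i = k then axis k 1 + 1 else ?c i)"
    by (subst vec_eq_iff) auto
  also have "det \<dots> = det (\<chi> i. if i = k then axis k 1 else ?c i) + det (\<chi> i. if i = k then 1 else ?c i)"
    by (rule det_row_add)
  also have "(\<chi> i. if i = k then axis k 1 else ?c i) = (\<chi> i. ?c i)"
    using insert.hyps by (subst vec_eq_iff) auto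
  finally show ?case
    using insert det_ones_row[of S k] by simp
qed

lemma det_scaleR_Sigma_N:
  "det (c *\<^sub>R Sigma_N :: real^'n::finite^'n) = (c / 2) ^ CARD('n) * (1 + real CARD('n))"
proof -
  have "(c *\<^sub>R Sigma_N :: real^'n^'n) = (\<chi> i. (c / 2) *s (axis i 1 + 1))"
    by (simp add: Sigma_N_def mat_def axis_def vec_eq_iff eq_commute field_simps)
  also have "det \<dots> = (c / 2) ^ CARD('n) * det ((\<chi> i. axis i 1 + 1) :: real^'n^'n)"
    by (subst det_rows_mul) simp
  finally show ?thesis
    using det_identity_plus_ones_rows[of "UNIV :: 'n set"] by simp
qed

lemma matrix_inv_eqI:
  fixes A B :: "real^'n::finite^'n"
  assumes "A ** B = mat 1"
  shows "matrix_inv A = B"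
proof -
  have ba: "B ** A = mat 1" using assms by (simp add: matrix_left_right_inverse)
  have "A ** matrix_inv A = mat 1 \<and> matrix_inv A ** A = mat 1"
    unfolding matrix_inv_def by (rule someI[of _ B]) (use assms ba in simp)
  then have "B ** (A ** matrix_inv A) = B" by simp
  then show ?thesis using ba by (simp add: matrix_mul_assoc)
qed

text \<open>The Sherman-Morrison formula: identity plus all-ones has as inverse the identity minus
  all-ones divided by \<open>1 + CARD('n)\<close>.\<close>

lemma matrix_inv_scaleR_Sigma_N:
  assumes "c > 0"
  shows "matrix_inv (c *\<^sub>R Sigma_N :: real^'n::finite^'n) =
    (\<chi> i j. (2 / c) * ((if i = j then 1 else 0) - 1 / (1 + real CARD('n))))"
proof (rule matrix_inv_eqI)
  let ?N = "real CARD('n)"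
  define K where "K = 1 + ?N"
  have K: "K > 0" "?N = K - 1" by (auto simp: K_def)
  have "(\<Sum>k\<in>UNIV. (c *\<^sub>R Sigma_N :: real^'n^'n) $ i $ k * ((2 / c) * ((if k = j then 1 else 0) - 1 / K))) =
      (if i = j then 1 else 0)" for i j :: 'n
  proof -
    have "(c *\<^sub>R Sigma_N :: real^'n^'n) $ i $ k * ((2 / c) * ((if k = j then 1 else 0) - 1 / K)) =
      (if k = j then (if i = j then 1 else 0) + 1 else 0) - (if k = i then 1 / K else 0) - 1 / K" for k
      using assms K(1) by (auto simp: Sigma_N_def mat_def divide_simps)
    then have "(\<Sum>k\<in>UNIV. (c *\<^sub>R Sigma_N :: real^'n^'n) $ i $ k * ((2 / c) * ((if k = j then 1 else 0) - 1 / K))) =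
      (\<Sum>k\<in>UNIV. (if k = j then (if i = j then 1 else 0) + 1 else 0) - (if k = i then 1 / K else 0) - 1 / K)"
      by simp
    also have "\<dots> = (if i = j then 1 else 0)"
      using K by (simp add: sum_subtractf) (simp add: field_simps)
    finally show ?thesis .
  qed
  then show "(c *\<^sub>R Sigma_N :: real^'n^'n) ** (\<chi> i j. (2 / c) * ((if i = j then 1 else 0) - 1 / (1 + ?N))) = mat 1"
    unfolding K_def by (simp add: matrix_matrix_mult_def mat_def vec_eq_iff)
qed

lemma quadratic_form_inv_Sigma_N:
  fixes v :: "real^'n::finite"
  assumes "c > 0"
  shows "v \<bullet> (matrix_inv (c *\<^sub>R Sigma_N) *v v) = (2 / c) * ((norm v)\<^sup>2 - (v \<bullet> 1)\<^sup>2 / (1 + real CARD('n)))"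
proof -
  let ?N = "real CARD('n)"
  have *: "matrix_inv (c *\<^sub>R Sigma_N) *v v = (2 / c) *\<^sub>R (v - ((v \<bullet> 1) / (1 + ?N)) *\<^sub>R 1)"
  proof (rule vec_eq_iff[THEN iffD2], rule allI)
    fix i
    have "(matrix_inv (c *\<^sub>R Sigma_N) *v v) $ i =
        (\<Sum>j\<in>UNIV. (2 / c) * (if i = j then v $ j else 0) - (2 / c) / (1 + ?N) * v $ j)"
      unfolding matrix_vector_mult_def matrix_inv_scaleR_Sigma_N[OF assms]
      by (auto intro!: sum.cong simp: algebra_simps)
    also have "\<dots> = ((2 / c) *\<^sub>R (v - ((v \<bullet> 1) / (1 + ?N)) *\<^sub>R 1)) $ i"
      unfolding sum_subtractf sum_distrib_left[symmetric] by (simp add: inner_vec_def right_diff_distrib)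
    finally show "(matrix_inv (c *\<^sub>R Sigma_N) *v v) $ i = ((2 / c) *\<^sub>R (v - ((v \<bullet> 1) / (1 + ?N)) *\<^sub>R 1)) $ i" .
  qed
  show ?thesis
    unfolding * power2_norm_eq_inner by (simp add: inner_diff_right power2_eq_square)
qed

text \<open>Under \<open>std_gauss\<close> the own parts contribute half the identity to the
  covariance and the shared part half the all-ones matrix, which together is
  \<open>Sigma_N\<close>.\<close>

definition common_factor :: "(real^'n::finite) \<times> real \<Rightarrow> real^'n" where
  "common_factor z = sqrt (1 / 2) *\<^sub>R (fst z + snd z *\<^sub>R 1)"

lemma measurable_common_factor [measurable]: "common_factor \<in> borel_measurable borel"
  unfolding common_factor_def by (intro borel_measurable_continuous_onI continuous_intros)

lemma nn_integral_exp_square: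
  "(\<integral>\<^sup>+y. ennreal (exp (- y\<^sup>2 / 2)) \<partial>(lborel :: real measure)) = ennreal (sqrt (2 * pi))"
proof -
  interpret prob_space "std_gauss :: real measure" by (rule prob_space_std_gauss)
  have "1 = (\<integral>\<^sup>+y. 1 \<partial>(std_gauss :: real measure))" by (simp add: emeasure_space_1[simplified])
  also have "\<dots> = (\<integral>\<^sup>+y. ennreal (1 / sqrt (2 * pi)) * ennreal (exp (- y\<^sup>2 / 2)) \<partial>(lborel :: real measure))"
    by (subst nn_integral_std_gauss) (auto intro!: nn_integral_cong simp: ennreal_mult[symmetric])
  also have "\<dots> = ennreal (1 / sqrt (2 * pi)) * (\<integral>\<^sup>+y. ennreal (exp (- y\<^sup>2 / 2)) \<partial>(lborel :: real measure))"
    by (rule nn_integral_cmult) simp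
  finally have "ennreal (sqrt (2 * pi)) * 1 = ennreal (sqrt (2 * pi)) * ennreal (1 / sqrt (2 * pi)) * (\<integral>\<^sup>+y. ennreal (exp (- y\<^sup>2 / 2)) \<partial>(lborel :: real measure))"
    by (simp add: mult.assoc)
  also have "ennreal (sqrt (2 * pi)) * ennreal (1 / sqrt (2 * pi)) = 1"
    by (simp add: ennreal_mult[symmetric])
  finally show ?thesis by simp
qed

text \<open>The shared factor \<open>z\<close> is integrated out by completing the square. The
  coefficient of its square is \<open>K\<close>: 1 from its own density and \<open>CARD('n)\<close>
  from the squared norm of the all-ones vector. The remaining exponent is the quadratic form of the
  inverse of identity plus all-ones, and the Gaussian integral supplies the determinant factor
  \<open>1 / sqrt K\<close>.\<close>

lemma nn_integral_common_factor_density: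
  fixes w :: "real^'n::finite"
  defines "K \<equiv> 1 + real CARD('n)"
  shows "(\<integral>\<^sup>+z. ennreal (exp (- (norm z)\<^sup>2 / 2) / sqrt (2 * pi)) *
      ennreal (exp (- (norm (w - z *\<^sub>R 1))\<^sup>2 / 2) / sqrt (2 * pi) ^ CARD('n)) \<partial>lborel) =
    ennreal (exp (- ((norm w)\<^sup>2 - (w \<bullet> 1)\<^sup>2 / K) / 2) / (sqrt (2 * pi) ^ CARD('n) * sqrt K))"
proof -
  have K: "K > 0" "real CARD('n) = K - 1" by (auto simp: K_def)
  let ?C = "exp (- ((norm w)\<^sup>2 - (w \<bullet> 1)\<^sup>2 / K) / 2) / (sqrt (2 * pi) * sqrt (2 * pi) ^ CARD('n))"
  have n1: "(1 :: real^'n) \<bullet> 1 = real CARD('n)" by (simp add: inner_vec_def)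
  let ?t = "(w \<bullet> 1) / K"
  have exponent: "- (norm z)\<^sup>2 / 2 + - (norm (w - z *\<^sub>R 1))\<^sup>2 / 2 =
      - ((norm w)\<^sup>2 - (w \<bullet> 1)\<^sup>2 / K) / 2 + - K * (z - ?t)\<^sup>2 / 2" for z
  proof -
    have "(norm (w - z *\<^sub>R 1))\<^sup>2 = (norm w)\<^sup>2 - 2 * z * (w \<bullet> 1) + z\<^sup>2 * (K - 1)"
      unfolding power2_norm_eq_inner
      by (simp add: inner_diff_left inner_diff_right n1 K(2) inner_commute algebra_simps power2_eq_square)
    moreover have "K * (z - ?t)\<^sup>2 = K * z\<^sup>2 - 2 * z * (w \<bullet> 1) + (w \<bullet> 1)\<^sup>2 / K"
      using K(1) by (simp add: power2_eq_square field_simps)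
    ultimately show ?thesis by (simp add: field_simps)
  qed
  have "(\<integral>\<^sup>+z. ennreal (exp (- (norm z)\<^sup>2 / 2) / sqrt (2 * pi)) *
      ennreal (exp (- (norm (w - z *\<^sub>R 1))\<^sup>2 / 2) / sqrt (2 * pi) ^ CARD('n)) \<partial>lborel) =
    (\<integral>\<^sup>+z. ennreal ?C * ennreal (exp (- K * (z - ?t)\<^sup>2 / 2)) \<partial>lborel)"
  proof (rule nn_integral_cong)
    fix z :: real
    have "exp (- (norm z)\<^sup>2 / 2) * exp (- (norm (w - z *\<^sub>R 1))\<^sup>2 / 2) =
      exp (- ((norm w)\<^sup>2 - (w \<bullet> 1)\<^sup>2 / K) / 2) * exp (- K * (z - ?t)\<^sup>2 / 2)"
      unfolding exp_add[symmetric] exponent ..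
    then show "ennreal (exp (- (norm z)\<^sup>2 / 2) / sqrt (2 * pi)) *
      ennreal (exp (- (norm (w - z *\<^sub>R 1))\<^sup>2 / 2) / sqrt (2 * pi) ^ CARD('n)) =
      ennreal ?C * ennreal (exp (- K * (z - ?t)\<^sup>2 / 2))"
      by (subst (1 2) ennreal_mult[symmetric]) (simp_all del: norm_scaleR real_norm_def power2_abs)
  qed
  also have "\<dots> = ennreal ?C * (\<integral>\<^sup>+z. ennreal (exp (- K * (z - ?t)\<^sup>2 / 2)) \<partial>lborel)"
    by (rule nn_integral_cmult) simp
  also have "(\<integral>\<^sup>+z. ennreal (exp (- K * (z - ?t)\<^sup>2 / 2)) \<partial>lborel) =
      ennreal (1 / sqrt K) * (\<integral>\<^sup>+y. ennreal (exp (- y\<^sup>2 / 2)) \<partial>lborel)"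
    using K(1) by (subst nn_integral_lborel_affine[of _ "1 / sqrt K" ?t]) (simp_all add: power_divide)
  also have "ennreal ?C * (ennreal (1 / sqrt K) * (\<integral>\<^sup>+y. ennreal (exp (- y\<^sup>2 / 2)) \<partial>lborel)) =
    ennreal (?C * (1 / sqrt K * sqrt (2 * pi)))"
  proof -
    have "ennreal a * (ennreal b * ennreal d) = ennreal (a * (b * d))" if "a \<ge> 0" "b \<ge> 0" "d \<ge> 0" for a b d
      using that by (simp add: ennreal_mult)
    then show ?thesis using K(1) unfolding nn_integral_exp_square by simp
  qed
  also have "?C * (1 / sqrt K * sqrt (2 * pi)) =
    exp (- ((norm w)\<^sup>2 - (w \<bullet> 1)\<^sup>2 / K) / 2) / (sqrt (2 * pi) ^ CARD('n) * sqrt K)"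
    by (simp add: field_simps)
  finally show ?thesis .
qed

text \<open>A normal vector with covariance \<open>\<Sigma>\<close> is obtained from independent standard normals by adding
  one common factor to all components.\<close>

lemma multivariate_normal_Sigma_N:
  fixes \<mu> :: "real^'n::finite"
  assumes c: "c > 0"
  shows "multivariate_normal \<mu> (c *\<^sub>R Sigma_N) =
    distr std_gauss borel (\<lambda>z. \<mu> + sqrt c *\<^sub>R common_factor z)"
proof (rule measure_eqI)
  interpret P: prob_space "std_gauss :: (real^'n) measure" by (rule prob_space_std_gauss)
  interpret Q: prob_space "std_gauss :: real measure" by (rule prob_space_std_gauss)
  interpret PQ: pair_prob_space "std_gauss :: (real^'n) measure" "std_gauss :: real measure" ..
  fix A :: "(real^'n) set" assume "A \<in> sets (multivariate_normal \<mu> (c *\<^sub>R Sigma_N))"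
  then have [measurable]: "A \<in> sets borel" by (simp add: multivariate_normal_def)
  let ?i = "indicator A :: real^'n \<Rightarrow> ennreal"
  let ?s = "sqrt (c / 2)"
  let ?\<phi> = "\<lambda>x::real^'n. exp (- (norm x)\<^sup>2 / 2) / sqrt (2 * pi) ^ CARD('n)"
  let ?\<psi> = "\<lambda>z::real. exp (- (norm z)\<^sup>2 / 2) / sqrt (2 * pi)"
  let ?w = "\<lambda>u. (1 / ?s) *\<^sub>R (u - \<mu>)"
  let ?K = "1 + real CARD('n)"
  let ?c = "ennreal (\<bar>1/?s\<bar> ^ CARD('n))" and ?k = "\<lambda>u z. ennreal (?\<psi> z) * ennreal (?\<phi> (?w u - z *\<^sub>R 1)) * ?i u"
  let ?d = "\<lambda>u. exp (- ((u - \<mu>) \<bullet> (matrix_inv (c *\<^sub>R Sigma_N) *v (u - \<mu>))) / 2) / sqrt ((2 * pi) ^ CARD('n) * det (c *\<^sub>R Sigma_N :: real^'n^'n))"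
  have s: "?s > 0" using c by simp
  have cf: "\<mu> + sqrt c *\<^sub>R common_factor (x, z) = \<mu> + ?s *\<^sub>R (x + z *\<^sub>R 1)" for x :: "real^'n" and z
    by (simp add: common_factor_def real_sqrt_divide)
  have "emeasure (distr std_gauss borel (\<lambda>z. \<mu> + sqrt c *\<^sub>R common_factor z)) A =
    (\<integral>\<^sup>+u. ?i u \<partial>distr std_gauss borel (\<lambda>z. \<mu> + sqrt c *\<^sub>R common_factor z))" by simp
  also have "\<dots> = (\<integral>\<^sup>+z. \<integral>\<^sup>+x. ?i (\<mu> + ?s *\<^sub>R (x + z *\<^sub>R 1)) \<partial>std_gauss \<partial>std_gauss)"
  proof -
    have "(\<integral>\<^sup>+u. ?i u \<partial>distr std_gauss borel (\<lambda>z. \<mu> + sqrt c *\<^sub>R common_factor z)) =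
      (\<integral>\<^sup>+z. ?i (\<mu> + sqrt c *\<^sub>R common_factor z) \<partial>std_gauss)"
      by (rule nn_integral_distr) measurable
    also have "\<dots> = (\<integral>\<^sup>+z. \<integral>\<^sup>+x. ?i (\<mu> + sqrt c *\<^sub>R common_factor (x, z)) \<partial>std_gauss \<partial>std_gauss)"
      unfolding std_gauss_prod by (rule PQ.nn_integral_snd[symmetric]) (unfold std_gauss_prod[symmetric], measurable)
    finally show ?thesis by (simp only: cf)
  qed
  also have "\<dots> = (\<integral>\<^sup>+z. \<integral>\<^sup>+x. ennreal (?\<psi> z) * (ennreal (?\<phi> x) * ?i (\<mu> + ?s *\<^sub>R (x + z *\<^sub>R 1))) \<partial>lborel \<partial>lborel)"
    by (subst nn_integral_std_gauss, measurable, rule nn_integral_cong,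
        subst nn_integral_std_gauss, measurable, subst nn_integral_cmult, auto)
  \<comment> \<open>The value \<open>u\<close> of the vector replaces its independent part
    \<open>x\<close>. After exchanging the integrals, the shared factor \<open>z\<close> is the
    inner variable and can be integrated out.\<close>
  also have "\<dots> = (\<integral>\<^sup>+z. \<integral>\<^sup>+u. ?c *
        ?k u z \<partial>lborel \<partial>lborel)"
  proof (rule nn_integral_cong)
    fix z :: real
    have e1: "- (1 / ?s) *\<^sub>R \<mu> - z *\<^sub>R 1 + (1 / ?s) *\<^sub>R u = ?w u - z *\<^sub>R 1" for u
      by (simp add: scaleR_diff_right)
    have e2: "\<mu> + ?s *\<^sub>R (?w u - z *\<^sub>R 1 + z *\<^sub>R 1) = u" for u
      using s by simp
    have "(\<integral>\<^sup>+x. ennreal (?\<psi> z) * (ennreal (?\<phi> x) * ?i (\<mu> + ?s *\<^sub>R (x + z *\<^sub>R 1))) \<partial>lborel) =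
      ennreal (\<bar>1/?s\<bar> ^ DIM(real^'n)) *
      (\<integral>\<^sup>+u. ennreal (?\<psi> z) * (ennreal (?\<phi> (?w u - z *\<^sub>R 1)) * ?i u) \<partial>lborel)"
      using s by (subst nn_integral_lborel_affine[of _ "1/?s" "- (1 / ?s) *\<^sub>R \<mu> - z *\<^sub>R 1"]) (simp_all only: e1 e2, simp_all)
    also have "\<dots> = (\<integral>\<^sup>+u. ?c *
        ?k u z \<partial>lborel)"
      by (subst nn_integral_cmult) (simp_all add: mult.assoc)
    finally show "(\<integral>\<^sup>+x. ennreal (?\<psi> z) * (ennreal (?\<phi> x) * ?i (\<mu> + ?s *\<^sub>R (x + z *\<^sub>R 1))) \<partial>lborel) =
      (\<integral>\<^sup>+u. ?c *
        ?k u z \<partial>lborel)" .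
  qed
  also have "\<dots> = (\<integral>\<^sup>+u. \<integral>\<^sup>+z. ?c *
        ?k u z \<partial>lborel \<partial>lborel)"
    by (rule lborel_pair.Fubini') measurable
  also have "\<dots> = (\<integral>\<^sup>+u. ennreal (?d u) * ?i u \<partial>lborel)"
  proof (rule nn_integral_cong)
    fix u :: "real^'n"
    have "(\<integral>\<^sup>+z. ?c *
        ?k u z \<partial>lborel) =
      (\<integral>\<^sup>+z. (?c * ?i u) *
        (ennreal (?\<psi> z) * ennreal (?\<phi> (?w u - z *\<^sub>R 1))) \<partial>lborel)"
      by (intro nn_integral_cong) (simp only: mult_ac)
    also have "\<dots> = (?c * ?i u) *
        (\<integral>\<^sup>+z. ennreal (?\<psi> z) * ennreal (?\<phi> (?w u - z *\<^sub>R 1)) \<partial>lborel)"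
      by (rule nn_integral_cmult) measurable
    also have "\<dots> = ennreal (\<bar>1/?s\<bar> ^ CARD('n) *
      (exp (- ((norm (?w u))\<^sup>2 - (?w u \<bullet> 1)\<^sup>2 / ?K) / 2) / (sqrt (2 * pi) ^ CARD('n) * sqrt ?K))) * ?i u"
    proof -
      have "ennreal a * i * ennreal b = ennreal (a * b) * i" if "a \<ge> 0" "b \<ge> 0" for a b and i :: ennreal
        using that by (simp add: ennreal_mult mult_ac)
      then show ?thesis unfolding nn_integral_common_factor_density by simp
    qed
    \<comment> \<open>Matching constants: the power of \<open>?s\<close> from the Jacobian and
      \<open>sqrt ?K\<close> form the square root of the determinant of the covariance, and
      rescaling \<open>?w u\<close> by \<open>?s\<close> puts the factor \<open>2 / c\<close> in
      front of the quadratic form.\<close>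
    also have "\<bar>1/?s\<bar> ^ CARD('n) *
      (exp (- ((norm (?w u))\<^sup>2 - (?w u \<bullet> 1)\<^sup>2 / ?K) / 2) / (sqrt (2 * pi) ^ CARD('n) * sqrt ?K)) =
      ?d u"
    proof -
      have "(norm (?w u))\<^sup>2 - (?w u \<bullet> 1)\<^sup>2 / ?K = (2 / c) * ((norm (u - \<mu>))\<^sup>2 - ((u - \<mu>) \<bullet> 1)\<^sup>2 / ?K)"
      proof -
        have "(norm (?w u))\<^sup>2 = (2 / c) * (norm (u - \<mu>))\<^sup>2" "(?w u \<bullet> 1)\<^sup>2 = (2 / c) * ((u - \<mu>) \<bullet> 1)\<^sup>2"
          using c by (simp_all add: power_mult_distrib power_divide)
        then show ?thesis by (simp add: right_diff_distrib)
      qed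
      moreover have "sqrt ((2 * pi) ^ CARD('n) * det (c *\<^sub>R Sigma_N :: real^'n^'n)) =
        sqrt (2 * pi) ^ CARD('n) * (?s ^ CARD('n) * sqrt ?K)"
        unfolding det_scaleR_Sigma_N by (simp only: real_sqrt_mult real_sqrt_power power_mult_distrib)
      moreover have "\<bar>1/?s\<bar> ^ CARD('n) * (E / (Q * k)) = E / (Q * (?s ^ CARD('n) * k))" for E Q k :: real
        using s by (simp add: power_one_over)
      ultimately show ?thesis
        unfolding quadratic_form_inv_Sigma_N[OF c] by (simp only:)
    qed
    finally show "(\<integral>\<^sup>+z. ?c *
        ?k u z \<partial>lborel) =
        ennreal (?d u) * ?i u" .
  qed
  also have "\<dots> = emeasure (multivariate_normal \<mu> (c *\<^sub>R Sigma_N)) A"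
    unfolding multivariate_normal_def
  proof (subst emeasure_density)
    have "(\<lambda>x. (x - \<mu>) \<bullet> (matrix_inv (c *\<^sub>R Sigma_N) *v (x - \<mu>))) \<in> borel_measurable borel"
      unfolding quadratic_form_inv_Sigma_N[OF c] by measurable
    then show "(\<lambda>x. ennreal (exp (- ((x - \<mu>) \<bullet> (matrix_inv (c *\<^sub>R Sigma_N) *v (x - \<mu>))) / 2) /
      sqrt ((2 * pi) ^ CARD('n) * det (c *\<^sub>R Sigma_N :: real^'n^'n)))) \<in> borel_measurable lborel"
      by measurable
  qed auto
  finally show "emeasure (multivariate_normal \<mu> (c *\<^sub>R Sigma_N)) A =
    emeasure (distr std_gauss borel (\<lambda>z. \<mu> + sqrt c *\<^sub>R common_factor z)) A" ..
qed (simp add: multivariate_normal_def)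

abbreviation noise :: "(real^'n::finite) measure" where
  "noise \<equiv> multivariate_normal 0 Sigma_N"

lemma sets_multivariate_normal [simp, measurable_cong]: "sets (multivariate_normal \<mu> S) = sets borel"
  and space_multivariate_normal [simp]: "space (multivariate_normal \<mu> S) = UNIV"
  by (simp_all add: multivariate_normal_def)

lemma noise_eq_distr: "noise = distr std_gauss borel common_factor"
  using multivariate_normal_Sigma_N[of 1 0] by simp

lemma prob_space_noise: "prob_space noise"
  unfolding noise_eq_distr by (intro prob_space.prob_space_distr prob_space_std_gauss) measurable

lemma multivariate_normal_eq_distr_noise:
  assumes "c > 0"
  shows "multivariate_normal \<mu> (c *\<^sub>R Sigma_N) = distr noise borel (\<lambda>x. \<mu> + sqrt c *\<^sub>R x)"
  unfolding multivariate_normal_Sigma_N[OF assms] noise_eq_distr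
  by (subst distr_distr) (auto simp: o_def)

text \<open>\<open>Sigma_N\<close> has unit diagonal: a component is \<open>sqrt (1 / 2)\<close>
  times a sum of two independent standard normals, a rotation by 45 degrees. Scalar moments of the
  noise are therefore those of \<open>std_gauss\<close>.\<close>

lemma distr_noise_component:
  "distr (noise :: (real^'n::finite) measure) borel (\<lambda>u. u $ n) = std_gauss"
proof -
  interpret Q: prob_space "std_gauss :: real measure" by (rule prob_space_std_gauss)
  have "distr (noise :: (real^'n) measure) borel (\<lambda>u. u $ n) =
      distr std_gauss borel (\<lambda>z :: (real^'n) \<times> real. sqrt (1 / 2) *\<^sub>R (fst z \<bullet> axis n 1) + sqrt (1 / 2) *\<^sub>R snd z)"
    unfolding noise_eq_distr
    by (subst distr_distr) (auto simp: o_def common_factor_def inner_axis distrib_left)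
  also have "\<dots> = distr (distr (std_gauss \<Otimes>\<^sub>M std_gauss) (borel \<Otimes>\<^sub>M borel) (\<lambda>(x :: real^'n, y :: real). (x \<bullet> axis n 1, y)))
      borel (\<lambda>(x, y). sqrt (1 / 2) *\<^sub>R x + sqrt (1 / 2) *\<^sub>R y)"
    unfolding std_gauss_prod by (subst distr_distr) (auto simp: o_def split_beta')
  also have "distr (std_gauss \<Otimes>\<^sub>M std_gauss) (borel \<Otimes>\<^sub>M borel) (\<lambda>(x :: real^'n, y :: real). (x \<bullet> axis n 1, y)) =
      distr std_gauss borel (\<lambda>x :: real^'n. x \<bullet> axis n 1) \<Otimes>\<^sub>M distr std_gauss borel (\<lambda>y. y)"
    by (subst pair_measure_distr) (auto intro!: prob_space_imp_sigma_finite Q.prob_space_distr)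
  also have "distr std_gauss borel (\<lambda>x :: real^'n. x \<bullet> axis n 1) = std_gauss"
    by (rule distr_std_gauss_Basis) simp
  also have "distr (std_gauss :: real measure) borel (\<lambda>y. y) = std_gauss"
    by (rule distr_id2) simp
  also have "distr (std_gauss \<Otimes>\<^sub>M std_gauss) borel (\<lambda>(x, y). sqrt (1 / 2) *\<^sub>R x + sqrt (1 / 2) *\<^sub>R y) = (std_gauss :: real measure)"
    by (rule std_gauss_rotate) simp
  finally show ?thesis .
qed

text \<open>\<open>common_factor\<close> is linear, so a combination of two noise vectors is
  \<open>common_factor\<close> of the same combination of Gaussian arguments; divided by
  \<open>r\<close>, the coefficients lie on the unit circle and \<open>std_gauss_rotate\<close>
  applies on the product space. If both coefficients are 0, both laws are the point mass at
  0.\<close>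

lemma noise_stable:
  "distr (noise \<Otimes>\<^sub>M noise) borel (\<lambda>(x, y). a *\<^sub>R x + b *\<^sub>R y) =
   distr (noise :: (real^'n::finite) measure) borel (\<lambda>x. sqrt (a\<^sup>2 + b\<^sup>2) *\<^sub>R x)"
proof (cases "a = 0 \<and> b = 0")
  case True
  interpret P: prob_space "noise :: (real^'n) measure" by (rule prob_space_noise)
  interpret PP: pair_prob_space "noise :: (real^'n) measure" "noise :: (real^'n) measure" ..
  have "emeasure (noise \<Otimes>\<^sub>M noise :: ((real^'n) \<times> (real^'n)) measure) UNIV = 1"
    using PP.P.emeasure_space_1 by (simp add: space_pair_measure)
  then show ?thesis
    using True by (intro measure_eqI) (auto simp: split_beta' emeasure_distr P.emeasure_space_1[simplified]
        space_pair_measure indicator_def vimage_def)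
next
  case False
  define r where "r = sqrt (a\<^sup>2 + b\<^sup>2)"
  have "a\<^sup>2 + b\<^sup>2 > 0" using False by (auto simp: sum_power2_gt_zero_iff)
  then have r: "r > 0" "r\<^sup>2 = a\<^sup>2 + b\<^sup>2" by (auto simp: r_def)
  have ab: "(a / r)\<^sup>2 + (b / r)\<^sup>2 = 1"
    using \<open>a\<^sup>2 + b\<^sup>2 > 0\<close> False unfolding power_divide r(2) add_divide_distrib[symmetric] by auto
  let ?c = "common_factor :: _ \<Rightarrow> real^'n"
  have lin: "a *\<^sub>R ?c x + b *\<^sub>R ?c y = r *\<^sub>R ?c ((a / r) *\<^sub>R x + (b / r) *\<^sub>R y)" for x y
    using r(1) by (simp add: common_factor_def algebra_simps)
  have sf: "sigma_finite_measure (distr std_gauss borel ?c)"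
    using prob_space_noise unfolding noise_eq_distr by (rule prob_space_imp_sigma_finite)
  have "distr (noise \<Otimes>\<^sub>M noise) borel (\<lambda>(x, y). a *\<^sub>R x + b *\<^sub>R y) =
     distr (distr (std_gauss \<Otimes>\<^sub>M std_gauss) (borel \<Otimes>\<^sub>M borel) (\<lambda>(x, y). (?c x, ?c y))) borel (\<lambda>(x, y). a *\<^sub>R x + b *\<^sub>R y)"
    unfolding noise_eq_distr by (subst pair_measure_distr[OF _ _ sf]) auto
  also have "\<dots> = distr (std_gauss \<Otimes>\<^sub>M std_gauss) borel (\<lambda>(x, y). r *\<^sub>R ?c ((a / r) *\<^sub>R x + (b / r) *\<^sub>R y))"
    by (subst distr_distr) (auto simp: o_def split_beta' lin)
  also have "\<dots> = distr (distr (std_gauss \<Otimes>\<^sub>M std_gauss) borel (\<lambda>(x, y). (a / r) *\<^sub>R x + (b / r) *\<^sub>R y)) borel (\<lambda>z. r *\<^sub>R ?c z)"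
    by (subst distr_distr) (auto simp: o_def split_beta')
  also have "\<dots> = distr std_gauss borel (\<lambda>z. r *\<^sub>R ?c z)"
    unfolding std_gauss_rotate[OF ab] ..
  also have "\<dots> = distr noise borel (\<lambda>x. r *\<^sub>R x)"
    unfolding noise_eq_distr by (subst distr_distr) (auto simp: o_def)
  finally show ?thesis unfolding r_def .
qed

text \<open>Stability, one summand at a time, with scales adding in squares. The coefficients are
  deterministic, so in the application the state has to be frozen first.\<close>

lemma (in prob_space) distr_sum_indep_noise:
  fixes X :: "'i \<Rightarrow> 'a \<Rightarrow> real^'n::finite"
  assumes "finite I" "indep_vars (\<lambda>_. borel) X I" "\<And>i. i \<in> I \<Longrightarrow> distr M borel (X i) = noise"
  shows "distr M borel (\<lambda>\<omega>. \<Sum>i\<in>I. c i *\<^sub>R X i \<omega>) = distr noise borel (\<lambda>x. sqrt (\<Sum>i\<in>I. (c i)\<^sup>2) *\<^sub>R x)"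
  using assms
proof (induction I rule: finite_induct)
  case empty
  interpret P: prob_space "noise :: (real^'n) measure" by (rule prob_space_noise)
  show ?case
    by (intro measure_eqI) (auto simp: emeasure_distr P.emeasure_space_1[simplified] emeasure_space_1 indicator_def vimage_def)
next
  case (insert j I)
  interpret P: prob_space "noise :: (real^'n) measure" by (rule prob_space_noise)
  have rv [measurable]: "\<And>i. i \<in> insert j I \<Longrightarrow> random_variable borel (X i)"
    using insert.prems(1) by (auto simp: indep_vars_def)
  let ?S = "\<lambda>\<omega>. \<Sum>i\<in>I. c i *\<^sub>R X i \<omega>" and ?s = "sqrt (\<Sum>i\<in>I. (c i)\<^sup>2)"
  have IH: "distr M borel ?S = distr noise borel (\<lambda>x. ?s *\<^sub>R x)"
    using insert.IH[OF indep_vars_subset[OF insert.prems(1)]] insert.prems by auto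
  \<comment> \<open>The partial sum is a function of the variables indexed by \<open>I\<close>
    alone, and \<open>j\<close> lies outside \<open>I\<close>.\<close>
  have "indep_var borel ((\<lambda>f. f j) \<circ> (\<lambda>\<omega>. restrict (\<lambda>i. X i \<omega>) {j}))
      borel ((\<lambda>f. \<Sum>i\<in>I. c i *\<^sub>R f i) \<circ> (\<lambda>\<omega>. restrict (\<lambda>i. X i \<omega>) I))"
    using insert.hyps by (intro indep_var_compose[OF indep_var_restrict[OF insert.prems(1)]]) auto
  also have "((\<lambda>f. f j) \<circ> (\<lambda>\<omega>. restrict (\<lambda>i. X i \<omega>) {j})) = X j" by auto
  also have "((\<lambda>f. \<Sum>i\<in>I. c i *\<^sub>R f i) \<circ> (\<lambda>\<omega>. restrict (\<lambda>i. X i \<omega>) I)) = ?S"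
    by (auto cong: rev_conj_cong)
  finally have iv: "indep_var borel (X j) borel ?S" .
  have joint: "distr M (borel \<Otimes>\<^sub>M borel) (\<lambda>\<omega>. (X j \<omega>, ?S \<omega>)) = noise \<Otimes>\<^sub>M distr noise borel (\<lambda>x. ?s *\<^sub>R x)"
    using iv insert.prems(2)[of j] IH unfolding indep_var_distribution_eq by simp
  have "noise \<Otimes>\<^sub>M distr noise borel (\<lambda>x. ?s *\<^sub>R x) = distr (noise :: (real^'n) measure) borel (\<lambda>x. x) \<Otimes>\<^sub>M distr noise borel (\<lambda>x :: real^'n. ?s *\<^sub>R x)"
    by (subst distr_id2) simp_all
  also have "\<dots> = distr (noise \<Otimes>\<^sub>M noise) (borel \<Otimes>\<^sub>M borel) (\<lambda>(x :: real^'n, y :: real^'n). (x, ?s *\<^sub>R y))"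
    by (subst pair_measure_distr, simp, simp, rule prob_space_imp_sigma_finite, rule P.prob_space_distr, simp_all)
  finally have joint2: "noise \<Otimes>\<^sub>M distr noise borel (\<lambda>x :: real^'n. ?s *\<^sub>R x) = distr (noise \<Otimes>\<^sub>M noise) (borel \<Otimes>\<^sub>M borel) (\<lambda>(x :: real^'n, y :: real^'n). (x, ?s *\<^sub>R y))" .
  have "distr M borel (\<lambda>\<omega>. \<Sum>i\<in>insert j I. c i *\<^sub>R X i \<omega>) =
    distr (distr M (borel \<Otimes>\<^sub>M borel) (\<lambda>\<omega>. (X j \<omega>, ?S \<omega>))) borel (\<lambda>(x, y). c j *\<^sub>R x + y)"
    using insert.hyps by (subst distr_distr) (auto simp: o_def)
  also have "\<dots> = distr (noise \<Otimes>\<^sub>M noise) borel (\<lambda>(x, y). c j *\<^sub>R x + ?s *\<^sub>R y)"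
    unfolding joint joint2 by (subst distr_distr) (auto simp: o_def split_beta')
  also have "\<dots> = distr noise borel (\<lambda>x. sqrt ((c j)\<^sup>2 + ?s\<^sup>2) *\<^sub>R x)"
    by (rule noise_stable)
  also have "(c j)\<^sup>2 + ?s\<^sup>2 = (\<Sum>i\<in>insert j I. (c i)\<^sup>2)"
    using insert.hyps by (simp add: sum_nonneg)
  finally show ?case .
qed

section \<open>The softmax function\<close>

definition softmax :: "('k::finite \<Rightarrow> real) \<Rightarrow> 'k \<Rightarrow> real" where
  "softmax h k = exp (h k) / (\<Sum>j\<in>UNIV. exp (h j))"

lemma softmax_pos: "softmax h k > 0"
  unfolding softmax_def by (intro divide_pos_pos sum_pos) auto

lemma sum_softmax: "(\<Sum>k\<in>UNIV. softmax h k) = 1"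
proof -
  have "(\<Sum>j\<in>UNIV. exp (h j)) > 0" by (intro sum_pos) auto
  then show ?thesis unfolding softmax_def sum_divide_distrib[symmetric] by simp
qed

lemma softmax_le_1: "softmax h k \<le> 1"
  using member_le_sum[of k UNIV "softmax h"] softmax_pos[of h] by (simp add: sum_softmax less_imp_le)

text \<open>A common factor cancels in the selection probabilities. This is what allows the density
  of a candidate path to be divided by that of the current state.\<close>

lemma softmax_add_const: "softmax (\<lambda>k. h k + c) = softmax h"
  by (simp add: softmax_def exp_add sum_distrib_right[symmetric] fun_eq_iff)

text \<open>Passing from \<open>h\<close> to \<open>g\<close> lowers the numerator by at most the
  factor \<open>exp (- e)\<close> and raises the normaliser by at most \<open>exp e\<close>, so the
  probability shrinks by at most \<open>exp (- 2 * e)\<close>, and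
  \<open>1 - exp (- 2 * e) \<le> 2 * e\<close>.\<close>

lemma softmax_diff_le_of_uniform:
  fixes h g :: "'k::finite \<Rightarrow> real"
  assumes "\<And>j. \<bar>h j - g j\<bar> \<le> e"
  shows "softmax h k - softmax g k \<le> 2 * e"
proof -
  let ?H = "\<Sum>j\<in>UNIV. exp (h j)" and ?G = "\<Sum>j\<in>UNIV. exp (g j)"
  have pos: "?H > 0" "?G > 0" by (auto intro!: sum_pos)
  have le1: "exp (h k) / ?H \<le> 1"
    using softmax_le_1[of h k] by (simp add: softmax_def)
  have e: "e \<ge> 0" using assms[of k] by linarith
  have "?G \<le> exp e * ?H"
    unfolding sum_distrib_left exp_add[symmetric] using assms by (intro sum_mono) (smt (verit) exp_le_cancel_iff)
  moreover have "exp (h k) * exp (- e) \<le> exp (g k)"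
    unfolding exp_add[symmetric] using assms[of k] by simp
  ultimately have "exp (h k) * exp (- e) / (exp e * ?H) \<le> exp (g k) / ?G"
    using pos by (intro frac_le) auto
  also have "exp (h k) * exp (- e) / (exp e * ?H) = exp (- 2 * e) * (exp (h k) / ?H)"
    by (simp add: exp_minus field_simps exp_double power2_eq_square flip: exp_add)
  finally have "exp (h k) / ?H - exp (g k) / ?G \<le> (1 - exp (- 2 * e)) * (exp (h k) / ?H)"
    unfolding left_diff_distrib by linarith
  also have "\<dots> \<le> (1 - exp (- 2 * e)) * 1"
    using e le1 by (intro mult_left_mono) auto
  also have "\<dots> \<le> 2 * e" using exp_ge_add_one_self[of "- 2 * e"] by simp
  finally show ?thesis unfolding softmax_def .
qed

text \<open>The maximal deviation is replaced by the sum over labels because L1 errors are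
  controlled label by label.\<close>

lemma softmax_diff_le:
  fixes h g :: "'k::finite \<Rightarrow> real"
  shows "\<bar>softmax h k - softmax g k\<bar> \<le> 2 * (\<Sum>j\<in>UNIV. \<bar>h j - g j\<bar>)"
proof -
  have "\<bar>h i - g i\<bar> \<le> (\<Sum>j\<in>UNIV. \<bar>h j - g j\<bar>)" "\<bar>g i - h i\<bar> \<le> (\<Sum>j\<in>UNIV. \<bar>h j - g j\<bar>)" for i
    using member_le_sum[of i UNIV "\<lambda>j. \<bar>h j - g j\<bar>"] by (auto simp: abs_minus_commute)
  from softmax_diff_le_of_uniform[of h g, OF this(1), of k] softmax_diff_le_of_uniform[of g h, OF this(2), of k]
  show ?thesis by linarith
qed

section \<open>Smooth target densities\<close>

lemma
  fixes g :: "'a::euclidean_space \<Rightarrow> real"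
  assumes "integrable lborel g"
  shows integrable_lborel_translate: "integrable lborel (\<lambda>x. g (x + c))"
    and integral_lborel_translate: "(\<integral>x. g (x + c) \<partial>lborel) = (\<integral>x. g x \<partial>lborel)"
proof -
  have [measurable]: "g \<in> borel_measurable borel" using assms by auto
  have d: "lborel = distr lborel borel ((+) c)" by (rule lborel_distr_plus[symmetric])
  show "integrable lborel (\<lambda>x. g (x + c))"
    using assms by (subst (asm) d, subst (asm) integrable_distr_eq) (auto simp: add.commute)
  show "(\<integral>x. g (x + c) \<partial>lborel) = (\<integral>x. g x \<partial>lborel)"
    by (subst (2) d, subst integral_distr) (auto simp: add.commute)
qed

text \<open>Translation invariance takes the place of boundary terms. The integral of
  \<open>g (x + e) - g x\<close> is 0; the fundamental theorem along the segment from
  \<open>x\<close> to \<open>x + e\<close> writes it as an average over \<open>h\<close> in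
  \<open>{0..1}\<close> of integrals of \<open>g'\<close> translated by
  \<open>h *\<^sub>R e\<close>, and these are all equal.\<close>

lemma integral_directional_derivative_eq_0:
  fixes g g' :: "'a::euclidean_space \<Rightarrow> real"
  assumes deriv: "\<And>x h. ((\<lambda>h. g (x + h *\<^sub>R e)) has_real_derivative g' (x + h *\<^sub>R e)) (at h)"
    and cont: "continuous_on UNIV g'"
    and g: "integrable lborel g" and g': "integrable lborel g'"
  shows "(\<integral>x. g' x \<partial>lborel) = 0"
proof -
  have [measurable]: "g' \<in> borel_measurable borel" using cont by (rule borel_measurable_continuous_onI)
  let ?f = "\<lambda>(h::real) x::'a. g' (x + h *\<^sub>R e) * indicator {0..1} h"
  have contg: "isCont (\<lambda>h. g' (x + h *\<^sub>R e)) h" for x and h :: real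
    using continuous_on_compose2[OF cont, of UNIV "\<lambda>h. x + h *\<^sub>R e"]
    by (auto simp: continuous_on_eq_continuous_at intro!: continuous_intros)
  have FTC: "(\<integral>h. ?f h x \<partial>lborel) = g (x + e) - g x" for x
    using integral_FTC_Icc_real[of 0 1 "\<lambda>h. g (x + h *\<^sub>R e)" "\<lambda>h. g' (x + h *\<^sub>R e)"] deriv contg by simp
  have int: "integrable (lborel \<Otimes>\<^sub>M lborel) (\<lambda>(h, x). ?f h x)"
  proof (rule lborel_pair.Fubini_integrable)
    have "(\<integral>x. norm (g' (x + h *\<^sub>R e) * indicator {0..1} h) \<partial>lborel) = (\<integral>x. norm (g' x) \<partial>lborel) * indicator {0..1} h" for h
      using integral_lborel_translate[OF integrable_norm[OF g'], of "h *\<^sub>R e"]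
      by (auto simp: abs_mult indicator_def)
    then show "integrable lborel (\<lambda>h. \<integral>x. norm (case (h, x) of (h, x) \<Rightarrow> ?f h x) \<partial>lborel)"
      by (simp add: integrable_real_mult_indicator)
    show "AE h in lborel. integrable lborel (\<lambda>x. case (h, x) of (h, x) \<Rightarrow> ?f h x)"
      using integrable_lborel_translate[OF g'] by auto
  qed measurable
  have "0 = (\<integral>x. g (x + e) - g x \<partial>lborel)"
    using integrable_lborel_translate[OF g, of e] integral_lborel_translate[OF g, of e] g by simp
  also have "\<dots> = (\<integral>x. \<integral>h. ?f h x \<partial>lborel \<partial>lborel)" by (simp only: FTC)
  also have "\<dots> = (\<integral>h. \<integral>x. ?f h x \<partial>lborel \<partial>lborel)"
    using lborel_pair.Fubini_integral[OF int] by simp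
  also have "\<dots> = (\<integral>h. (\<integral>x. g' x \<partial>lborel) * indicator {0..1::real} h \<partial>lborel)"
    unfolding integral_mult_left_zero integral_lborel_translate[OF g'] ..
  also have "\<dots> = (\<integral>x. g' x \<partial>lborel)" by simp
  finally show ?thesis ..
qed

lemma partial_eq_derivative:
  assumes "(f has_derivative F) (at x)"
  shows "partial t f x = F (axis t 1)"
proof -
  have "((\<lambda>h. f (x + h *\<^sub>R axis t 1)) has_derivative (\<lambda>h. F (h *\<^sub>R axis t 1))) (at 0)"
  proof (rule has_derivative_compose[of _ _ 0 UNIV f F, simplified])
    show "((\<lambda>h. x + h *\<^sub>R axis t 1) has_derivative (\<lambda>h. h *\<^sub>R axis t 1)) (at 0)"
      by (auto intro!: derivative_eq_intros)
    show "(f has_derivative F) (at (x + 0 *\<^sub>R axis t 1))" using assms by simp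
  qed
  moreover have "F (h *\<^sub>R axis t 1) = h * F (axis t 1)" for h
    using linear_scale[OF has_derivative_linear[OF assms]] by simp
  ultimately have "((\<lambda>h. f (x + h *\<^sub>R axis t 1)) has_real_derivative F (axis t 1)) (at 0)"
    unfolding has_field_derivative_def by (simp add: mult_commute_abs)
  then show ?thesis unfolding partial_def by (rule DERIV_imp_deriv)
qed

lemma has_derivative_partials:
  fixes f :: "real^'t::finite \<Rightarrow> real"
  assumes "(f has_derivative F) (at x)"
  shows "(f has_derivative (\<lambda>v. \<Sum>t\<in>UNIV. v $ t * partial t f x)) (at x)"
proof -
  have "F v = (\<Sum>t\<in>UNIV. v $ t * partial t f x)" for v
  proof -
    have "F v = F (\<Sum>t\<in>UNIV. v $ t *\<^sub>R axis t 1)"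
      by (simp add: basis_expansion scalar_mult_eq_scaleR[symmetric])
    also have "\<dots> = (\<Sum>t\<in>UNIV. v $ t * F (axis t 1))"
      using has_derivative_linear[OF assms] by (simp add: linear_sum linear_scale)
    finally show ?thesis unfolding partial_eq_derivative[OF assms] .
  qed
  then show ?thesis using assms by (metis (no_types, lifting) ext)
qed

lemma has_real_derivative_along_line:
  fixes f :: "real^'t::finite \<Rightarrow> real"
  assumes "\<And>x. (f has_derivative (\<lambda>v. \<Sum>t\<in>UNIV. v $ t * f' t x)) (at x)"
  shows "((\<lambda>h. f (x + h *\<^sub>R v)) has_real_derivative (\<Sum>t\<in>UNIV. v $ t * f' t (x + h *\<^sub>R v))) (at h)"
proof -
  have "((\<lambda>h. f (x + h *\<^sub>R v)) has_derivative (\<lambda>k. \<Sum>t\<in>UNIV. (k *\<^sub>R v) $ t * f' t (x + h *\<^sub>R v))) (at h)"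
    by (rule has_derivative_compose[OF _ assms]) (auto intro!: derivative_eq_intros)
  moreover have "(\<Sum>t\<in>UNIV. (k *\<^sub>R v) $ t * f' t (x + h *\<^sub>R v)) = (\<Sum>t\<in>UNIV. v $ t * f' t (x + h *\<^sub>R v)) * k" for k
    by (subst sum_distrib_right) (auto intro: sum.cong simp: mult_ac)
  ultimately show ?thesis unfolding has_field_derivative_def by simp
qed

lemma has_real_derivative_along_axis:
  fixes f :: "real^'t::finite \<Rightarrow> real"
  assumes "\<And>x. (f has_derivative (\<lambda>v. \<Sum>t\<in>UNIV. v $ t * f' t x)) (at x)"
  shows "((\<lambda>h. f (x + h *\<^sub>R axis t 1)) has_real_derivative f' t (x + h *\<^sub>R axis t 1)) (at h)"
proof -
  have "(\<Sum>s\<in>UNIV. axis t 1 $ s * f' s y) = f' t y" for y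
  proof -
    have "(\<Sum>s\<in>UNIV. axis t 1 $ s * f' s y) = (\<Sum>s\<in>UNIV. if s = t then f' s y else 0)"
      by (intro sum.cong) (auto simp: axis_def)
    then show ?thesis by simp
  qed
  then show ?thesis using has_real_derivative_along_line[OF assms, of x "axis t 1" h] by simp
qed

locale smooth_density =
  fixes p :: "real^'t::finite \<Rightarrow> real"
  assumes p_pos: "\<And>x. p x > 0"
    and p_integrable: "integrable lborel p"
    and p_integral: "(\<integral>x. p x \<partial>lborel) = 1"
    and p_C2: "twice_continuously_differentiable p"
    and second_lipschitz:
      "\<And>r s. \<exists>L. L-lipschitz_on UNIV (partial r (partial s (\<lambda>x. ln (p x))))"
    and second_bounded:
      "\<And>r s. bounded (range (partial r (partial s (\<lambda>x. ln (p x)))))"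
    and fourth_moment:
      "\<And>s. integrable (target_measure p) (\<lambda>x. \<bar>partial s (\<lambda>y. ln (p y)) x\<bar> ^ 4)"
begin

definition \<phi> :: "real^'t \<Rightarrow> real" where "\<phi> = (\<lambda>x. ln (p x))"
definition \<phi>1 :: "'t \<Rightarrow> real^'t \<Rightarrow> real" where "\<phi>1 s = partial s \<phi>"
definition \<phi>2 :: "'t \<Rightarrow> 't \<Rightarrow> real^'t \<Rightarrow> real" where "\<phi>2 r s = partial r (\<phi>1 s)"

text \<open>The Frechet derivatives of \<open>p\<close> are transported through \<open>ln\<close>.
  Partial derivatives alone would not give the chain rule along an arbitrary direction, which the
  expansion of a simultaneous move of several times uses.\<close>

lemma
  shows has_derivative_phi: "(\<phi> has_derivative (\<lambda>v. \<Sum>t\<in>UNIV. v $ t * \<phi>1 t x)) (at x)"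
    and has_derivative_phi1: "(\<phi>1 s has_derivative (\<lambda>v. \<Sum>t\<in>UNIV. v $ t * \<phi>2 t s x)) (at x)"
proof -
  obtain f' :: "real^'t \<Rightarrow> ((real^'t) \<Rightarrow>\<^sub>L real)" and f'' :: "real^'t \<Rightarrow> (real^'t) \<Rightarrow>\<^sub>L ((real^'t) \<Rightarrow>\<^sub>L real)"
    where f': "\<And>x. (p has_derivative f' x) (at x)" and f'': "\<And>x. (f' has_derivative f'' x) (at x)"
    using p_C2 unfolding twice_continuously_differentiable_def by blast
  have d1: "(\<phi> has_derivative (\<lambda>v. f' x v / p x)) (at x)" for x
    unfolding \<phi>_def using p_pos[of x] by (auto intro!: derivative_eq_intros f' simp: divide_inverse mult.commute)
  show "(\<phi> has_derivative (\<lambda>v. \<Sum>t\<in>UNIV. v $ t * \<phi>1 t x)) (at x)"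
    unfolding \<phi>1_def by (rule has_derivative_partials[OF d1])
  have e: "\<phi>1 s = (\<lambda>x. f' x (axis s 1) / p x)"
    unfolding \<phi>1_def using partial_eq_derivative[OF d1] by auto
  have "((\<lambda>x. f' x (axis s 1)) has_derivative (\<lambda>v. f'' x v (axis s 1))) (at x)"
    by (rule bounded_linear.has_derivative[OF blinfun.bounded_linear_left f''])
  from has_derivative_divide[OF this f'[of x]] p_pos[of x]
  obtain F where F: "(\<phi>1 s has_derivative F) (at x)" unfolding e by auto
  show "(\<phi>1 s has_derivative (\<lambda>v. \<Sum>t\<in>UNIV. v $ t * \<phi>2 t s x)) (at x)"
    unfolding \<phi>2_def by (rule has_derivative_partials[OF F])
qed

lemma phi2_eq: "\<phi>2 r s = partial r (partial s (\<lambda>x. ln (p x)))"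
  by (simp add: \<phi>2_def \<phi>1_def \<phi>_def)

lemma p_eq_exp: "p x = exp (\<phi> x)"
  using p_pos by (simp add: \<phi>_def)

lemma continuous_on_p: "continuous_on A p"
  and continuous_on_phi: "continuous_on A \<phi>"
  and continuous_on_phi1: "continuous_on A (\<phi>1 s)"
  and continuous_on_phi2: "continuous_on A (\<phi>2 r s)"
proof -
  show *: "continuous_on A \<phi>" for A
    using has_derivative_phi by (intro continuous_at_imp_continuous_on ballI has_derivative_continuous)
  have "p = (\<lambda>x. exp (\<phi> x))" using p_eq_exp by auto
  then show "continuous_on A p"
    using * by (metis continuous_on_exp)
  show "continuous_on A (\<phi>1 s)"
    using has_derivative_phi1 by (intro continuous_at_imp_continuous_on ballI has_derivative_continuous)
  show "continuous_on A (\<phi>2 r s)"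
    using second_lipschitz[of r s] lipschitz_on_continuous_on continuous_on_subset unfolding phi2_eq by blast
qed

lemma [measurable]: "p \<in> borel_measurable borel" "\<phi> \<in> borel_measurable borel"
    "\<phi>1 s \<in> borel_measurable borel" "\<phi>2 r s \<in> borel_measurable borel"
  by (rule borel_measurable_continuous_onI, rule continuous_on_p continuous_on_phi continuous_on_phi1 continuous_on_phi2)+

text \<open>Summing the constants of the finitely many index pairs gives one constant for all of
  them; \<open>phi2_lipschitz\<close> proceeds in the same way.\<close>

lemma phi2_bound: "\<exists>B\<ge>0. \<forall>r s x. \<bar>\<phi>2 r s x\<bar> \<le> B"
proof -
  have "\<exists>b. \<forall>x. \<bar>\<phi>2 (fst z) (snd z) x\<bar> \<le> b" for z
    using second_bounded[of "fst z" "snd z"] unfolding phi2_eq bounded_iff by auto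
  then obtain b where b: "\<And>z x. \<bar>\<phi>2 (fst z) (snd z) x\<bar> \<le> b z" by metis
  have b0: "b z \<ge> 0" for z using b[of z] by (meson abs_ge_zero order_trans)
  show ?thesis
  proof (intro exI[of _ "\<Sum>z\<in>UNIV. b z"] conjI allI)
    show "0 \<le> (\<Sum>z\<in>UNIV. b z)" using b0 by (intro sum_nonneg) auto
    fix r s :: 't and x :: "real^'t"
    show "\<bar>\<phi>2 r s x\<bar> \<le> (\<Sum>z\<in>UNIV. b z)"
      using b[of "(r, s)" x] member_le_sum[of "(r, s)" UNIV b] b0 by (auto intro: order_trans)
  qed
qed

lemma phi2_lipschitz: "\<exists>L\<ge>0. \<forall>r s x y. \<bar>\<phi>2 r s x - \<phi>2 r s y\<bar> \<le> L * norm (x - y)"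
proof -
  have "\<exists>b\<ge>0. \<forall>x y. \<bar>\<phi>2 (fst z) (snd z) x - \<phi>2 (fst z) (snd z) y\<bar> \<le> b * norm (x - y)" for z
    using second_lipschitz[of "fst z" "snd z"] unfolding phi2_eq lipschitz_on_def dist_norm by auto
  then obtain b where b0: "\<And>z. b z \<ge> 0" and
    b: "\<And>z x y. \<bar>\<phi>2 (fst z) (snd z) x - \<phi>2 (fst z) (snd z) y\<bar> \<le> b z * norm (x - y)" by metis
  show ?thesis
  proof (intro exI[of _ "\<Sum>z\<in>UNIV. b z"] conjI allI)
    show "0 \<le> (\<Sum>z\<in>UNIV. b z)" using b0 by (intro sum_nonneg) auto
    fix r s :: 't and x y :: "real^'t"
    have "b (r, s) * norm (x - y) \<le> (\<Sum>z\<in>UNIV. b z) * norm (x - y)"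
      using member_le_sum[of "(r, s)" UNIV b] b0 by (intro mult_right_mono) auto
    then show "\<bar>\<phi>2 r s x - \<phi>2 r s y\<bar> \<le> (\<Sum>z\<in>UNIV. b z) * norm (x - y)"
      using b[of "(r, s)" x y] by auto
  qed
qed

text \<open>The Lagrange form of the second-order remainder on the segment from \<open>x\<close> to
  \<open>x + v\<close>, moved to the base point by Lipschitz continuity of the Hessian. The l1 norm
  of \<open>v\<close> is convenient because the double sum of the products of absolute entries is
  exactly its square; the factor 1/2 is given away.\<close>

lemma taylor_remainder:
  "\<exists>L\<ge>0. \<forall>x v. \<bar>\<phi> (x + v) - \<phi> x - (\<Sum>s\<in>UNIV. v $ s * \<phi>1 s x)
       - (1/2) * (\<Sum>s\<in>UNIV. \<Sum>r\<in>UNIV. v $ s * v $ r * \<phi>2 r s x)\<bar> \<le> L * (\<Sum>s\<in>UNIV. \<bar>v $ s\<bar>) ^ 3"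
proof -
  obtain L where L: "L \<ge> 0" "\<And>r s x y. \<bar>\<phi>2 r s x - \<phi>2 r s y\<bar> \<le> L * norm (x - y)" using phi2_lipschitz by blast
  show ?thesis
  proof (intro exI[of _ L] conjI allI L(1))
    fix x v :: "real^'t"
    define S where "S = (\<Sum>s\<in>UNIV. \<bar>v $ s\<bar>)"
    have S: "S \<ge> 0" "norm v \<le> S" unfolding S_def by (auto intro: sum_nonneg norm_le_l1_cart)
    define g where "g = (\<lambda>h::real. \<phi> (x + h *\<^sub>R v))"
    define g1 where "g1 = (\<lambda>h::real. \<Sum>s\<in>UNIV. v $ s * \<phi>1 s (x + h *\<^sub>R v))"
    define g2 where "g2 = (\<lambda>h::real. \<Sum>s\<in>UNIV. \<Sum>r\<in>UNIV. v $ s * v $ r * \<phi>2 r s (x + h *\<^sub>R v))"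
    have d1: "(g has_real_derivative g1 h) (at h)" for h
      unfolding g_def g1_def by (rule has_real_derivative_along_line[OF has_derivative_phi])
    have "((\<lambda>h. v $ s * \<phi>1 s (x + h *\<^sub>R v)) has_real_derivative v $ s * (\<Sum>r\<in>UNIV. v $ r * \<phi>2 r s (x + h *\<^sub>R v))) (at h)" for s h
      by (rule DERIV_cmult[OF has_real_derivative_along_line[OF has_derivative_phi1]])
    then have d2: "(g1 has_real_derivative g2 h) (at h)" for h
      unfolding g1_def g2_def by (auto intro!: DERIV_sum simp: sum_distrib_left mult.assoc)
    \<comment> \<open>Only the orders 0, 1 and 2 occur, so every order from 2 on may be set to
      \<open>g2\<close>.\<close>
    define diff where "diff = (\<lambda>m::nat. if m = 0 then g else if m = 1 then g1 else g2)"
    have "\<forall>m t. m < 2 \<and> 0 \<le> t \<and> t \<le> 1 \<longrightarrow> DERIV (diff m) t :> diff (Suc m) t"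
      using d1 d2 by (auto simp: diff_def less_2_cases_iff)
    then have "\<exists>h>0. h < 1 \<and> g 1 = (\<Sum>m<2. diff m 0 / fact m * 1 ^ m) + diff 2 h / fact 2 * 1 ^ 2"
      by (intro Maclaurin) (simp_all add: diff_def)
    then obtain h where h: "0 < h" "h < 1" "g 1 = (\<Sum>m<2. diff m 0 / fact m * 1 ^ m) + diff 2 h / fact 2 * 1 ^ 2"
      by blast
    have "g 1 - g 0 - g1 0 - (1/2) * g2 0 = (1/2) * (g2 h - g2 0)"
      using h(3) by (simp add: diff_def lessThan_Suc numeral_2_eq_2 field_simps)
    also have "g2 h - g2 0 = (\<Sum>s\<in>UNIV. \<Sum>r\<in>UNIV. v $ s * v $ r * (\<phi>2 r s (x + h *\<^sub>R v) - \<phi>2 r s x))"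
      by (simp add: g2_def sum_subtractf right_diff_distrib)
    also have "\<bar>(1/2) * \<dots>\<bar> \<le> (\<Sum>s\<in>UNIV. \<Sum>r\<in>UNIV. \<bar>v $ s\<bar> * \<bar>v $ r\<bar> * (L * S))"
    proof -
      have "\<bar>v $ s * v $ r * (\<phi>2 r s (x + h *\<^sub>R v) - \<phi>2 r s x)\<bar> \<le> \<bar>v $ s\<bar> * \<bar>v $ r\<bar> * (L * S)" for r s
      proof -
        have "\<bar>\<phi>2 r s (x + h *\<^sub>R v) - \<phi>2 r s x\<bar> \<le> L * (h * norm v)"
          using L(2)[of r s "x + h *\<^sub>R v" x] h by simp
        also have "\<dots> \<le> L * S"
          using h S by (intro mult_left_mono L(1)) (metis less_imp_le mult_left_le_one_le norm_ge_zero order_trans)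
        finally show ?thesis by (simp add: abs_mult mult_left_mono)
      qed
      then have "\<bar>\<Sum>s\<in>UNIV. \<Sum>r\<in>UNIV. v $ s * v $ r * (\<phi>2 r s (x + h *\<^sub>R v) - \<phi>2 r s x)\<bar>
          \<le> (\<Sum>s\<in>UNIV. \<Sum>r\<in>UNIV. \<bar>v $ s\<bar> * \<bar>v $ r\<bar> * (L * S))"
        by (intro order_trans[OF sum_abs] sum_mono)
      then show ?thesis by linarith
    qed
    also have "\<dots> = L * S ^ 3"
    proof -
      have "(\<Sum>s\<in>UNIV. \<Sum>r\<in>UNIV. \<bar>v $ s\<bar> * \<bar>v $ r\<bar> * (L * S)) = S * S * (L * S)"
        unfolding sum_distrib_right[symmetric] sum_distrib_left[symmetric] S_def[symmetric] ..
      then show ?thesis by (simp add: power3_eq_cube)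
    qed
    finally show "\<bar>\<phi> (x + v) - \<phi> x - (\<Sum>s\<in>UNIV. v $ s * \<phi>1 s x)
       - (1/2) * (\<Sum>s\<in>UNIV. \<Sum>r\<in>UNIV. v $ s * v $ r * \<phi>2 r s x)\<bar> \<le> L * (\<Sum>s\<in>UNIV. \<bar>v $ s\<bar>) ^ 3"
      by (simp add: g_def g1_def g2_def S_def)
  qed
qed

abbreviation \<mu> :: "(real^'t) measure" where "\<mu> \<equiv> target_measure p"

lemma sets_target [simp, measurable_cong]: "sets \<mu> = sets borel"
  and space_target [simp]: "space \<mu> = UNIV"
  by (simp_all add: target_measure_def)

lemma prob_space_target: "prob_space \<mu>"
proof
  have "emeasure \<mu> (space \<mu>) = (\<integral>\<^sup>+x. ennreal (p x) \<partial>lborel)"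
    unfolding target_measure_def by (simp add: emeasure_density)
  also have "\<dots> = 1"
    using nn_integral_eq_integral[OF p_integrable] p_pos p_integral by (simp add: less_imp_le)
  finally show "emeasure \<mu> (space \<mu>) = 1" .
qed

lemma
  fixes f :: "real^'t \<Rightarrow> real"
  assumes [measurable]: "f \<in> borel_measurable borel"
  shows integrable_target_iff: "integrable \<mu> f \<longleftrightarrow> integrable lborel (\<lambda>x. p x * f x)"
    and integral_target: "(\<integral>x. f x \<partial>\<mu>) = (\<integral>x. p x * f x \<partial>lborel)"
proof -
  have nn: "AE x in lborel. 0 \<le> p x" using p_pos by (simp add: less_imp_le)
  show "integrable \<mu> f \<longleftrightarrow> integrable lborel (\<lambda>x. p x * f x)"
    unfolding target_measure_def by (subst integrable_density[OF _ _ nn]) simp_all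
  show "(\<integral>x. f x \<partial>\<mu>) = (\<integral>x. p x * f x \<partial>lborel)"
    unfolding target_measure_def by (subst integral_density[OF _ _ nn]) simp_all
qed

lemma integrable_phi1_power:
  assumes "k \<le> 4"
  shows "integrable \<mu> (\<lambda>x. \<phi>1 s x ^ k)"
proof -
  interpret prob_space \<mu> by (rule prob_space_target)
  have "\<bar>y ^ k\<bar> \<le> 1 + \<bar>y\<bar> ^ 4" for y :: real
    using assms power_increasing[of k 4 "\<bar>y\<bar>"] power_le_one[of "\<bar>y\<bar>" k]
    by (cases "\<bar>y\<bar> \<le> 1") (auto simp: power_abs intro: order_trans)
  moreover have fourth: "integrable \<mu> (\<lambda>x. \<bar>\<phi>1 s x\<bar> ^ 4)"
    using fourth_moment[of s] by (simp only: \<phi>1_def \<phi>_def)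
  ultimately have "norm (y ^ k) \<le> norm (1 + \<bar>y\<bar> ^ 4)" for y :: real
    by simp
  then have "AE x in \<mu>. norm (\<phi>1 s x ^ k) \<le> norm (1 + \<bar>\<phi>1 s x\<bar> ^ 4)"
    by (intro AE_I2)
  then show ?thesis
  proof (rule Bochner_Integration.integrable_bound[rotated 2])
    show "integrable \<mu> (\<lambda>x. 1 + \<bar>\<phi>1 s x\<bar> ^ 4)"
      by (rule Bochner_Integration.integrable_add[OF integrable_const fourth])
  qed simp_all
qed

lemma integrable_phi2: "integrable \<mu> (\<lambda>x. \<phi>2 r s x)"
proof -
  interpret prob_space \<mu> by (rule prob_space_target)
  obtain B where B: "\<forall>r s x. \<bar>\<phi>2 r s x\<bar> \<le> B" using phi2_bound by blast
  have "AE x in \<mu>. norm (\<phi>2 r s x) \<le> B" by (rule AE_I2) (simp only: real_norm_def B)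
  then show ?thesis by (rule integrable_const_bound) measurable
qed

section \<open>Integration by parts against the target density\<close>

lemma has_real_derivative_p:
  "((\<lambda>h. p (x + h *\<^sub>R axis t 1)) has_real_derivative p (x + h *\<^sub>R axis t 1) * \<phi>1 t (x + h *\<^sub>R axis t 1)) (at h)"
  using DERIV_fun_exp[OF has_real_derivative_along_axis[OF has_derivative_phi, of x t h]]
  by (simp only: p_eq_exp[symmetric])

lemma info_eq: "info p t = (\<integral>x. (\<phi>1 t x)\<^sup>2 \<partial>\<mu>)"
  unfolding info_def \<phi>1_def \<phi>_def ..

text \<open>The function \<open>p * \<phi>1 t\<close> is the partial derivative of \<open>p\<close>;
  its own derivative \<open>p * (\<phi>1 t)^2 + p * \<phi>2 t t\<close> integrates to 0. This is how
  the mean curvature becomes the drift of the limiting law.\<close>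

lemma integral_phi2_diag: "(\<integral>x. \<phi>2 t t x \<partial>\<mu>) = - info p t"
proof -
  have "(\<integral>x. p x * (\<phi>1 t x)\<^sup>2 + p x * \<phi>2 t t x \<partial>lborel) = 0"
  proof (rule integral_directional_derivative_eq_0)
    show "((\<lambda>h. p (x + h *\<^sub>R axis t 1) * \<phi>1 t (x + h *\<^sub>R axis t 1)) has_real_derivative
        p (x + h *\<^sub>R axis t 1) * (\<phi>1 t (x + h *\<^sub>R axis t 1))\<^sup>2 + p (x + h *\<^sub>R axis t 1) * \<phi>2 t t (x + h *\<^sub>R axis t 1)) (at h)" for x h
      using DERIV_mult[OF has_real_derivative_p[of x t h] has_real_derivative_along_axis[OF has_derivative_phi1[of t], of x t h]]
      by (simp add: power2_eq_square mult_ac)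
    show "continuous_on UNIV (\<lambda>x. p x * (\<phi>1 t x)\<^sup>2 + p x * \<phi>2 t t x)"
      by (intro continuous_intros continuous_on_p continuous_on_phi1 continuous_on_phi2)
    show "integrable lborel (\<lambda>x. p x * \<phi>1 t x)"
      using integrable_phi1_power[of 1 t] by (simp add: integrable_target_iff)
    show "integrable lborel (\<lambda>x. p x * (\<phi>1 t x)\<^sup>2 + p x * \<phi>2 t t x)"
      using integrable_phi1_power[of 2 t] integrable_phi2[of t t] by (simp add: integrable_target_iff)
  qed
  then show ?thesis
    using integrable_phi1_power[of 2 t] integrable_phi2[of t t]
    by (simp add: integrable_target_iff integral_target info_eq)
qed

text \<open>If the score vanished, integrating the derivative of \<open>p x * arctan (x $ t)\<close> would give
  \<open>\<integral> p / (1 + x $ t ^ 2) = 0\<close>.\<close>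

lemma info_pos: "info p t > 0"
proof (rule ccontr)
  interpret prob_space \<mu> by (rule prob_space_target)
  assume "\<not> info p t > 0"
  moreover have "info p t \<ge> 0" unfolding info_eq by simp
  ultimately have "(\<integral>x. (\<phi>1 t x)\<^sup>2 \<partial>\<mu>) = 0" unfolding info_eq by simp
  then have ae: "AE x in \<mu>. \<phi>1 t x = 0"
    using integral_nonneg_eq_0_iff_AE[of \<mu> "\<lambda>x. (\<phi>1 t x)\<^sup>2"] integrable_phi1_power[of 2 t] by simp
  \<comment> \<open>The arctangent is a bounded test function with a positive bounded derivative, so
    its products with \<open>p\<close> and with the score are integrable without any moment of the
    coordinate itself.\<close>
  have at: "\<bar>arctan z\<bar> \<le> pi / 2" for z
    using arctan_bounded[of z] by auto
  have i1: "integrable \<mu> (\<lambda>x. \<phi>1 t x * arctan (x $ t))"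
  proof (rule Bochner_Integration.integrable_bound[OF integrable_mult_left[of "pi / 2", OF integrable_phi1_power[of 1 t]]])
    show "AE x in \<mu>. norm (\<phi>1 t x * arctan (x $ t)) \<le> norm (\<phi>1 t x ^ 1 * (pi / 2))"
    proof (rule AE_I2)
      fix x
      have "\<bar>\<phi>1 t x\<bar> * \<bar>arctan (x $ t)\<bar> \<le> \<bar>\<phi>1 t x\<bar> * (pi / 2)"
        by (rule mult_left_mono[OF at]) simp
      then show "norm (\<phi>1 t x * arctan (x $ t)) \<le> norm (\<phi>1 t x ^ 1 * (pi / 2))"
        by (simp add: abs_mult)
    qed
  qed simp_all
  have i2: "integrable \<mu> (\<lambda>x. inverse (1 + (x $ t)\<^sup>2))"
    by (rule integrable_const_bound[where B=1]) (auto simp: inverse_le_1_iff)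
  have i3: "integrable \<mu> (\<lambda>x. arctan (x $ t))"
    using at by (intro integrable_const_bound[where B="pi / 2"]) auto
  have nz: "1 + z\<^sup>2 \<noteq> 0" for z :: real
    using zero_le_power2[of z] by linarith
  have "(\<integral>x. p x * (\<phi>1 t x * arctan (x $ t)) + p x * inverse (1 + (x $ t)\<^sup>2) \<partial>lborel) = 0"
  proof (rule integral_directional_derivative_eq_0)
    show "((\<lambda>h. p (x + h *\<^sub>R axis t 1) * arctan ((x + h *\<^sub>R axis t 1) $ t)) has_real_derivative
        p (x + h *\<^sub>R axis t 1) * (\<phi>1 t (x + h *\<^sub>R axis t 1) * arctan ((x + h *\<^sub>R axis t 1) $ t))
        + p (x + h *\<^sub>R axis t 1) * inverse (1 + ((x + h *\<^sub>R axis t 1) $ t)\<^sup>2)) (at h)" for x h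
      by (auto intro!: derivative_eq_intros has_real_derivative_p)
    show "continuous_on UNIV (\<lambda>x. p x * (\<phi>1 t x * arctan (x $ t)) + p x * inverse (1 + (x $ t)\<^sup>2))"
      using nz by (intro continuous_intros continuous_on_p continuous_on_phi1) blast+
    show "integrable lborel (\<lambda>x. p x * arctan (x $ t))"
      using i3 by (simp add: integrable_target_iff)
    show "integrable lborel (\<lambda>x. p x * (\<phi>1 t x * arctan (x $ t)) + p x * inverse (1 + (x $ t)\<^sup>2))"
      using i1 i2 by (simp add: integrable_target_iff)
  qed
  then have "(\<integral>x. \<phi>1 t x * arctan (x $ t) \<partial>\<mu>) + (\<integral>x. inverse (1 + (x $ t)\<^sup>2) \<partial>\<mu>) = 0"
    using i1 i2 by (simp add: integrable_target_iff integral_target)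
  moreover have "(\<integral>x. \<phi>1 t x * arctan (x $ t) \<partial>\<mu>) = 0"
    using ae by (intro integral_eq_zero_AE) auto
  ultimately have "(\<integral>x. inverse (1 + (x $ t)\<^sup>2) \<partial>\<mu>) = 0" by simp
  then have "AE x in \<mu>. inverse (1 + (x $ t)\<^sup>2) = 0"
    using integral_nonneg_eq_0_iff_AE[OF i2] by simp
  then have "AE x in \<mu>. False"
    by (rule eventually_mono) (metis nz inverse_nonzero_iff_nonzero)
  then show False
    using prob_Collect_eq_1[of "\<lambda>_. False"] by simp
qed

end

section \<open>The update and the limiting law\<close>

lemma measurable_softmax [measurable (raw)]:
  assumes "\<And>k. (\<lambda>z. h z k) \<in> borel_measurable M"
  shows "(\<lambda>z. softmax (h z) k) \<in> borel_measurable M"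
  unfolding softmax_def using assms by measurable

lemma pmf_embed_pmf_finite:
  fixes f :: "'k::finite \<Rightarrow> real"
  assumes "\<And>k. f k \<ge> 0" "(\<Sum>k\<in>UNIV. f k) = 1"
  shows "pmf (embed_pmf f) k = f k"
proof (rule pmf_embed_pmf)
  show "(\<integral>\<^sup>+k. ennreal (f k) \<partial>count_space UNIV) = 1"
    using assms by (simp add: nn_integral_count_space_finite)
qed (rule assms)

lemma nn_integral_measure_pmf_UNIV:
  fixes K :: "'k::finite pmf"
  shows "(\<integral>\<^sup>+k. f k \<partial>measure_pmf K) = (\<Sum>k\<in>UNIV. f k * ennreal (pmf K k))"
  by (rule nn_integral_measure_pmf_support) auto

lemma measurable_measure_pmf_finite:
  fixes K :: "'z \<Rightarrow> 'k::finite pmf"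
  assumes [measurable]: "\<And>k. (\<lambda>z. pmf (K z) k) \<in> borel_measurable M"
  shows "(\<lambda>z. measure_pmf (K z)) \<in> measurable M (subprob_algebra (count_space UNIV))"
  by (rule measurable_subprob_algebra)
     (auto simp: emeasure_measure_pmf_finite intro: measure_pmf.subprob_space_axioms)

lemma borel_measurable_vec_lambda [measurable (raw)]:
  fixes f :: "'t::finite \<Rightarrow> 'z \<Rightarrow> real"
  assumes [measurable]: "\<And>t. f t \<in> borel_measurable M"
  shows "(\<lambda>z. \<chi> t. f t z) \<in> borel_measurable M"
  by (subst borel_measurable_euclidean_space) (auto simp: Basis_vec_def inner_axis)

lemma borel_measurable_vec_nth [measurable (raw)]:
  fixes f :: "'z \<Rightarrow> real^'t::finite"
  assumes "f \<in> borel_measurable M"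
  shows "(\<lambda>z. f z $ t) \<in> borel_measurable M"
  by (rule measurable_compose[OF assms]) (intro borel_measurable_continuous_onI continuous_intros)

definition displacement ::
    "('t \<Rightarrow> real) \<Rightarrow> nat \<Rightarrow> ('t \<times> nat \<Rightarrow> real^'n) \<Rightarrow> ('t::finite \<Rightarrow> 'n::finite option) \<Rightarrow> nat \<Rightarrow> 't \<Rightarrow> real" where
  "displacement l D u k d s = (case k s of None \<Rightarrow> 0 | Some n \<Rightarrow> sqrt (l s / real D) * u (s, d) $ n)"

lemma selected_path_eq:
  "selected_path l D x u k = (\<lambda>d\<in>{1..D}. x d + (\<chi> s. displacement l D u k d s))"
  unfolding selected_path_def proposal_def displacement_def
  by (intro restrict_ext) (auto simp: vec_eq_iff split: option.split)

lemma sets_noise_law [measurable_cong]: "sets (noise_law S D) = sets (PiM (UNIV \<times> {1..D}) (\<lambda>_. borel))"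
  unfolding noise_law_def by (rule sets_PiM_cong) auto

lemma sets_target_measure_D [measurable_cong]: "sets (target_measure_D p D) = sets (PiM {1..D} (\<lambda>_. borel))"
  unfolding target_measure_D_def by (rule sets_PiM_cong) (auto simp: target_measure_def)

lemma measurable_displacement [measurable]:
  assumes "d \<in> {1..D}"
  shows "(\<lambda>u. displacement l D u k d s) \<in> borel_measurable (PiM (UNIV \<times> {1..D}) (\<lambda>_. borel))"
proof -
  have "(s, d) \<in> UNIV \<times> {1..D}" using assms by simp
  then have [measurable]: "(\<lambda>u. u (s, d)) \<in> borel_measurable (PiM (UNIV \<times> {1..D}) (\<lambda>_. borel))"
    by (rule measurable_component_singleton)
  show ?thesis
  proof (cases "k s")
    case (Some n)
    show ?thesis unfolding displacement_def Some option.case by measurable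
  qed (simp add: displacement_def)
qed

lemma measurable_displacement_snd:
  assumes "d \<in> {1..D}"
  shows "(\<lambda>z. displacement l D (snd z) k d s) \<in> borel_measurable (M \<Otimes>\<^sub>M PiM (UNIV \<times> {1..D}) (\<lambda>_. borel))"
  by (rule measurable_compose[OF measurable_snd measurable_displacement[OF assms]])

lemma measurable_selected_path [measurable]:
  "(\<lambda>z. selected_path l D (fst z) (snd z) k) \<in>
     measurable (PiM {1..D} (\<lambda>_. borel) \<Otimes>\<^sub>M PiM (UNIV \<times> {1..D}) (\<lambda>_. borel)) (state_space D)"
  unfolding selected_path_eq state_space_def
  by (intro measurable_restrict borel_measurable_add borel_measurable_vec_lambda measurable_displacement_snd) auto

lemma prob_space_noise_law: "prob_space (noise_law Sigma_N D)"
  unfolding noise_law_def by (intro prob_space_PiM prob_space_noise)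

context smooth_density
begin

definition log_ratio ::
    "('t \<Rightarrow> real) \<Rightarrow> nat \<Rightarrow> (nat \<Rightarrow> real^'t) \<Rightarrow> ('t \<times> nat \<Rightarrow> real^'n) \<Rightarrow> ('t \<Rightarrow> 'n::finite option) \<Rightarrow> real" where
  "log_ratio l D x u k = (\<Sum>d\<in>{1..D}. \<phi> (x d + (\<chi> s. displacement l D u k d s)) - \<phi> (x d))"

lemma prob_space_target_measure_D: "prob_space (target_measure_D p D)"
  unfolding target_measure_D_def by (intro prob_space_PiM prob_space_target)

lemma pmf_selection_pmf: "pmf (selection_pmf l p D x u) k = softmax (log_ratio l D x u) k"
proof -
  \<comment> \<open>The log-density of the current state: the shift between the log-density of a
    candidate path and its log-ratio.\<close>
  define c where "c = (\<Sum>d\<in>{1..D}. \<phi> (x d))"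
  have "target_density_D p D (selected_path l D x u k) = exp (log_ratio l D x u k + c)" for k
    unfolding target_density_D_def selected_path_eq log_ratio_def c_def sum.distrib[symmetric]
    by (simp add: exp_sum p_eq_exp)
  then have "(\<lambda>k. target_density_D p D (selected_path l D x u k) /
     (\<Sum>j\<in>UNIV. target_density_D p D (selected_path l D x u j))) = softmax (\<lambda>k. log_ratio l D x u k + c)"
    by (simp add: softmax_def fun_eq_iff)
  also have "\<dots> = softmax (log_ratio l D x u)" by (rule softmax_add_const)
  finally show ?thesis
    unfolding selection_pmf_def
    by (simp only:) (rule pmf_embed_pmf_finite, auto intro: less_imp_le softmax_pos sum_softmax)
qed

lemma measurable_log_ratio [measurable]:
  "(\<lambda>z. log_ratio l D (fst z) (snd z) k) \<in>
     borel_measurable (PiM {1..D} (\<lambda>_. borel) \<Otimes>\<^sub>M PiM (UNIV \<times> {1..D}) (\<lambda>_. borel))"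
proof -
  have "(\<lambda>z. fst z d + (\<chi> s. displacement l D (snd z) k d s)) \<in> borel_measurable
      (PiM {1..D} (\<lambda>_. borel :: (real^'t) measure) \<Otimes>\<^sub>M PiM (UNIV \<times> {1..D}) (\<lambda>_. borel))"
    if "d \<in> {1..D}" for d
    using that by (intro borel_measurable_add borel_measurable_vec_lambda measurable_displacement_snd) auto
  from measurable_compose[OF this, of _ \<phi> borel] show ?thesis
    unfolding log_ratio_def by (intro borel_measurable_sum borel_measurable_diff) auto
qed

text \<open>The conditional expectation of the squared jump given state and noise. With the label
  path averaged out, the randomness left is a product measure.\<close>

definition squared_jump ::
    "('t \<Rightarrow> real) \<Rightarrow> nat \<Rightarrow> 't \<Rightarrow> (nat \<Rightarrow> real^'t) \<Rightarrow> ('t \<times> nat \<Rightarrow> real^'n::finite) \<Rightarrow> real" where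
  "squared_jump l D t x u =
    (\<Sum>k\<in>UNIV. softmax (log_ratio l D x u) k * (\<Sum>d\<in>{1..D}. (displacement l D u k d t)\<^sup>2))"

lemma measurable_squared_jump [measurable]:
  "(\<lambda>z. squared_jump l D t (fst z) (snd z)) \<in>
     borel_measurable (PiM {1..D} (\<lambda>_. borel) \<Otimes>\<^sub>M PiM (UNIV \<times> {1..D}) (\<lambda>_. borel))"
  unfolding squared_jump_def
  by (intro borel_measurable_sum borel_measurable_times measurable_softmax measurable_log_ratio
      borel_measurable_power measurable_displacement_snd) auto

text \<open>The stages of sampling are integrated out one after the other. Nonnegative integrals
  disintegrate along kernels by measurability alone; nonnegativity of both integrands then brings
  back the Bochner integral.\<close>

lemma ESJD_eq_integral:
  "ESJD (Sigma_N :: real^'n::finite^'n) l p D t =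
    (\<integral>z. squared_jump l D t (fst z) (snd z :: 't \<times> nat \<Rightarrow> real^'n) \<partial>(target_measure_D p D \<Otimes>\<^sub>M noise_law Sigma_N D))"
proof -
  let ?X = "target_measure_D p D" and ?U = "noise_law (Sigma_N :: real^'n^'n) D :: ('t \<times> nat \<Rightarrow> real^'n) measure"
  let ?S = "state_space D :: (nat \<Rightarrow> real^'t) measure"
  let ?K = "\<lambda>x (u :: 't \<times> nat \<Rightarrow> real^'n). measure_pmf (selection_pmf l p D x u)"
  let ?upd = "\<lambda>x. rw_ehmm_update (Sigma_N :: real^'n^'n) l p D x"
  interpret X: prob_space ?X by (rule prob_space_target_measure_D)
  interpret U: prob_space ?U by (rule prob_space_noise_law)
  have setsX [measurable_cong]: "sets ?X = sets ?S"
    by (simp add: sets_target_measure_D state_space_def)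
  have setsP: "sets (?X \<Otimes>\<^sub>M ?U) = sets (PiM {1..D} (\<lambda>_. borel) \<Otimes>\<^sub>M PiM (UNIV \<times> {1..D}) (\<lambda>_. borel))"
    by (rule sets_pair_measure_cong[OF sets_target_measure_D sets_noise_law])
  have spX: "space ?X = space ?S" by (rule sets_eq_imp_space_eq[OF setsX])
  have U_sp: "?U \<in> space (subprob_algebra ?U)"
    by (simp add: space_subprob_algebra U.subprob_space_axioms)
  have sel [measurable]: "(\<lambda>z. selected_path l D (fst z) (snd z) k) \<in> measurable (?X \<Otimes>\<^sub>M ?U) ?S" for k :: "'t \<Rightarrow> 'n option"
    unfolding measurable_cong_sets[OF setsP refl] by (rule measurable_selected_path)
  have lr [measurable]: "(\<lambda>z. log_ratio l D (fst z) (snd z) k) \<in> borel_measurable (?X \<Otimes>\<^sub>M ?U)" for k :: "'t \<Rightarrow> 'n option"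
    unfolding measurable_cong_sets[OF setsP refl] by (rule measurable_log_ratio)
  have sj: "(\<lambda>z. squared_jump l D t (fst z) (snd z)) \<in> borel_measurable (?X \<Otimes>\<^sub>M ?U)"
    unfolding measurable_cong_sets[OF setsP refl] by (rule measurable_squared_jump)
  have K: "(\<lambda>z. ?K (fst z) (snd z)) \<in> measurable (?X \<Otimes>\<^sub>M ?U) (subprob_algebra (count_space UNIV))"
    by (rule measurable_measure_pmf_finite) (simp add: pmf_selection_pmf)
  \<comment> \<open>\<open>inner\<close> draws the label path for fixed state and noise, and
    \<open>outer\<close> below produces the pair for a fixed state. Both have to be measurable
    kernels before the integrals can be unfolded.\<close>
  define inner where "inner = (\<lambda>x u. ?K x u \<bind> (\<lambda>k. return ?S (selected_path l D x u k)))"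
  have inner: "(\<lambda>z. inner (fst z) (snd z)) \<in> measurable (?X \<Otimes>\<^sub>M ?U) (subprob_algebra ?S)"
    unfolding inner_def
  proof (rule measurable_bind[OF K])
    show "(\<lambda>z. return ?S (selected_path l D (fst (fst z)) (snd (fst z)) (snd z)))
      \<in> measurable ((?X \<Otimes>\<^sub>M ?U) \<Otimes>\<^sub>M count_space UNIV) (subprob_algebra ?S)"
      \<comment> \<open>There are only finitely many label paths, so joint measurability reduces to
        measurability for each fixed path.\<close>
      by (rule measurable_compose_countable[where g=snd and f="\<lambda>k z. return ?S (selected_path l D (fst (fst z)) (snd (fst z)) k)"])
         (auto intro!: measurable_compose[OF measurable_fst measurable_compose[OF sel return_measurable]])
  qed
  have upd_eq: "?upd x = ?U \<bind> inner x" for x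
    unfolding rw_ehmm_update_def inner_def ..
  have upd: "?upd \<in> measurable ?X (subprob_algebra ?S)"
    unfolding upd_eq by (rule measurable_bind[OF measurable_const[OF U_sp] inner])
  define outer where "outer = (\<lambda>x. ?upd x \<bind> (\<lambda>x'. return (?S \<Otimes>\<^sub>M ?S) (x, x')))"
  have outer: "outer \<in> measurable ?X (subprob_algebra (?S \<Otimes>\<^sub>M ?S))"
    unfolding outer_def
    by (rule measurable_bind[OF upd]) (rule measurable_compose[OF _ return_measurable], measurable)
  let ?J = "\<lambda>z :: (nat \<Rightarrow> real^'t) \<times> (nat \<Rightarrow> real^'t). (L2_set (\<lambda>d. snd z d $ t - fst z d $ t) {1..D})\<^sup>2"
  have J_eq: "?J z = (\<Sum>d\<in>{1..D}. (snd z d $ t - fst z d $ t)\<^sup>2)" for z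
    by (simp add: L2_set_def sum_nonneg)
  have J: "?J \<in> borel_measurable (?S \<Otimes>\<^sub>M ?S)"
    unfolding J_eq state_space_def by measurable
  have law: "stationary_pair_law (Sigma_N :: real^'n^'n) l p D = ?X \<bind> outer"
    unfolding stationary_pair_law_def outer_def ..
  have sets_law: "sets (?X \<bind> outer) = sets (?S \<Otimes>\<^sub>M ?S)"
    by (rule sets_bind[OF sets_kernel[OF outer]]) (auto simp: X.not_empty)
  have "(\<integral>\<^sup>+z. ennreal (?J z) \<partial>(?X \<bind> outer)) = (\<integral>\<^sup>+x. \<integral>\<^sup>+z. ennreal (?J z) \<partial>outer x \<partial>?X)"
    by (rule nn_integral_bind[OF _ outer]) (use J in measurable)
  also have "\<dots> = (\<integral>\<^sup>+x. \<integral>\<^sup>+u. ennreal (squared_jump l D t x u) \<partial>?U \<partial>?X)"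
  proof (rule nn_integral_cong)
    fix x assume x: "x \<in> space ?X"
    then have xS: "x \<in> space ?S" by (simp add: spX)
    have Jx: "(\<lambda>x'. ennreal (?J (x, x'))) \<in> borel_measurable ?S"
      using measurable_compose[OF measurable_Pair1'[OF xS] J] by simp
    have ix: "inner x \<in> measurable ?U (subprob_algebra ?S)"
      using measurable_compose[OF measurable_Pair1'[OF x] inner] by simp
    have "(\<integral>\<^sup>+z. ennreal (?J z) \<partial>outer x) =
      (\<integral>\<^sup>+x'. \<integral>\<^sup>+z. ennreal (?J z) \<partial>return (?S \<Otimes>\<^sub>M ?S) (x, x') \<partial>?upd x)"
      unfolding outer_def
    proof (rule nn_integral_bind[where B="?S \<Otimes>\<^sub>M ?S"])
      have s: "sets (?upd x) = sets ?S" by (rule sets_kernel[OF upd x])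
      show "(\<lambda>x'. return (?S \<Otimes>\<^sub>M ?S) (x, x')) \<in> measurable (?upd x) (subprob_algebra (?S \<Otimes>\<^sub>M ?S))"
        unfolding measurable_cong_sets[OF s refl] by (rule measurable_compose[OF measurable_Pair1'[OF xS] return_measurable])
    qed (use J in measurable)
    also have "\<dots> = (\<integral>\<^sup>+x'. ennreal (?J (x, x')) \<partial>?upd x)"
    proof (rule nn_integral_cong)
      fix x' assume "x' \<in> space (?upd x)"
      then have "x' \<in> space ?S" using sets_eq_imp_space_eq[OF sets_kernel[OF upd x]] by simp
      then show "(\<integral>\<^sup>+z. ennreal (?J z) \<partial>return (?S \<Otimes>\<^sub>M ?S) (x, x')) = ennreal (?J (x, x'))"
        using J xS by (subst nn_integral_return) (auto simp: space_pair_measure)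
    qed
    also have "\<dots> = (\<integral>\<^sup>+u. \<integral>\<^sup>+x'. ennreal (?J (x, x')) \<partial>inner x u \<partial>?U)"
      unfolding upd_eq by (rule nn_integral_bind[OF Jx ix])
    also have "\<dots> = (\<integral>\<^sup>+u. ennreal (squared_jump l D t x u) \<partial>?U)"
    proof (rule nn_integral_cong)
      fix u assume u: "u \<in> space ?U"
      have selS: "selected_path l D x u k \<in> space ?S" for k :: "'t \<Rightarrow> 'n option"
        using measurable_space[OF sel[of k], of "(x, u)"] x u by (simp add: space_pair_measure)
      have "(\<integral>\<^sup>+x'. ennreal (?J (x, x')) \<partial>inner x u) =
        (\<integral>\<^sup>+k. \<integral>\<^sup>+x'. ennreal (?J (x, x')) \<partial>return ?S (selected_path l D x u k) \<partial>?K x u)"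
        unfolding inner_def using selS
        by (intro nn_integral_bind[OF Jx]) (auto simp: space_subprob_algebra intro: prob_space_imp_subprob_space prob_space_return)
      also have "\<dots> = (\<integral>\<^sup>+k. ennreal (?J (x, selected_path l D x u k)) \<partial>?K x u)"
        using selS by (intro nn_integral_cong nn_integral_return[OF _ Jx]) auto
      also have "\<dots> = (\<Sum>k\<in>UNIV. ennreal (?J (x, selected_path l D x u k)) * ennreal (softmax (log_ratio l D x u) k))"
        by (simp add: nn_integral_measure_pmf_UNIV pmf_selection_pmf)
      also have "\<dots> = ennreal (\<Sum>k\<in>UNIV. ?J (x, selected_path l D x u k) * softmax (log_ratio l D x u) k)"
        using softmax_pos[of "log_ratio l D x u"] by (simp add: ennreal_mult[symmetric] sum_ennreal less_imp_le)
      also have "(\<Sum>k\<in>UNIV. ?J (x, selected_path l D x u k) * softmax (log_ratio l D x u) k) = squared_jump l D t x u"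
        unfolding squared_jump_def J_eq selected_path_eq by (intro sum.cong refl) (simp add: mult.commute)
      finally show "(\<integral>\<^sup>+x'. ennreal (?J (x, x')) \<partial>inner x u) = ennreal (squared_jump l D t x u)" .
    qed
    finally show "(\<integral>\<^sup>+z. ennreal (?J z) \<partial>outer x) = (\<integral>\<^sup>+u. ennreal (squared_jump l D t x u) \<partial>?U)" .
  qed
  also have "\<dots> = (\<integral>\<^sup>+z. ennreal (squared_jump l D t (fst z) (snd z)) \<partial>(?X \<Otimes>\<^sub>M ?U))"
    by (subst U.nn_integral_fst[symmetric]) (use sj in simp_all)
  finally have nn: "(\<integral>\<^sup>+z. ennreal (?J z) \<partial>(?X \<bind> outer)) = (\<integral>\<^sup>+z. ennreal (squared_jump l D t (fst z) (snd z)) \<partial>(?X \<Otimes>\<^sub>M ?U))" .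
  have "squared_jump l D t x u \<ge> 0" for x and u :: "'t \<times> nat \<Rightarrow> real^'n"
    unfolding squared_jump_def by (intro sum_nonneg mult_nonneg_nonneg) (auto intro: less_imp_le softmax_pos sum_nonneg)
  moreover have "(\<lambda>z. squared_jump l D t (fst z) (snd z)) \<in> borel_measurable (?X \<Otimes>\<^sub>M ?U)"
    by (rule sj)
  moreover have "?J \<in> borel_measurable (?X \<bind> outer)"
    unfolding measurable_cong_sets[OF sets_law refl] by (rule J)
  ultimately show ?thesis
    unfolding ESJD_def law using nn by (simp add: integral_eq_nn_integral)
qed

end

section \<open>The limiting law as one softmax over paths with independent normal weights\<close>

lemma distr_PiM_map:
  assumes "I \<noteq> {}" and M: "\<And>i. i \<in> I \<Longrightarrow> prob_space (M i)" and f: "\<And>i. i \<in> I \<Longrightarrow> f i \<in> measurable (M i) (N i)"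
  shows "distr (PiM I M) (PiM I N) (\<lambda>\<omega>. \<lambda>i\<in>I. f i (\<omega> i)) = PiM I (\<lambda>i. distr (M i) (N i) (f i))"
proof -
  interpret prob_space "PiM I M" using M by (rule prob_space_PiM)
  have ind: "indep_vars N (\<lambda>i \<omega>. f i (\<omega> i)) I"
    by (rule indep_vars_compose2[OF indep_vars_PiM_coordinates[OF M] f])
  have rv: "\<And>i. i \<in> I \<Longrightarrow> (\<lambda>\<omega>. f i (\<omega> i)) \<in> measurable (PiM I M) (N i)"
    using ind by (auto simp: indep_vars_def)
  have "distr (PiM I M) (PiM I N) (\<lambda>\<omega>. \<lambda>i\<in>I. f i (\<omega> i)) = PiM I (\<lambda>i. distr (PiM I M) (N i) (\<lambda>\<omega>. f i (\<omega> i)))"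
    using indep_vars_iff_distr_eq_PiM'[OF \<open>I \<noteq> {}\<close> rv] ind by simp
  also have "\<dots> = PiM I (\<lambda>i. distr (M i) (N i) (f i))"
  proof (rule PiM_cong[OF refl])
    fix i assume i: "i \<in> I"
    have "distr (M i) (N i) (f i) = distr (distr (PiM I M) (M i) (\<lambda>\<omega>. \<omega> i)) (N i) (f i)"
      by (subst distr_PiM_component[OF M i]) simp_all
    also have "\<dots> = distr (PiM I M) (N i) (\<lambda>\<omega>. f i (\<omega> i))"
      using i f by (subst distr_distr) (auto simp: o_def)
    finally show "distr (PiM I M) (N i) (\<lambda>\<omega>. f i (\<omega> i)) = distr (M i) (N i) (f i)" ..
  qed
  finally show ?thesis .
qed

text \<open>The limiting log-weight of a path. Scale and noise are separate arguments so that the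
  random scale and its limit can be compared on the same noise.\<close>

definition potential ::
    "('t \<Rightarrow> real) \<Rightarrow> ('t \<Rightarrow> real) \<Rightarrow> ('t \<Rightarrow> real^'n) \<Rightarrow> ('t::finite \<Rightarrow> 'n::finite option) \<Rightarrow> real" where
  "potential b \<sigma> w k = (\<Sum>s\<in>UNIV. case k s of None \<Rightarrow> 0 | Some n \<Rightarrow> \<sigma> s * w s $ n - b s)"

lemma sum_UNIV_option: "(\<Sum>k\<in>UNIV. f k) = f None + (\<Sum>n\<in>UNIV. f (Some n))"
  for f :: "'n::finite option \<Rightarrow> real"
  by (simp add: UNIV_option_conv sum.reindex)

lemma Psi_eq: "Psi h k = softmax (case_option 0 (vec_nth h)) k"
  unfolding Psi_def softmax_def sum_UNIV_option by simp

text \<open>Expanding the product over times of the normalisers gives the sum over all paths, so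
  independent labels amount to a single softmax with additive weights. In this form the limiting law
  is comparable with the selection among whole paths.\<close>

lemma prod_Psi:
  "(\<Prod>s\<in>UNIV. Psi (v s) (k s)) = softmax (\<lambda>k. \<Sum>s\<in>UNIV. case k s of None \<Rightarrow> 0 | Some n \<Rightarrow> v s $ n) k"
proof -
  have "(\<Prod>s\<in>UNIV. \<Sum>j\<in>UNIV. exp (case_option 0 (vec_nth (v s)) j)) =
      (\<Sum>k\<in>UNIV. \<Prod>s\<in>UNIV. exp (case_option 0 (vec_nth (v s)) (k s)))"
    using prod_sum_PiE[of UNIV "\<lambda>_. UNIV" "\<lambda>s j. exp (case_option 0 (vec_nth (v s)) j)"] by simp
  then show ?thesis
    unfolding Psi_eq softmax_def prod_dividef by (simp add: exp_sum)
qed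

lemma pmf_Pi_Psi:
  fixes v :: "'t::finite \<Rightarrow> real^'n::finite"
  shows "pmf (Pi_pmf UNIV None (\<lambda>t. embed_pmf (Psi (v t)))) k =
    softmax (\<lambda>k. \<Sum>s\<in>UNIV. case k s of None \<Rightarrow> 0 | Some n \<Rightarrow> v s $ n) k"
proof -
  have "pmf (embed_pmf (Psi (v s))) j = Psi (v s) j" for s j
    by (rule pmf_embed_pmf_finite) (auto simp: Psi_eq intro: less_imp_le softmax_pos sum_softmax)
  then show ?thesis by (simp add: pmf_Pi prod_Psi)
qed

lemma measurable_potential [measurable (raw)]:
  fixes w :: "'z \<Rightarrow> 't::finite \<Rightarrow> real^'n::finite"
  assumes [measurable]: "\<And>s. (\<lambda>z. \<sigma> z s) \<in> borel_measurable M" "\<And>s. (\<lambda>z. w z s) \<in> borel_measurable M"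
  shows "(\<lambda>z. potential b (\<sigma> z) (w z) k) \<in> borel_measurable M"
proof -
  have "(\<lambda>z. case k s of None \<Rightarrow> 0 | Some n \<Rightarrow> \<sigma> z s * w z s $ n - b s) \<in> borel_measurable M" for s
    by (cases "k s") simp_all
  then show ?thesis unfolding potential_def by (rule borel_measurable_sum)
qed

definition standard_noise :: "('t::finite \<Rightarrow> real^'n::finite) measure" where
  "standard_noise = PiM UNIV (\<lambda>_. noise)"

lemma sets_standard_noise [measurable_cong]: "sets standard_noise = sets (PiM UNIV (\<lambda>_. borel))"
  unfolding standard_noise_def by (rule sets_PiM_cong) auto

lemma prob_space_standard_noise: "prob_space standard_noise"
  unfolding standard_noise_def by (intro prob_space_PiM prob_space_noise)

text \<open>Positive variances make each normal law an affine image of \<open>noise\<close>.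
  Averaging out the labels with \<open>pmf_Pi_Psi\<close> leaves an integral over standardised
  noise, whose law depends neither on the target nor on the step sizes.\<close>

lemma limit_acceptance_eq_integral:
  fixes p :: "real^'t::finite \<Rightarrow> real"
  assumes pos: "\<And>s. l s * info p s > 0"
  shows "limit_acceptance (Sigma_N :: real^'n::finite^'n) l p t =
    (\<integral>w. (\<Sum>k\<in>{k. k t \<noteq> None}. softmax (potential (\<lambda>s. l s * info p s / 2) (\<lambda>s. sqrt (l s * info p s)) w) k)
      \<partial>(standard_noise :: ('t \<Rightarrow> real^'n) measure))"
proof -
  let ?mu = "\<lambda>s. (- (1/2) * l s * info p s) *\<^sub>R (\<chi> n. 1) :: real^'n"
  let ?aff = "\<lambda>s x. ?mu s + sqrt (l s * info p s) *\<^sub>R x"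
  let ?B = "PiM UNIV (\<lambda>_. borel) :: ('t \<Rightarrow> real^'n) measure"
  let ?N = "?B \<Otimes>\<^sub>M count_space UNIV :: (('t \<Rightarrow> real^'n) \<times> ('t \<Rightarrow> 'n option)) measure"
  define V where "V = PiM UNIV (\<lambda>s. multivariate_normal (?mu s) ((l s * info p s) *\<^sub>R Sigma_N))"
  interpret W: prob_space "standard_noise :: ('t \<Rightarrow> real^'n) measure" by (rule prob_space_standard_noise)
  let ?G = "\<lambda>w. \<lambda>s\<in>UNIV. ?aff s (w s)"
  have G: "?G \<in> measurable standard_noise ?B" by measurable
  have V: "V = distr standard_noise ?B ?G"
    unfolding V_def standard_noise_def multivariate_normal_eq_distr_noise[OF pos]
    by (rule distr_PiM_map[symmetric]) (auto intro: prob_space_noise)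
  interpret V: prob_space V unfolding V by (rule W.prob_space_distr[OF G])
  have setsV [measurable_cong]: "sets V = sets ?B" unfolding V by simp
  let ?K = "\<lambda>v. measure_pmf (Pi_pmf UNIV None (\<lambda>t. embed_pmf (Psi (v t)))) :: ('t \<Rightarrow> 'n option) measure"
  let ?S = "\<lambda>v :: 't \<Rightarrow> real^'n. \<lambda>k. \<Sum>s\<in>UNIV. case k s of None \<Rightarrow> 0 | Some n \<Rightarrow> v s $ n"
  have S: "(\<lambda>v. ?S v k) \<in> borel_measurable ?B" for k
  proof (rule borel_measurable_sum)
    fix s show "(\<lambda>v. case k s of None \<Rightarrow> 0 | Some n \<Rightarrow> v s $ n) \<in> borel_measurable ?B"
      by (cases "k s") simp_all
  qed
  let ?F = "\<lambda>v. \<Sum>k\<in>{k. k t \<noteq> None}. softmax (?S v) k"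
  have F: "?F \<in> borel_measurable ?B"
    by (intro borel_measurable_sum measurable_softmax S)
  have F0: "?F v \<ge> 0" for v by (intro sum_nonneg less_imp_le softmax_pos)
  have K: "?K \<in> measurable V (subprob_algebra (count_space UNIV))"
    by (rule measurable_measure_pmf_finite, unfold pmf_Pi_Psi measurable_cong_sets[OF setsV refl],
        rule measurable_softmax, rule S)
  define f where "f = (\<lambda>v. ?K v \<bind> (\<lambda>k. return ?N (v, k)))"
  have f: "f \<in> measurable V (subprob_algebra ?N)"
    unfolding f_def by (rule measurable_bind[OF K]) (rule measurable_compose[OF _ return_measurable], measurable)
  have law: "limit_law Sigma_N l p = V \<bind> f" unfolding limit_law_def V_def f_def ..
  have sets_law: "sets (V \<bind> f) = sets ?N" by (rule sets_bind[OF sets_kernel[OF f] V.not_empty])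
  let ?A = "{z \<in> space ?N. snd z t \<noteq> None}"
  have "snd -` {k. k t \<noteq> None} \<inter> space ?N \<in> sets ?N"
    by (rule measurable_sets[OF measurable_snd]) simp
  also have "snd -` {k. k t \<noteq> None} \<inter> space ?N = ?A" by auto
  finally have A: "?A \<in> sets ?N" .
  have "emeasure (V \<bind> f) ?A = (\<integral>\<^sup>+v. emeasure (f v) ?A \<partial>V)"
    by (rule emeasure_bind[OF V.not_empty f A])
  also have "\<dots> = (\<integral>\<^sup>+v. ennreal (?F v) \<partial>V)"
  proof (rule nn_integral_cong)
    fix v assume "v \<in> space V"
    then have v: "v \<in> space ?B" using sets_eq_imp_space_eq[OF setsV] by simp
    have "emeasure (f v) ?A = (\<integral>\<^sup>+k. emeasure (return ?N (v, k)) ?A \<partial>?K v)"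
      unfolding f_def by (rule emeasure_bind) (use A v in \<open>auto simp: space_subprob_algebra space_pair_measure intro!: prob_space_imp_subprob_space prob_space_return\<close>)
    also have "\<dots> = (\<integral>\<^sup>+k. indicator ?A (v, k) \<partial>?K v)"
      using A by (intro nn_integral_cong) simp
    also have "\<dots> = (\<Sum>k\<in>UNIV. indicator ?A (v, k) * ennreal (softmax (?S v) k))"
      by (simp add: nn_integral_measure_pmf_UNIV pmf_Pi_Psi)
    also have "\<dots> = (\<Sum>k\<in>{k. k t \<noteq> None}. ennreal (softmax (?S v) k))"
      using v by (intro sum.mono_neutral_cong_right) (auto simp: indicator_def space_pair_measure)
    also have "\<dots> = ennreal (?F v)"
      by (rule sum_ennreal) (intro less_imp_le softmax_pos)
    finally show "emeasure (f v) ?A = ennreal (?F v)" .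
  qed
  finally have "measure (V \<bind> f) ?A = (\<integral>v. ?F v \<partial>V)"
    unfolding measure_def using F F0 setsV by (subst integral_eq_nn_integral) (auto cong: measurable_cong_sets)
  also have "\<dots> = (\<integral>w. ?F (?G w) \<partial>standard_noise)"
    unfolding V by (rule integral_distr[OF G F])
  also have "(\<lambda>w. ?F (?G w)) = (\<lambda>w. \<Sum>k\<in>{k. k t \<noteq> None}. softmax (potential (\<lambda>s. l s * info p s / 2) (\<lambda>s. sqrt (l s * info p s)) w) k)"
  proof -
    have "?S (?G w) = potential (\<lambda>s. l s * info p s / 2) (\<lambda>s. sqrt (l s * info p s)) w" for w
      unfolding potential_def by (intro ext sum.cong refl) (auto split: option.split)
    then show ?thesis by simp
  qed
  finally show ?thesis
    unfolding limit_acceptance_def law sets_eq_imp_space_eq[OF sets_law] .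
qed

section \<open>Averages under the noise and the target\<close>

lemma
  shows integrable_std_gauss_abs_power: "integrable (std_gauss :: real measure) (\<lambda>x. \<bar>x\<bar> ^ k)"
    and integrable_std_gauss_power: "integrable (std_gauss :: real measure) (\<lambda>x. x ^ k)"
    and integral_std_gauss: "(\<integral>x. x \<partial>(std_gauss :: real measure)) = 0"
    and integral_std_gauss_square: "(\<integral>x. x\<^sup>2 \<partial>(std_gauss :: real measure)) = 1"
proof -
  show "integrable (std_gauss :: real measure) (\<lambda>x. \<bar>x\<bar> ^ k)"
    unfolding std_gauss_real using integrable_std_normal_moment_abs[of k]
    by (subst integrable_density) auto
  show "integrable (std_gauss :: real measure) (\<lambda>x. x ^ k)"
    unfolding std_gauss_real using integrable_std_normal_moment[of k]
    by (subst integrable_density) auto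
  show "(\<integral>x. x \<partial>(std_gauss :: real measure)) = 0"
    unfolding std_gauss_real using integral_std_normal_moment_odd[of 0]
    by (subst integral_density) auto
  show "(\<integral>x. x\<^sup>2 \<partial>(std_gauss :: real measure)) = 1"
    unfolding std_gauss_real using integral_std_normal_moment_even[of 1]
    by (subst integral_density) auto
qed

lemma measurable_ident_multivariate_normal: "(\<lambda>x. x) \<in> borel_measurable (multivariate_normal \<mu> S)"
  by (rule measurable_ident_sets) simp

lemma measurable_noise_law_coordinate:
  "i \<in> UNIV \<times> {1..D} \<Longrightarrow> (\<lambda>u. u i) \<in> borel_measurable (noise_law S D)"
  unfolding measurable_cong_sets[OF sets_noise_law refl] by (rule measurable_component_singleton)

lemma distr_noise_law_coordinate:
  assumes "i \<in> UNIV \<times> {1..D}"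
  shows "distr (noise_law Sigma_N D) borel (\<lambda>u. u i $ n) = std_gauss"
proof -
  have "distr (noise_law Sigma_N D) borel (\<lambda>u. u i $ n) =
      distr (distr (noise_law Sigma_N D) noise (\<lambda>u. u i)) borel (\<lambda>v. v $ n)"
  proof (subst distr_distr)
    show "(\<lambda>v. v $ n) \<in> borel_measurable noise"
      by (rule borel_measurable_vec_nth[OF measurable_ident_multivariate_normal])
    show "(\<lambda>u. u i) \<in> measurable (noise_law Sigma_N D) noise"
      using measurable_noise_law_coordinate[OF assms] by (simp cong: measurable_cong_sets)
  qed (simp add: o_def)
  also have "distr (noise_law Sigma_N D) noise (\<lambda>u. u i) = noise"
    unfolding noise_law_def by (rule distr_PiM_component[OF prob_space_noise assms])
  finally show ?thesis by (simp add: distr_noise_component)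
qed

lemma
  fixes f :: "real \<Rightarrow> real"
  assumes i: "i \<in> UNIV \<times> {1..D}" and f [measurable]: "f \<in> borel_measurable borel"
  shows integral_noise_law: "(\<integral>u. f (u i $ n) \<partial>noise_law Sigma_N D) = (\<integral>x. f x \<partial>std_gauss)"
    and integrable_noise_law: "integrable std_gauss f \<Longrightarrow> integrable (noise_law Sigma_N D) (\<lambda>u. f (u i $ n))"
proof -
  have m: "(\<lambda>u. u i $ n) \<in> borel_measurable (noise_law Sigma_N D)"
    using i by (intro borel_measurable_vec_nth measurable_noise_law_coordinate)
  show "(\<integral>u. f (u i $ n) \<partial>noise_law Sigma_N D) = (\<integral>x. f x \<partial>std_gauss)"
    unfolding distr_noise_law_coordinate[OF i, of n, symmetric] by (rule integral_distr[symmetric, OF m f])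
  show "integrable std_gauss f \<Longrightarrow> integrable (noise_law Sigma_N D) (\<lambda>u. f (u i $ n))"
    unfolding distr_noise_law_coordinate[OF i, of n, symmetric] by (rule integrable_distr[OF m])
qed

lemma indep_vars_noise_law:
  "prob_space.indep_vars (noise_law Sigma_N D) (\<lambda>_. borel) (\<lambda>i u. u i) (UNIV \<times> {1..D})"
proof -
  interpret prob_space "noise_law Sigma_N D" by (rule prob_space_noise_law)
  have "indep_vars (\<lambda>_. noise) (\<lambda>i u. u i) (UNIV \<times> {1..D})"
    unfolding noise_law_def by (rule indep_vars_PiM_coordinates[OF prob_space_noise])
  from indep_vars_compose2[OF this, of "\<lambda>_ x. x" "\<lambda>_. borel", OF measurable_ident_multivariate_normal]
  show ?thesis .
qed

text \<open>The proviso excludes two different labels at one time, whose covariance under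
  \<open>Sigma_N\<close> is 1/2. What remains is a unit variance or a product of independent centred
  components.\<close>

lemma noise_law_product_moment:
  fixes r s :: "'t::finite" and n m :: "'n::finite"
  assumes d: "d \<in> {1..D}" and rs: "r = s \<Longrightarrow> n = m"
  shows "(\<integral>u. u (r, d) $ n * u (s, d) $ m \<partial>noise_law Sigma_N D) = (if r = s then 1 else 0)"
proof -
  interpret prob_space "noise_law Sigma_N D :: ('t \<times> nat \<Rightarrow> real^'n) measure" by (rule prob_space_noise_law)
  have i: "(r, d) \<in> UNIV \<times> {1..D}" "(s, d) \<in> UNIV \<times> {1..D}" using d by auto
  show ?thesis
  proof (cases "r = s")
    case True
    then show ?thesis
      using integral_noise_law[OF i(1), of "\<lambda>x. x\<^sup>2" n] rs by (simp add: power2_eq_square[symmetric] integral_std_gauss_square)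
  next
    case False
    \<comment> \<open>One family over the two noise coordinates that reads component
      \<open>n\<close> at the first and \<open>m\<close> at the second, so that the product rule for
      independent families applies.\<close>
    define Y where "Y = (\<lambda>(j :: 't \<times> nat) (x :: real^'n). if j = (r, d) then x $ n else x $ m)"
    have Y [measurable]: "Y j \<in> borel_measurable borel" for j
      unfolding Y_def by (cases "j = (r, d)") simp_all
    have ind: "indep_vars (\<lambda>_. borel) (\<lambda>j u. Y j (u j)) {(r, d), (s, d)}"
      by (rule indep_vars_compose2[OF indep_vars_subset[OF indep_vars_noise_law]]) (use i in auto)
    have Y1: "Y (r, d) x = x $ n" for x unfolding Y_def by (rule if_P) (rule refl)
    have Y2: "Y (s, d) x = x $ m" for x unfolding Y_def by (rule if_not_P) (use False in blast)
    have std: "integrable (std_gauss :: real measure) (\<lambda>x. x)"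
      using integrable_std_gauss_power[of 1] by (simp only: power_one_right)
    have "integrable (noise_law Sigma_N D) (\<lambda>u :: 't \<times> nat \<Rightarrow> real^'n. Y (r, d) (u (r, d)))"
      unfolding Y1 by (rule integrable_noise_law[OF i(1) _ std]) simp
    moreover have "integrable (noise_law Sigma_N D) (\<lambda>u :: 't \<times> nat \<Rightarrow> real^'n. Y (s, d) (u (s, d)))"
      unfolding Y2 by (rule integrable_noise_law[OF i(2) _ std]) simp
    ultimately have int1: "integrable (noise_law Sigma_N D) (\<lambda>u. Y j (u j))" if "j \<in> {(r, d), (s, d)}" for j
      using that by (elim insertE emptyE) (simp_all only:)
    have "(\<integral>u. (\<Prod>j\<in>{(r, d), (s, d)}. Y j (u j)) \<partial>noise_law Sigma_N D) =
        (\<Prod>j\<in>{(r, d), (s, d)}. \<integral>u. Y j (u j) \<partial>noise_law Sigma_N D)"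
      by (rule indep_vars_lebesgue_integral[OF _ ind int1]) simp
    then have "(\<integral>u. u (r, d) $ n * u (s, d) $ m \<partial>noise_law Sigma_N D) =
      (\<integral>u. u (r, d) $ n \<partial>noise_law Sigma_N D) * (\<integral>u. u (s, d) $ m \<partial>noise_law Sigma_N D)"
      using False by (simp add: Y1 Y2)
    then show ?thesis
      using False integral_noise_law[OF i(1), of "\<lambda>x. x" n] by (simp add: integral_std_gauss)
  qed
qed

text \<open>The expectation of \<open>y^4 + z^4 + 2\<close> for standard normal \<open>y\<close> and
  \<open>z\<close>, which dominates \<open>(y * z - \<delta>)^2\<close> for \<open>\<delta>\<close>
  equal to 0 or 1. It is the same for all dimensions and indices.\<close>

definition noise_constant :: real where
  "noise_constant = 2 + 2 * (\<integral>x. x ^ 4 \<partial>(std_gauss :: real measure))"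

lemma noise_constant_nonneg: "noise_constant \<ge> 0"
  unfolding noise_constant_def by (intro add_nonneg_nonneg mult_nonneg_nonneg Bochner_Integration.integral_nonneg) simp_all

lemma noise_law_product_variance:
  fixes r s :: "'t::finite" and n m :: "'n::finite"
  assumes d: "d \<in> {1..D}"
  defines "\<delta> \<equiv> (if r = s then 1 else 0 :: real)"
  shows "integrable (noise_law Sigma_N D) (\<lambda>u. (u (r, d) $ n * u (s, d) $ m - \<delta>)\<^sup>2)"
    and "(\<integral>u. (u (r, d) $ n * u (s, d) $ m - \<delta>)\<^sup>2 \<partial>noise_law Sigma_N D) \<le> noise_constant"
proof -
  interpret prob_space "noise_law Sigma_N D :: ('t \<times> nat \<Rightarrow> real^'n) measure" by (rule prob_space_noise_law)
  have i: "(r, d) \<in> UNIV \<times> {1..D}" "(s, d) \<in> UNIV \<times> {1..D}" using d by auto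
  note [measurable] = measurable_noise_law_coordinate[OF i(1)] measurable_noise_law_coordinate[OF i(2)]
  let ?g = "\<lambda>u :: 't \<times> nat \<Rightarrow> real^'n. (u (r, d) $ n) ^ 4 + (u (s, d) $ m) ^ 4 + 2"
  have int4: "integrable (noise_law Sigma_N D) (\<lambda>u. (u (r, d) $ n) ^ 4)" "integrable (noise_law Sigma_N D) (\<lambda>u. (u (s, d) $ m) ^ 4)"
    using integrable_noise_law[OF i(1), of "\<lambda>x. x ^ 4"] integrable_noise_law[OF i(2), of "\<lambda>x. x ^ 4"]
      integrable_std_gauss_power[of 4] by auto
  then have int: "integrable (noise_law Sigma_N D) ?g" by simp
  have le: "(y * z - \<delta>)\<^sup>2 \<le> y ^ 4 + z ^ 4 + 2" for y z :: real
  proof -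
    have "(y * z - \<delta>)\<^sup>2 \<le> 2 * (y * z)\<^sup>2 + 2 * \<delta>\<^sup>2"
      using zero_le_power2[of "y * z + \<delta>"] by (simp add: power2_diff power2_sum)
    moreover have "2 * (y * z)\<^sup>2 \<le> y ^ 4 + z ^ 4"
      using zero_le_power2[of "y\<^sup>2 - z\<^sup>2"] by (simp add: power2_diff power_mult_distrib)
    moreover have "\<delta>\<^sup>2 \<le> 1" by (simp add: \<delta>_def)
    ultimately show ?thesis by linarith
  qed
  have nn: "0 \<le> y ^ 4 + z ^ 4 + (2 :: real)" for y z
    by (intro add_nonneg_nonneg) auto
  show int': "integrable (noise_law Sigma_N D) (\<lambda>u. (u (r, d) $ n * u (s, d) $ m - \<delta>)\<^sup>2)"
    by (rule Bochner_Integration.integrable_bound[OF int]) (simp_all add: le nn)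
  have "(\<integral>u. (u (r, d) $ n * u (s, d) $ m - \<delta>)\<^sup>2 \<partial>noise_law Sigma_N D) \<le> (\<integral>u. ?g u \<partial>noise_law Sigma_N D)"
    by (rule integral_mono[OF int' int le])
  also have "\<dots> = noise_constant"
    using int4 integral_noise_law[OF i(1), of "\<lambda>x. x ^ 4" n] integral_noise_law[OF i(2), of "\<lambda>x. x ^ 4" m]
    by (simp add: noise_constant_def prob_space)
  finally show "(\<integral>u. (u (r, d) $ n * u (s, d) $ m - \<delta>)\<^sup>2 \<partial>noise_law Sigma_N D) \<le> noise_constant" .
qed

text \<open>The weights \<open>c d\<close> stand for Hessian entries at a frozen state. Only their
  bound \<open>C\<close> enters, so the estimate is uniform in the state and can be integrated over
  it afterwards.\<close>

lemma noise_law_average_le: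
  fixes r s :: "'t::finite" and n m :: "'n::finite"
  assumes D: "D > 0" and rs: "r = s \<Longrightarrow> n = m" and c: "\<And>d. \<bar>c d\<bar> \<le> C"
  shows "(\<integral>\<^sup>+u. ennreal \<bar>(\<Sum>d\<in>{1..D}. c d * (u (r, d) $ n * u (s, d) $ m - (if r = s then 1 else 0))) / real D\<bar>
      \<partial>noise_law Sigma_N D) \<le> ennreal ((1 + C\<^sup>2 * noise_constant) / sqrt (real D))"
proof -
  interpret prob_space "noise_law Sigma_N D :: ('t \<times> nat \<Rightarrow> real^'n) measure" by (rule prob_space_noise_law)
  let ?\<delta> = "if r = s then 1 else 0 :: real"
  let ?\<zeta> = "\<lambda>d (u :: 't \<times> nat \<Rightarrow> real^'n). u (r, d) $ n * u (s, d) $ m - ?\<delta>"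
  have C: "C \<ge> 0" using c[of 0] by linarith
  show ?thesis
  proof (rule nn_integral_abs_average_le[OF D])
    \<comment> \<open>A summand may involve the noise at two times; collecting all times with the
      same \<open>d\<close> into one block makes the summands functions of independent
      blocks.\<close>
    have "indep_vars (\<lambda>d. PiM (UNIV \<times> {d}) (\<lambda>_. borel)) (\<lambda>d u. restrict (\<lambda>i. u i) (UNIV \<times> {d})) {1..D}"
      by (rule indep_vars_restrict[OF indep_vars_noise_law]) (auto simp: disjoint_family_on_def)
    then have "indep_vars (\<lambda>_. borel) (\<lambda>d u. c d * ?\<zeta> d (restrict (\<lambda>i. u i) (UNIV \<times> {d}))) {1..D}"
    proof (rule indep_vars_compose2)
      fix d
      have [measurable]: "(\<lambda>u :: 't \<times> nat \<Rightarrow> real^'n. u (a, d)) \<in> borel_measurable (PiM (UNIV \<times> {d}) (\<lambda>_. borel))" for a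
        by (rule measurable_component_singleton) simp
      show "(\<lambda>u. c d * ?\<zeta> d u) \<in> borel_measurable (PiM (UNIV \<times> {d}) (\<lambda>_. borel))"
        by measurable
    qed
    then show "indep_vars (\<lambda>_. borel) (\<lambda>d u. c d * ?\<zeta> d u) {1..D}" by simp
    fix d assume d: "d \<in> {1..D}"
    have sq: "(c d * ?\<zeta> d u)\<^sup>2 = (c d)\<^sup>2 * (?\<zeta> d u)\<^sup>2" for u by (rule power_mult_distrib)
    note var = noise_law_product_variance[OF d, of r n s m]
    show "integrable (noise_law Sigma_N D) (\<lambda>u. (c d * ?\<zeta> d u)\<^sup>2)"
      unfolding sq by (rule integrable_mult_right[OF var(1)])
    have i: "(r, d) \<in> UNIV \<times> {1..D}" "(s, d) \<in> UNIV \<times> {1..D}" using d by auto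
    note [measurable] = measurable_noise_law_coordinate[OF i(1)] measurable_noise_law_coordinate[OF i(2)]
    have "integrable (noise_law Sigma_N D) (?\<zeta> d)"
      by (rule square_integrable_imp_integrable[OF _ var(1)]) measurable
    then have "integrable (noise_law Sigma_N D) (\<lambda>u. ?\<zeta> d u + ?\<delta>)"
      by (rule Bochner_Integration.integrable_add) simp
    then have "integrable (noise_law Sigma_N D) (\<lambda>u :: 't \<times> nat \<Rightarrow> real^'n. u (r, d) $ n * u (s, d) $ m)" by simp
    then show "expectation (\<lambda>u. c d * ?\<zeta> d u) = 0"
      using noise_law_product_moment[of d D r s n m] d rs by (simp add: prob_space)
    have "expectation (\<lambda>u. (c d * ?\<zeta> d u)\<^sup>2) = (c d)\<^sup>2 * expectation (\<lambda>u. (?\<zeta> d u)\<^sup>2)"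
      unfolding sq by (rule integral_mult_right_zero)
    also have "\<dots> \<le> C\<^sup>2 * noise_constant"
      using c[of d] C by (intro mult_mono var(2)) (auto simp: abs_le_square_iff[symmetric] intro: integral_nonneg_AE)
    finally show "expectation (\<lambda>u. (c d * ?\<zeta> d u)\<^sup>2) \<le> C\<^sup>2 * noise_constant" .
  qed
qed

text \<open>With frozen weights, the noise blocks of different times are disjoint and hence
  independent, and inside a block \<open>distr_sum_indep_noise\<close> gives the exact law. The
  joint law over all times is recorded because the softmax over paths couples them.\<close>

lemma distr_noise_law_weighted_sums:
  fixes c :: "'t::finite \<Rightarrow> nat \<Rightarrow> real"
  shows "distr (noise_law Sigma_N D) (PiM UNIV (\<lambda>_. borel)) (\<lambda>u s. \<Sum>d\<in>{1..D}. c s d *\<^sub>R u (s, d)) =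
    distr (standard_noise :: ('t \<Rightarrow> real^'n::finite) measure) (PiM UNIV (\<lambda>_. borel))
      (\<lambda>w s. sqrt (\<Sum>d\<in>{1..D}. (c s d)\<^sup>2) *\<^sub>R w s)"
proof -
  interpret prob_space "noise_law Sigma_N D :: ('t \<times> nat \<Rightarrow> real^'n) measure" by (rule prob_space_noise_law)
  let ?W = "\<lambda>s (u :: 't \<times> nat \<Rightarrow> real^'n). \<Sum>d\<in>{1..D}. c s d *\<^sub>R u (s, d)"
  have "indep_vars (\<lambda>s. PiM ({s} \<times> {1..D}) (\<lambda>_. borel)) (\<lambda>s u. restrict (\<lambda>i. u i) ({s} \<times> {1..D})) UNIV"
    by (rule indep_vars_restrict[OF indep_vars_noise_law]) (auto simp: disjoint_family_on_def)
  then have "indep_vars (\<lambda>_. borel) (\<lambda>s u. ?W s (restrict (\<lambda>i. u i) ({s} \<times> {1..D}))) UNIV"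
  proof (rule indep_vars_compose2)
    fix s
    have "(\<lambda>u :: 't \<times> nat \<Rightarrow> real^'n. u (s, d)) \<in> borel_measurable (PiM ({s} \<times> {1..D}) (\<lambda>_. borel))" if "d \<in> {1..D}" for d
      by (rule measurable_component_singleton) (use that in simp)
    then show "?W s \<in> borel_measurable (PiM ({s} \<times> {1..D}) (\<lambda>_. borel))"
      by (intro borel_measurable_sum borel_measurable_scaleR borel_measurable_const)
  qed
  moreover have "?W s (restrict (\<lambda>i. u i) ({s} \<times> {1..D})) = ?W s u" for s u
    by (intro sum.cong) auto
  ultimately have ind: "indep_vars (\<lambda>_. borel) ?W UNIV" by simp
  have rv: "?W s \<in> borel_measurable (noise_law Sigma_N D)" for s
    using ind by (auto simp: indep_vars_def)
  have W: "distr (noise_law Sigma_N D) borel (?W s) = distr noise borel (\<lambda>x. sqrt (\<Sum>d\<in>{1..D}. (c s d)\<^sup>2) *\<^sub>R x)" for s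
  proof (rule distr_sum_indep_noise)
    have "indep_vars (\<lambda>d. PiM {(s, d)} (\<lambda>_. borel)) (\<lambda>d u. restrict (\<lambda>i. u i) {(s, d)}) {1..D}"
      by (rule indep_vars_restrict[OF indep_vars_noise_law]) (auto simp: disjoint_family_on_def)
    then have "indep_vars (\<lambda>_. borel) (\<lambda>d u. (restrict (\<lambda>i. u i) {(s, d)}) (s, d)) {1..D}"
      by (rule indep_vars_compose2) (rule measurable_component_singleton, simp)
    then show "indep_vars (\<lambda>_. borel) (\<lambda>d u. u (s, d)) {1..D}" by simp
    fix d assume "d \<in> {1..D}"
    then have "(s, d) \<in> UNIV \<times> {1..D}" by simp
    then have "distr (noise_law Sigma_N D) noise (\<lambda>u :: 't \<times> nat \<Rightarrow> real^'n. u (s, d)) = noise"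
      unfolding noise_law_def by (intro distr_PiM_component prob_space_noise)
    moreover have "distr (noise_law Sigma_N D) noise (\<lambda>u :: 't \<times> nat \<Rightarrow> real^'n. u (s, d)) = distr (noise_law Sigma_N D) borel (\<lambda>u. u (s, d))"
      by (rule distr_cong) simp_all
    ultimately show "distr (noise_law Sigma_N D) borel (\<lambda>u :: 't \<times> nat \<Rightarrow> real^'n. u (s, d)) = noise" by simp
  qed simp
  have "distr (noise_law Sigma_N D) (PiM UNIV (\<lambda>_. borel)) (\<lambda>u. \<lambda>s\<in>UNIV. ?W s u) =
    PiM UNIV (\<lambda>s. distr (noise_law Sigma_N D) borel (?W s))"
    using ind by (subst indep_vars_iff_distr_eq_PiM'[symmetric, OF _ rv]) simp_all
  also have "\<dots> = PiM UNIV (\<lambda>s. distr noise borel (\<lambda>x. sqrt (\<Sum>d\<in>{1..D}. (c s d)\<^sup>2) *\<^sub>R x))"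
    unfolding W ..
  also have "\<dots> = distr standard_noise (PiM UNIV (\<lambda>_. borel)) (\<lambda>w. \<lambda>s\<in>UNIV. sqrt (\<Sum>d\<in>{1..D}. (c s d)\<^sup>2) *\<^sub>R w s)"
    unfolding standard_noise_def by (rule distr_PiM_map[symmetric]) (auto intro: prob_space_noise)
  finally show ?thesis unfolding restrict_UNIV .
qed

context smooth_density
begin

text \<open>Centring lowers the second moment, so the second moment of \<open>f\<close> bounds the
  variance of each term.\<close>

lemma target_average_le:
  fixes f :: "real^'t \<Rightarrow> real"
  assumes D: "D > 0" and f [measurable]: "f \<in> borel_measurable borel" and sq: "integrable \<mu> (\<lambda>x. (f x)\<^sup>2)"
  shows "(\<integral>\<^sup>+x. ennreal \<bar>(\<Sum>d\<in>{1..D}. f (x d) - (\<integral>y. f y \<partial>\<mu>)) / real D\<bar> \<partial>target_measure_D p D)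
    \<le> ennreal ((1 + (\<integral>y. (f y)\<^sup>2 \<partial>\<mu>)) / sqrt (real D))"
proof -
  interpret M: prob_space \<mu> by (rule prob_space_target)
  interpret X: prob_space "target_measure_D p D" by (rule prob_space_target_measure_D)
  have prob_UNIV: "M.prob UNIV = 1" using M.prob_space by simp
  let ?m = "\<integral>y. f y \<partial>\<mu>"
  let ?g = "\<lambda>y. f y - ?m"
  have int: "integrable \<mu> f"
    by (rule M.square_integrable_imp_integrable[OF _ sq]) measurable
  have sq_eq: "(?g y)\<^sup>2 = (f y)\<^sup>2 - 2 * ?m * f y + ?m\<^sup>2" for y
    by (simp add: power2_diff)
  have intg2: "integrable \<mu> (\<lambda>y. (?g y)\<^sup>2)" unfolding sq_eq using sq int by simp
  have comp: "distr (target_measure_D p D) \<mu> (\<lambda>x. x d) = \<mu>" if "d \<in> {1..D}" for d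
    unfolding target_measure_D_def by (rule distr_PiM_component[OF prob_space_target that])
  have md: "(\<lambda>x. x d) \<in> measurable (target_measure_D p D) \<mu>" if "d \<in> {1..D}" for d
    unfolding target_measure_D_def by (rule measurable_component_singleton[OF that])
  show ?thesis
  proof (rule X.nn_integral_abs_average_le[OF D])
    have "X.indep_vars (\<lambda>_. \<mu>) (\<lambda>d x. x d) {1..D}"
      unfolding target_measure_D_def by (rule indep_vars_PiM_coordinates[OF prob_space_target])
    then show "X.indep_vars (\<lambda>_. borel) (\<lambda>d x. f (x d) - ?m) {1..D}"
      by (rule X.indep_vars_compose2) measurable
    fix d assume d: "d \<in> {1..D}"
    show "integrable (target_measure_D p D) (\<lambda>x. (f (x d) - ?m)\<^sup>2)"
      by (rule integrable_distr[OF md[OF d], of "\<lambda>y. (?g y)\<^sup>2"]) (unfold comp[OF d], rule intg2)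
    have "X.expectation (\<lambda>x. f (x d) - ?m) = (\<integral>y. ?g y \<partial>distr (target_measure_D p D) \<mu> (\<lambda>x. x d))"
      by (rule integral_distr[symmetric, OF md[OF d]]) measurable
    then show "X.expectation (\<lambda>x. f (x d) - ?m) = 0"
      unfolding comp[OF d] using int by (simp add: prob_UNIV)
    have "X.expectation (\<lambda>x. (f (x d) - ?m)\<^sup>2) = (\<integral>y. (?g y)\<^sup>2 \<partial>distr (target_measure_D p D) \<mu> (\<lambda>x. x d))"
      by (rule integral_distr[symmetric, OF md[OF d]]) measurable
    also have "\<dots> = (\<integral>y. (f y)\<^sup>2 \<partial>\<mu>) - ?m\<^sup>2"
      unfolding comp[OF d] sq_eq using int sq by (simp add: prob_UNIV power2_eq_square)
    finally show "X.expectation (\<lambda>x. (f (x d) - ?m)\<^sup>2) \<le> (\<integral>y. (f y)\<^sup>2 \<partial>\<mu>)" by simp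
  qed
qed

end

section \<open>Vanishing errors\<close>

text \<open>Equal noise makes the drifts cancel. Summing the absolute components over all labels
  gives a bound that is the same for every path.\<close>

lemma potential_diff_le:
  "\<bar>potential b \<sigma> w k - potential b \<tau> w k\<bar> \<le> (\<Sum>s\<in>UNIV. \<bar>\<sigma> s - \<tau> s\<bar> * (\<Sum>n\<in>UNIV. \<bar>w s $ n\<bar>))"
proof -
  have "\<bar>(case k s of None \<Rightarrow> 0 | Some n \<Rightarrow> \<sigma> s * w s $ n - b s) - (case k s of None \<Rightarrow> 0 | Some n \<Rightarrow> \<tau> s * w s $ n - b s)\<bar>
      \<le> \<bar>\<sigma> s - \<tau> s\<bar> * (\<Sum>n\<in>UNIV. \<bar>w s $ n\<bar>)" for s
  proof (cases "k s")
    case (Some n)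
    have "\<bar>\<sigma> s * w s $ n - \<tau> s * w s $ n\<bar> = \<bar>\<sigma> s - \<tau> s\<bar> * \<bar>w s $ n\<bar>"
      by (simp add: abs_mult[symmetric] left_diff_distrib)
    also have "\<dots> \<le> \<bar>\<sigma> s - \<tau> s\<bar> * (\<Sum>n\<in>UNIV. \<bar>w s $ n\<bar>)"
      by (intro mult_left_mono member_le_sum) auto
    finally show ?thesis by (simp add: Some)
  qed (simp add: sum_nonneg)
  then show ?thesis
    unfolding potential_def sum_subtractf[symmetric] by (intro order_trans[OF sum_abs] sum_mono)
qed

lemma potential_scaleR: "potential b (\<lambda>_. 1) (\<lambda>s. \<sigma> s *\<^sub>R w s) k = potential b \<sigma> w k"
  unfolding potential_def by (intro sum.cong refl) (simp split: option.split)

text \<open>Multiplication by \<open>sqrt a + sqrt b\<close>, of which only \<open>sqrt b\<close> is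
  kept: \<open>a\<close> will be a random variance that may be arbitrarily small, while
  \<open>b\<close> is its fixed positive limit.\<close>

lemma sqrt_diff_le:
  assumes "a \<ge> 0" "b > 0"
  shows "\<bar>sqrt a - sqrt b\<bar> \<le> \<bar>a - b\<bar> / sqrt b"
proof -
  have "\<bar>sqrt a - sqrt b\<bar> * sqrt b \<le> \<bar>sqrt a - sqrt b\<bar> * (sqrt a + sqrt b)"
    using assms by (intro mult_left_mono) auto
  also have "\<dots> = \<bar>(sqrt a - sqrt b) * (sqrt a + sqrt b)\<bar>"
    using assms by (simp add: abs_mult)
  also have "(sqrt a - sqrt b) * (sqrt a + sqrt b) = a - b"
    using assms by (simp add: algebra_simps)
  finally show ?thesis using assms by (simp add: le_divide_eq)
qed

text \<open>Every term is at most the largest one, \<open>a s0\<close>, whose cube occurs on the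
  right.\<close>

lemma cube_sum_le:
  fixes a :: "'t::finite \<Rightarrow> real"
  assumes "\<And>s. a s \<ge> 0"
  shows "(\<Sum>s\<in>UNIV. a s) ^ 3 \<le> real CARD('t) ^ 3 * (\<Sum>s\<in>UNIV. a s ^ 3)"
proof -
  obtain s0 where s0: "\<And>s. a s \<le> a s0"
    using Max_ge[of "range a"] Max_in[of "range a"] by fastforce
  have "(\<Sum>s\<in>UNIV. a s) \<le> real CARD('t) * a s0"
    using sum_bounded_above[of UNIV a "a s0"] s0 by simp
  then have "(\<Sum>s\<in>UNIV. a s) ^ 3 \<le> (real CARD('t) * a s0) ^ 3"
    by (intro power_mono sum_nonneg assms)
  also have "\<dots> = real CARD('t) ^ 3 * a s0 ^ 3" by (rule power_mult_distrib)
  also have "\<dots> \<le> real CARD('t) ^ 3 * (\<Sum>s\<in>UNIV. a s ^ 3)"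
    by (intro mult_left_mono member_le_sum) (auto simp: assms)
  finally show ?thesis .
qed

lemma scaled_average_diff:
  assumes "D > 0"
  shows "(\<Sum>d\<in>{1..D}. (c / real D) * f d) - c * e = c * ((\<Sum>d\<in>{1..D}. f d - e) / real D)"
  using assms by (simp add: sum_distrib_left[symmetric] sum_divide_distrib[symmetric] sum_subtractf
      right_diff_distrib diff_divide_distrib)

text \<open>The parameter \<open>noise_dim\<close> only fixes the type of the proposal labels.\<close>

locale rw_ehmm = smooth_density p for p :: "real^'t::finite \<Rightarrow> real" +
  fixes l :: "'t \<Rightarrow> real" and noise_dim :: "'n::finite itself"
  assumes l_pos: "\<And>s. l s > 0"
begin

section \<open>The class of errors of order 1 / sqrt D in L1\<close>

abbreviation U :: "nat \<Rightarrow> ('t \<times> nat \<Rightarrow> real^'n) measure" where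
  "U D \<equiv> noise_law Sigma_N D"

abbreviation X :: "nat \<Rightarrow> (nat \<Rightarrow> real^'t) measure" where
  "X D \<equiv> target_measure_D p D"

definition joint :: "nat \<Rightarrow> ((nat \<Rightarrow> real^'t) \<times> ('t \<times> nat \<Rightarrow> real^'n)) measure" where
  "joint D = X D \<Otimes>\<^sub>M U D"

lemma prob_space_joint: "prob_space (joint D)"
  unfolding joint_def by (intro prob_space_pair prob_space_target_measure_D prob_space_noise_law)

lemma measurable_joint_fst:
  assumes "d \<in> {1..D}"
  shows "(\<lambda>z. fst z d) \<in> borel_measurable (joint D)"
proof -
  have "(\<lambda>x. x d) \<in> borel_measurable (X D)"
    unfolding measurable_cong_sets[OF sets_target_measure_D refl] by (rule measurable_component_singleton[OF assms])
  then show ?thesis unfolding joint_def by (rule measurable_compose[OF measurable_fst])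
qed

lemma measurable_joint_snd:
  assumes "d \<in> {1..D}"
  shows "(\<lambda>z. snd z (s, d)) \<in> borel_measurable (joint D)"
  unfolding joint_def
  by (rule measurable_compose[OF measurable_snd measurable_noise_law_coordinate]) (use assms in simp)

text \<open>A single rate for all errors makes the class closed under finite sums, scalar multiples
  and domination, with constants that only have to exist. Dimension 0 is left out because the
  proposal scale and the averages divide by \<open>D\<close>.\<close>

definition vanishing :: "(nat \<Rightarrow> (nat \<Rightarrow> real^'t) \<times> ('t \<times> nat \<Rightarrow> real^'n) \<Rightarrow> real) \<Rightarrow> bool" where
  "vanishing f \<longleftrightarrow> (\<exists>C\<ge>0. \<forall>D>0. f D \<in> borel_measurable (joint D) \<and>
     (\<integral>\<^sup>+z. ennreal \<bar>f D z\<bar> \<partial>joint D) \<le> ennreal (C / sqrt (real D)))"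

lemma vanishingD:
  assumes "vanishing f" "D > 0"
  shows "f D \<in> borel_measurable (joint D)"
proof -
  obtain C where "\<forall>D>0. f D \<in> borel_measurable (joint D) \<and>
     (\<integral>\<^sup>+z. ennreal \<bar>f D z\<bar> \<partial>joint D) \<le> ennreal (C / sqrt (real D))"
    using assms(1) unfolding vanishing_def by (elim exE conjE)
  then show ?thesis using assms(2) by (elim allE[of _ D] impE conjE)
qed

lemma vanishing_bound:
  assumes f: "vanishing f" and g: "\<And>D. D > 0 \<Longrightarrow> g D \<in> borel_measurable (joint D)"
    and le: "\<And>D z. D > 0 \<Longrightarrow> \<bar>g D z\<bar> \<le> \<bar>f D z\<bar>"
  shows "vanishing g"
proof -
  obtain C where C: "C \<ge> 0" "\<And>D. D > 0 \<Longrightarrow> (\<integral>\<^sup>+z. ennreal \<bar>f D z\<bar> \<partial>joint D) \<le> ennreal (C / sqrt (real D))"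
    using f unfolding vanishing_def by auto
  have "(\<integral>\<^sup>+z. ennreal \<bar>g D z\<bar> \<partial>joint D) \<le> ennreal (C / sqrt (real D))" if "D > 0" for D
    using nn_integral_mono[of "joint D" "\<lambda>z. ennreal \<bar>g D z\<bar>" "\<lambda>z. ennreal \<bar>f D z\<bar>"] le[OF that] C(2)[OF that]
    by (auto intro: order_trans ennreal_leI)
  then show ?thesis unfolding vanishing_def using g C(1) by auto
qed

lemma vanishing_abs: "vanishing f \<Longrightarrow> vanishing (\<lambda>D z. \<bar>f D z\<bar>)"
  by (rule vanishing_bound[of f]) (simp_all add: borel_measurable_abs vanishingD)

lemma vanishing_0: "vanishing (\<lambda>D z. 0)"
  unfolding vanishing_def by (rule exI[of _ 0]) simp

lemma vanishing_add:
  assumes f: "vanishing f" and g: "vanishing g"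
  shows "vanishing (\<lambda>D z. f D z + g D z)"
proof -
  obtain C1 where C1: "C1 \<ge> 0" "\<And>D. D > 0 \<Longrightarrow> (\<integral>\<^sup>+z. ennreal \<bar>f D z\<bar> \<partial>joint D) \<le> ennreal (C1 / sqrt (real D))"
    using f unfolding vanishing_def by auto
  obtain C2 where C2: "C2 \<ge> 0" "\<And>D. D > 0 \<Longrightarrow> (\<integral>\<^sup>+z. ennreal \<bar>g D z\<bar> \<partial>joint D) \<le> ennreal (C2 / sqrt (real D))"
    using g unfolding vanishing_def by auto
  show ?thesis
    unfolding vanishing_def
  proof (intro exI[of _ "C1 + C2"] conjI allI impI)
    fix D :: nat assume D: "D > 0"
    note [measurable] = vanishingD[OF f D] vanishingD[OF g D]
    show "(\<lambda>z. f D z + g D z) \<in> borel_measurable (joint D)" by measurable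
    have "(\<integral>\<^sup>+z. ennreal \<bar>f D z + g D z\<bar> \<partial>joint D) \<le> (\<integral>\<^sup>+z. ennreal \<bar>f D z\<bar> + ennreal \<bar>g D z\<bar> \<partial>joint D)"
      by (rule nn_integral_mono, subst ennreal_plus[symmetric], simp, simp, rule ennreal_leI, rule abs_triangle_ineq)
    also have "\<dots> = (\<integral>\<^sup>+z. ennreal \<bar>f D z\<bar> \<partial>joint D) + (\<integral>\<^sup>+z. ennreal \<bar>g D z\<bar> \<partial>joint D)"
      by (rule nn_integral_add) measurable
    also have "\<dots> \<le> ennreal (C1 / sqrt (real D)) + ennreal (C2 / sqrt (real D))"
      by (intro add_mono C1 C2 D)
    also have "\<dots> = ennreal ((C1 + C2) / sqrt (real D))"
      using C1(1) C2(1) by (simp add: ennreal_plus[symmetric] add_divide_distrib del: ennreal_plus)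
    finally show "(\<integral>\<^sup>+z. ennreal \<bar>f D z + g D z\<bar> \<partial>joint D) \<le> ennreal ((C1 + C2) / sqrt (real D))" .
  qed (use C1(1) C2(1) in simp)
qed

lemma vanishing_cmult:
  assumes f: "vanishing f"
  shows "vanishing (\<lambda>D z. c * f D z)"
proof -
  obtain C where C: "C \<ge> 0" "\<And>D. D > 0 \<Longrightarrow> (\<integral>\<^sup>+z. ennreal \<bar>f D z\<bar> \<partial>joint D) \<le> ennreal (C / sqrt (real D))"
    using f unfolding vanishing_def by auto
  show ?thesis
    unfolding vanishing_def
  proof (intro exI[of _ "\<bar>c\<bar> * C"] conjI allI impI)
    fix D :: nat assume D: "D > 0"
    note [measurable] = vanishingD[OF f D]
    show "(\<lambda>z. c * f D z) \<in> borel_measurable (joint D)" by measurable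
    have "(\<integral>\<^sup>+z. ennreal \<bar>c * f D z\<bar> \<partial>joint D) = (\<integral>\<^sup>+z. ennreal \<bar>c\<bar> * ennreal \<bar>f D z\<bar> \<partial>joint D)"
      by (simp add: abs_mult ennreal_mult)
    also have "\<dots> = ennreal \<bar>c\<bar> * (\<integral>\<^sup>+z. ennreal \<bar>f D z\<bar> \<partial>joint D)"
      by (rule nn_integral_cmult) measurable
    also have "\<dots> \<le> ennreal \<bar>c\<bar> * ennreal (C / sqrt (real D))"
      by (intro mult_left_mono C D) simp
    also have "\<dots> = ennreal (\<bar>c\<bar> * C / sqrt (real D))"
      using C(1) by (simp add: ennreal_mult[symmetric])
    finally show "(\<integral>\<^sup>+z. ennreal \<bar>c * f D z\<bar> \<partial>joint D) \<le> ennreal (\<bar>c\<bar> * C / sqrt (real D))" .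
  qed (use C(1) in simp)
qed

lemma vanishing_sum:
  "finite I \<Longrightarrow> (\<And>i. i \<in> I \<Longrightarrow> vanishing (f i)) \<Longrightarrow> vanishing (\<lambda>D z. \<Sum>i\<in>I. f i D z)"
proof (induction I rule: finite_induct)
  case empty
  then show ?case using vanishing_0 by simp
next
  case (insert j I)
  have "vanishing (\<lambda>D z. f j D z + (\<Sum>i\<in>I. f i D z))"
    by (rule vanishing_add[OF insert.prems insert.IH]) (simp_all add: insert.prems)
  then show ?case using insert.hyps by simp
qed

lemma integrable_vanishing:
  assumes "vanishing f" "D > 0"
  shows "integrable (joint D) (f D)"
proof (rule integrableI_bounded)
  obtain C where "(\<integral>\<^sup>+z. ennreal \<bar>f D z\<bar> \<partial>joint D) \<le> ennreal (C / sqrt (real D))"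
    using assms unfolding vanishing_def by auto
  also have "\<dots> < \<infinity>" by simp
  finally show "(\<integral>\<^sup>+z. ennreal (norm (f D z)) \<partial>joint D) < \<infinity>" by simp
qed (rule vanishingD[OF assms])

lemma vanishing_tendsto:
  assumes f: "vanishing f"
  shows "(\<lambda>D. \<integral>z. f D z \<partial>joint D) \<longlonglongrightarrow> 0"
proof -
  obtain C where C: "C \<ge> 0" "\<And>D. D > 0 \<Longrightarrow> (\<integral>\<^sup>+z. ennreal \<bar>f D z\<bar> \<partial>joint D) \<le> ennreal (C / sqrt (real D))"
    using f unfolding vanishing_def by auto
  have "norm (\<integral>z. f D z \<partial>joint D) \<le> C / sqrt (real D)" if D: "D > 0" for D
  proof -
    have "ennreal (norm (\<integral>z. f D z \<partial>joint D)) \<le> (\<integral>\<^sup>+z. ennreal (norm (f D z)) \<partial>joint D)"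
      by (rule integral_norm_bound_ennreal[OF integrable_vanishing[OF f D]])
    also have "\<dots> \<le> ennreal (C / sqrt (real D))" using C(2)[OF D] by simp
    finally show ?thesis using C(1) by (subst (asm) ennreal_le_iff) auto
  qed
  then have "\<forall>\<^sub>F D in sequentially. norm (\<integral>z. f D z \<partial>joint D) \<le> C / sqrt (real D)"
    by (auto intro: eventually_mono[OF eventually_gt_at_top[of 0]])
  moreover have "(\<lambda>D. C / sqrt (real D)) \<longlonglongrightarrow> 0"
    by (intro tendsto_divide_0[OF tendsto_const] filterlim_at_top_imp_at_infinity
        filterlim_compose[OF sqrt_at_top filterlim_real_sequentially])
  ultimately show ?thesis by (rule Lim_null_comparison)
qed

lemma vanishing_targetI:
  assumes f: "\<And>D. D > 0 \<Longrightarrow> f D \<in> borel_measurable (X D)"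
    and le: "\<And>D. D > 0 \<Longrightarrow> (\<integral>\<^sup>+x. ennreal \<bar>f D x\<bar> \<partial>X D) \<le> ennreal (C / sqrt (real D))" and C: "C \<ge> 0"
  shows "vanishing (\<lambda>D z. f D (fst z))"
  unfolding vanishing_def
proof (intro exI[of _ C] conjI allI impI C)
  fix D :: nat assume D: "D > 0"
  interpret U: prob_space "U D" by (rule prob_space_noise_law)
  show m: "(\<lambda>z. f D (fst z)) \<in> borel_measurable (joint D)"
    unfolding joint_def by (rule measurable_compose[OF measurable_fst f[OF D]])
  have "(\<integral>\<^sup>+z. ennreal \<bar>f D (fst z)\<bar> \<partial>joint D) = (\<integral>\<^sup>+x. \<integral>\<^sup>+u. ennreal \<bar>f D x\<bar> \<partial>U D \<partial>X D)"
    unfolding joint_def by (subst U.nn_integral_fst[symmetric]) (use m in \<open>simp_all add: joint_def\<close>)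
  also have "\<dots> = (\<integral>\<^sup>+x. ennreal \<bar>f D x\<bar> \<partial>X D)"
    using U.emeasure_space_1 by simp
  finally show "(\<integral>\<^sup>+z. ennreal \<bar>f D (fst z)\<bar> \<partial>joint D) \<le> ennreal (C / sqrt (real D))"
    using le[OF D] by simp
qed

text \<open>A conditional L1 bound that is uniform over states integrates to the same bound under
  the joint law. This handles noise averages whose weights depend on the state.\<close>

lemma vanishing_noiseI:
  assumes f: "\<And>D. D > 0 \<Longrightarrow> f D \<in> borel_measurable (joint D)"
    and le: "\<And>D x. D > 0 \<Longrightarrow> (\<integral>\<^sup>+u. ennreal \<bar>f D (x, u)\<bar> \<partial>U D) \<le> ennreal (C / sqrt (real D))" and C: "C \<ge> 0"
  shows "vanishing f"
  unfolding vanishing_def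
proof (intro exI[of _ C] conjI allI impI C)
  fix D :: nat assume D: "D > 0"
  interpret U: prob_space "U D" by (rule prob_space_noise_law)
  interpret X: prob_space "X D" by (rule prob_space_target_measure_D)
  show m: "f D \<in> borel_measurable (joint D)" by (rule f[OF D])
  have "(\<integral>\<^sup>+z. ennreal \<bar>f D z\<bar> \<partial>joint D) = (\<integral>\<^sup>+x. \<integral>\<^sup>+u. ennreal \<bar>f D (x, u)\<bar> \<partial>U D \<partial>X D)"
    unfolding joint_def by (subst U.nn_integral_fst[symmetric]) (use m in \<open>simp_all add: joint_def\<close>)
  also have "\<dots> \<le> (\<integral>\<^sup>+x. ennreal (C / sqrt (real D)) \<partial>X D)"
    by (intro nn_integral_mono le D)
  also have "\<dots> = ennreal (C / sqrt (real D))" using X.emeasure_space_1 by simp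
  finally show "(\<integral>\<^sup>+z. ennreal \<bar>f D z\<bar> \<partial>joint D) \<le> ennreal (C / sqrt (real D))" .
qed

end

section \<open>Expansion of the log-ratio\<close>

context rw_ehmm
begin

definition sel :: "('t \<Rightarrow> 'n option) \<Rightarrow> ('t \<times> nat \<Rightarrow> real^'n) \<Rightarrow> 't \<Rightarrow> nat \<Rightarrow> real" where
  "sel k u s d = (case k s of None \<Rightarrow> 0 | Some n \<Rightarrow> u (s, d) $ n)"

definition moved :: "('t \<Rightarrow> 'n option) \<Rightarrow> 't \<Rightarrow> real" where
  "moved k s = (if k s = None then 0 else 1)"

text \<open>The vector W_s: the linear Taylor term collected over \<open>d\<close>, for all labels
  at once. It is exactly normal once \<open>x\<close> is fixed.\<close>

definition score_sum :: "nat \<Rightarrow> (nat \<Rightarrow> real^'t) \<Rightarrow> ('t \<times> nat \<Rightarrow> real^'n) \<Rightarrow> 't \<Rightarrow> real^'n" where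
  "score_sum D x u s = (\<Sum>d\<in>{1..D}. (sqrt (l s / real D) * \<phi>1 s (x d)) *\<^sub>R u (s, d))"

definition half_info :: "'t \<Rightarrow> real" where "half_info s = l s * info p s / 2"

lemma displacement_eq: "displacement l D u k d s = sqrt (l s / real D) * sel k u s d"
  by (simp add: displacement_def sel_def split: option.split)

lemma measurable_joint_sel:
  assumes "d \<in> {1..D}"
  shows "(\<lambda>z. sel k (snd z) s d) \<in> borel_measurable (joint D)"
proof (cases "k s")
  case (Some n)
  show ?thesis
    unfolding sel_def Some option.case by (rule borel_measurable_vec_nth[OF measurable_joint_snd[OF assms]])
qed (simp add: sel_def)

lemma measurable_joint_fst_comp:
  assumes "d \<in> {1..D}" "f \<in> borel_measurable borel"
  shows "(\<lambda>z. f (fst z d)) \<in> borel_measurable (joint D)"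
  by (rule measurable_compose[OF measurable_joint_fst[OF assms(1)] assms(2)])

lemma sets_joint: "sets (joint D) = sets (PiM {1..D} (\<lambda>_. borel) \<Otimes>\<^sub>M PiM (UNIV \<times> {1..D}) (\<lambda>_. borel))"
  unfolding joint_def by (rule sets_pair_measure_cong[OF sets_target_measure_D sets_noise_law])

lemma measurable_joint_log_ratio:
  "(\<lambda>z. log_ratio l D (fst z) (snd z :: 't \<times> nat \<Rightarrow> real^'n) k) \<in> borel_measurable (joint D)"
  unfolding measurable_cong_sets[OF sets_joint refl] by (rule measurable_log_ratio)

lemma measurable_joint_score_sum:
  "(\<lambda>z. score_sum D (fst z) (snd z) s) \<in> borel_measurable (joint D)"
  unfolding score_sum_def
proof (rule borel_measurable_sum)
  fix d assume d: "d \<in> {1..D}"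
  show "(\<lambda>z. (sqrt (l s / real D) * \<phi>1 s (fst z d)) *\<^sub>R snd z (s, d)) \<in> borel_measurable (joint D)"
    by (rule borel_measurable_scaleR[OF borel_measurable_times[OF borel_measurable_const
          measurable_joint_fst_comp[OF d]] measurable_joint_snd[OF d]]) measurable
qed

text \<open>Given the state, the bracket is centred: for \<open>s = r\<close> the path uses one
  label, whose square has mean 1, and for \<open>s \<noteq> r\<close> the two noises are
  independent. If one of the two times is not moved, the bracket is identically 0.\<close>

lemma vanishing_hessian_noise:
  "vanishing (\<lambda>D z. (\<Sum>d\<in>{1..D}. \<phi>2 r s (fst z d) *
     (sel k (snd z) s d * sel k (snd z) r d - (if s = r then moved k s else 0))) / real D)"
  (is "vanishing ?f")
proof (cases "k s = None \<or> k r = None")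
  case True
  then have "?f = (\<lambda>D z. 0)"
    by (auto simp: sel_def moved_def fun_eq_iff)
  then show ?thesis using vanishing_0 by simp
next
  case False
  then obtain n m where nm: "k s = Some n" "k r = Some m" by auto
  obtain B where B: "\<forall>r s x. \<bar>\<phi>2 r s x\<bar> \<le> B" using phi2_bound by (elim exE conjE)
  show ?thesis
  proof (rule vanishing_noiseI[where C="1 + B\<^sup>2 * noise_constant"])
    fix D :: nat
    show "?f D \<in> borel_measurable (joint D)"
      by (intro borel_measurable_divide borel_measurable_sum borel_measurable_times borel_measurable_diff
          borel_measurable_const measurable_joint_fst_comp measurable_joint_sel) measurable
    fix x assume D: "D > 0"
    have eq: "sel k u s d * sel k u r d - (if s = r then moved k s else 0) =
        u (s, d) $ n * u (r, d) $ m - (if s = r then 1 else 0)" for u d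
      by (simp add: sel_def moved_def nm)
    show "(\<integral>\<^sup>+u. ennreal \<bar>(\<Sum>d\<in>{1..D}. \<phi>2 r s (fst (x, u) d) *
     (sel k (snd (x, u)) s d * sel k (snd (x, u)) r d - (if s = r then moved k s else 0))) / real D\<bar> \<partial>U D)
       \<le> ennreal ((1 + B\<^sup>2 * noise_constant) / sqrt (real D))"
      unfolding fst_conv snd_conv eq by (rule noise_law_average_le[OF D]) (use nm B in simp_all)
  qed (use noise_constant_nonneg in simp)
qed

text \<open>The summands are centred by \<open>integral_phi2_diag\<close>, and boundedness of the
  Hessian controls their variance.\<close>

lemma vanishing_hessian_target:
  "vanishing (\<lambda>D z. (\<Sum>d\<in>{1..D}. \<phi>2 s s (fst z d) + info p s) / real D)"
proof -
  interpret M: prob_space \<mu> by (rule prob_space_target)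
  obtain B where B: "\<forall>r s x. \<bar>\<phi>2 r s x\<bar> \<le> B" using phi2_bound by (elim exE conjE)
  have "AE x in \<mu>. norm ((\<phi>2 s s x)\<^sup>2) \<le> B\<^sup>2"
  proof (rule AE_I2)
    fix x
    have "\<bar>\<phi>2 s s x\<bar> \<le> \<bar>B\<bar>" using B[rule_format, of s s x] by linarith
    then show "norm ((\<phi>2 s s x)\<^sup>2) \<le> B\<^sup>2" by (simp add: abs_le_square_iff)
  qed
  then have sq: "integrable \<mu> (\<lambda>x. (\<phi>2 s s x)\<^sup>2)"
    by (rule M.integrable_const_bound) measurable
  show ?thesis
  proof (rule vanishing_targetI[where C="1 + (\<integral>y. (\<phi>2 s s y)\<^sup>2 \<partial>\<mu>)" and f="\<lambda>D x. (\<Sum>d\<in>{1..D}. \<phi>2 s s (x d) + info p s) / real D"])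
    fix D :: nat assume D: "D > 0"
    show "(\<lambda>x. (\<Sum>d\<in>{1..D}. \<phi>2 s s (x d) + info p s) / real D) \<in> borel_measurable (X D)"
      unfolding measurable_cong_sets[OF sets_target_measure_D refl] by measurable
    show "(\<integral>\<^sup>+x. ennreal \<bar>(\<Sum>d\<in>{1..D}. \<phi>2 s s (x d) + info p s) / real D\<bar> \<partial>X D)
        \<le> ennreal ((1 + (\<integral>y. (\<phi>2 s s y)\<^sup>2 \<partial>\<mu>)) / sqrt (real D))"
      using target_average_le[OF D, of "\<phi>2 s s"] sq by (simp add: integral_phi2_diag)
  qed simp
qed

text \<open>The squared score has mean \<open>info p s\<close>, and its variance is controlled by
  the fourth moment of the score.\<close>

lemma vanishing_score_target:
  "vanishing (\<lambda>D z. (\<Sum>d\<in>{1..D}. (\<phi>1 s (fst z d))\<^sup>2 - info p s) / real D)"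
proof (rule vanishing_targetI[where C="1 + (\<integral>y. ((\<phi>1 s y)\<^sup>2)\<^sup>2 \<partial>\<mu>)" and f="\<lambda>D x. (\<Sum>d\<in>{1..D}. (\<phi>1 s (x d))\<^sup>2 - info p s) / real D"])
  fix D :: nat assume D: "D > 0"
  show "(\<lambda>x. (\<Sum>d\<in>{1..D}. (\<phi>1 s (x d))\<^sup>2 - info p s) / real D) \<in> borel_measurable (X D)"
    unfolding measurable_cong_sets[OF sets_target_measure_D refl] by measurable
  show "(\<integral>\<^sup>+x. ennreal \<bar>(\<Sum>d\<in>{1..D}. (\<phi>1 s (x d))\<^sup>2 - info p s) / real D\<bar> \<partial>X D)
      \<le> ennreal ((1 + (\<integral>y. ((\<phi>1 s y)\<^sup>2)\<^sup>2 \<partial>\<mu>)) / sqrt (real D))"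
    using target_average_le[OF D, of "\<lambda>y. (\<phi>1 s y)\<^sup>2"] integrable_phi1_power[of 4 s]
    by (simp add: info_eq)
qed simp

lemma vanishing_noise_square:
  "vanishing (\<lambda>D z. (\<Sum>d\<in>{1..D}. (snd z (s, d) $ n)\<^sup>2 - 1) / real D)"
proof (rule vanishing_noiseI[where C="1 + 1\<^sup>2 * noise_constant"])
  fix D :: nat
  show "(\<lambda>z. (\<Sum>d\<in>{1..D}. (snd z (s, d) $ n)\<^sup>2 - 1) / real D) \<in> borel_measurable (joint D)"
    by (intro borel_measurable_divide borel_measurable_sum borel_measurable_power borel_measurable_diff
        borel_measurable_const borel_measurable_vec_nth measurable_joint_snd)
  fix x assume D: "D > 0"
  show "(\<integral>\<^sup>+u. ennreal \<bar>(\<Sum>d\<in>{1..D}. (snd (x, u) (s, d) $ n)\<^sup>2 - 1) / real D\<bar> \<partial>U D)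
     \<le> ennreal ((1 + 1\<^sup>2 * noise_constant) / sqrt (real D))"
    using noise_law_average_le[OF D, of s s n n "\<lambda>d. 1" 1] by (simp add: power2_eq_square)
qed (use noise_constant_nonneg in simp)

text \<open>No cancellation is involved: \<open>D\<close> terms of the same finite mean divided by
  \<open>D * sqrt D\<close> are of order \<open>1 / sqrt D\<close>. The divisor comes from the cube
  of the proposal scale.\<close>

lemma vanishing_noise_cube:
  "vanishing (\<lambda>D z. (\<Sum>d\<in>{1..D}. \<bar>sel k (snd z) s d\<bar> ^ 3) / (real D * sqrt (real D)))"
proof (cases "k s")
  case None
  then show ?thesis using vanishing_0 by (simp add: sel_def)
next
  case (Some n)
  let ?K = "\<integral>x. \<bar>x\<bar> ^ 3 \<partial>(std_gauss :: real measure)"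
  have K: "?K \<ge> 0" by (intro integral_nonneg_AE) simp
  show ?thesis
  proof (rule vanishing_noiseI[where C="?K"])
    fix D :: nat
    show "(\<lambda>z. (\<Sum>d\<in>{1..D}. \<bar>sel k (snd z) s d\<bar> ^ 3) / (real D * sqrt (real D))) \<in> borel_measurable (joint D)"
      by (intro borel_measurable_divide borel_measurable_sum borel_measurable_power borel_measurable_abs
          borel_measurable_const measurable_joint_sel)
    fix x assume D: "D > 0"
    have i: "(s, d) \<in> UNIV \<times> {1..D}" if "d \<in> {1..D}" for d using that by simp
    have int: "integrable (U D) (\<lambda>u. \<bar>u (s, d) $ n\<bar> ^ 3)" if "d \<in> {1..D}" for d
      by (rule integrable_noise_law[OF i[OF that] _ integrable_std_gauss_abs_power]) simp
    let ?f = "\<lambda>u. (\<Sum>d\<in>{1..D}. \<bar>u (s, d) $ n\<bar> ^ 3) / (real D * sqrt (real D))"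
    have "(\<integral>\<^sup>+u. ennreal \<bar>(\<Sum>d\<in>{1..D}. \<bar>sel k (snd (x, u)) s d\<bar> ^ 3) / (real D * sqrt (real D))\<bar> \<partial>U D) =
       (\<integral>\<^sup>+u. ennreal (?f u) \<partial>U D)"
      by (simp add: sel_def Some sum_nonneg)
    also have "\<dots> = ennreal (\<integral>u. ?f u \<partial>U D)"
      by (rule nn_integral_eq_integral) (auto intro!: integrable_divide Bochner_Integration.integrable_sum int sum_nonneg divide_nonneg_nonneg)
    also have "(\<integral>u. ?f u \<partial>U D) = (\<Sum>d\<in>{1..D}. (\<integral>u. \<bar>u (s, d) $ n\<bar> ^ 3 \<partial>U D)) / (real D * sqrt (real D))"
      by (subst integral_divide_zero, subst Bochner_Integration.integral_sum[OF int]) simp_all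
    also have "\<dots> = ?K / sqrt (real D)"
      using D integral_noise_law[OF i, of _ "\<lambda>x. \<bar>x\<bar> ^ 3" n] by simp
    finally show "(\<integral>\<^sup>+u. ennreal \<bar>(\<Sum>d\<in>{1..D}. \<bar>sel k (snd (x, u)) s d\<bar> ^ 3) / (real D * sqrt (real D))\<bar> \<partial>U D)
       \<le> ennreal (?K / sqrt (real D))" by simp
  qed (rule K)
qed

text \<open>An exact identity, prior to any estimate. The linear Taylor term is the normal part of
  \<open>potential\<close>; the drift appears by adding and subtracting the mean of the diagonal
  Hessian terms, \<open>- info p s\<close> per moved time, which \<open>l s / 2\<close> turns into
  \<open>- half_info s\<close>.\<close>

lemma log_ratio_minus_potential_eq:
  assumes D: "D > 0"
  shows "log_ratio l D x u k - potential half_info (\<lambda>_. 1) (score_sum D x u) k =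
    (\<Sum>d\<in>{1..D}. \<phi> (x d + (\<chi> s. displacement l D u k d s)) - \<phi> (x d)
        - (\<Sum>s\<in>UNIV. displacement l D u k d s * \<phi>1 s (x d))
        - (1/2) * (\<Sum>s\<in>UNIV. \<Sum>r\<in>UNIV. displacement l D u k d s * displacement l D u k d r * \<phi>2 r s (x d)))
    + (1/2) * (\<Sum>s\<in>UNIV. \<Sum>r\<in>UNIV. sqrt (l s) * sqrt (l r) *
        ((\<Sum>d\<in>{1..D}. \<phi>2 r s (x d) * (sel k u s d * sel k u r d - (if s = r then moved k s else 0))) / real D
         + (if s = r then moved k s * ((\<Sum>d\<in>{1..D}. \<phi>2 s s (x d) + info p s) / real D) else 0)))"
proof -
  let ?v = "displacement l D u k"
  have first: "potential half_info (\<lambda>_. 1) (score_sum D x u) k =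
      (\<Sum>d\<in>{1..D}. \<Sum>s\<in>UNIV. ?v d s * \<phi>1 s (x d)) - (\<Sum>s\<in>UNIV. moved k s * half_info s)"
  proof -
    have "(case k s of None \<Rightarrow> 0 | Some n \<Rightarrow> 1 * score_sum D x u s $ n - half_info s) =
        (\<Sum>d\<in>{1..D}. ?v d s * \<phi>1 s (x d)) - moved k s * half_info s" for s
      by (cases "k s") (simp_all add: displacement_eq sel_def moved_def score_sum_def mult_ac)
    then have "potential half_info (\<lambda>_. 1) (score_sum D x u) k =
      (\<Sum>s\<in>UNIV. \<Sum>d\<in>{1..D}. ?v d s * \<phi>1 s (x d)) - (\<Sum>s\<in>UNIV. moved k s * half_info s)"
      unfolding potential_def by (simp add: sum_subtractf)
    then show ?thesis by (subst (asm) sum.swap)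
  qed
  \<comment> \<open>On the diagonal the two errors telescope: squared noise around
    \<open>moved k s\<close>, then Hessian around \<open>- info p s\<close>, leave the Hessian term
    itself plus twice the drift constant of a moved time.\<close>
  have pointwise: "sqrt (l s) * sqrt (l r) *
        ((\<Sum>d\<in>{1..D}. \<phi>2 r s (x d) * (sel k u s d * sel k u r d - (if s = r then moved k s else 0))) / real D
         + (if s = r then moved k s * ((\<Sum>d\<in>{1..D}. \<phi>2 s s (x d) + info p s) / real D) else 0)) =
      (\<Sum>d\<in>{1..D}. ?v d s * ?v d r * \<phi>2 r s (x d)) + (if s = r then moved k s * (2 * half_info s) else 0)" for s r
  proof -
    have "sqrt (l s / real D) * sqrt (l r / real D) = sqrt (l s) * sqrt (l r) / real D"
      using D by (simp add: real_sqrt_divide)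
    then have v: "?v d s * ?v d r * \<phi>2 r s (x d) = sqrt (l s) * sqrt (l r) * (\<phi>2 r s (x d) * (sel k u s d * sel k u r d)) / real D" for d
      unfolding displacement_eq by (simp add: field_simps)
    show ?thesis
    proof (cases "s = r")
      case True
      have ls: "sqrt (l r) * sqrt (l r) = l r" using l_pos[of r] by simp
      have "(\<Sum>d\<in>{1..D}. \<phi>2 r r (x d) * (sel k u r d * sel k u r d - moved k r)) / real D
         + moved k r * ((\<Sum>d\<in>{1..D}. \<phi>2 r r (x d) + info p r) / real D) =
        (\<Sum>d\<in>{1..D}. \<phi>2 r r (x d) * (sel k u r d * sel k u r d)) / real D + moved k r * info p r"
        using D by (simp add: right_diff_distrib sum_subtractf sum.distrib sum_distrib_left[symmetric]
            sum_distrib_right[symmetric] field_simps)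
      then show ?thesis
        unfolding v unfolding True ls
        by (simp add: half_info_def sum_divide_distrib[symmetric] sum_distrib_left[symmetric] distrib_left)
    next
      case False
      then show ?thesis
        unfolding v by (simp add: sum_divide_distrib[symmetric] sum_distrib_left[symmetric])
    qed
  qed
  have "(\<Sum>s\<in>UNIV. \<Sum>r\<in>UNIV. if s = r then moved k s * (2 * half_info s) else 0) = 2 * (\<Sum>s\<in>UNIV. moved k s * half_info s)"
    by (simp add: sum_distrib_left mult_ac)
  moreover have "(\<Sum>s\<in>UNIV. \<Sum>r\<in>UNIV. \<Sum>d\<in>{1..D}. ?v d s * ?v d r * \<phi>2 r s (x d)) =
     (\<Sum>d\<in>{1..D}. \<Sum>s\<in>UNIV. \<Sum>r\<in>UNIV. ?v d s * ?v d r * \<phi>2 r s (x d))"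
  proof -
    have "(\<Sum>s\<in>UNIV. \<Sum>r\<in>UNIV. \<Sum>d\<in>{1..D}. ?v d s * ?v d r * \<phi>2 r s (x d)) =
      (\<Sum>s\<in>UNIV. \<Sum>d\<in>{1..D}. \<Sum>r\<in>UNIV. ?v d s * ?v d r * \<phi>2 r s (x d))"
      by (intro sum.cong refl sum.swap)
    also have "\<dots> = (\<Sum>d\<in>{1..D}. \<Sum>s\<in>UNIV. \<Sum>r\<in>UNIV. ?v d s * ?v d r * \<phi>2 r s (x d))"
      by (rule sum.swap)
    finally show ?thesis .
  qed
  ultimately show ?thesis
    unfolding pointwise first log_ratio_def by (simp add: sum_subtractf sum.distrib sum_distrib_left[symmetric] sum_divide_distrib[symmetric] add_divide_distrib)
qed

end

section \<open>Convergence\<close>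

context rw_ehmm
begin

lemma vanishing_log_ratio:
  "vanishing (\<lambda>D z. log_ratio l D (fst z) (snd z) k - potential half_info (\<lambda>_. 1) (score_sum D (fst z) (snd z)) k)"
  (is "vanishing ?e")
proof -
  obtain L where L: "L \<ge> 0" and taylor: "\<forall>x v. \<bar>\<phi> (x + v) - \<phi> x - (\<Sum>s\<in>UNIV. v $ s * \<phi>1 s x)
       - (1/2) * (\<Sum>s\<in>UNIV. \<Sum>r\<in>UNIV. v $ s * v $ r * \<phi>2 r s x)\<bar> \<le> L * (\<Sum>s\<in>UNIV. \<bar>v $ s\<bar>) ^ 3"
    using taylor_remainder by (elim exE conjE)
  define c where "c = (\<lambda>s D (z :: (nat \<Rightarrow> real^'t) \<times> ('t \<times> nat \<Rightarrow> real^'n)).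
    (\<Sum>d\<in>{1..D}. \<bar>sel k (snd z) s d\<bar> ^ 3) / (real D * sqrt (real D)))"
  define h where "h = (\<lambda>s r D (z :: (nat \<Rightarrow> real^'t) \<times> ('t \<times> nat \<Rightarrow> real^'n)).
    (\<Sum>d\<in>{1..D}. \<phi>2 r s (fst z d) * (sel k (snd z) s d * sel k (snd z) r d - (if s = r then moved k s else 0))) / real D)"
  define m where "m = (\<lambda>s D (z :: (nat \<Rightarrow> real^'t) \<times> ('t \<times> nat \<Rightarrow> real^'n)).
    (\<Sum>d\<in>{1..D}. \<phi>2 s s (fst z d) + info p s) / real D)"
  define T where "T = real CARD('t)"
  \<comment> \<open>\<open>L\<close> is the Taylor constant, and \<open>T ^ 3\<close> comes from
    \<open>cube_sum_le\<close>, which splits the cubed l1 displacement into times. In the Hessian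
    part, \<open>moved\<close> has been bounded by 1.\<close>
  define f where "f = (\<lambda>D z. (\<Sum>s\<in>UNIV. (L * T ^ 3 * sqrt (l s) ^ 3) * c s D z) +
    (\<Sum>s\<in>UNIV. \<Sum>r\<in>UNIV. (1/2 * (sqrt (l s) * sqrt (l r))) * (\<bar>h s r D z\<bar> + (if s = r then 1 else 0) * \<bar>m s D z\<bar>)))"
  have "vanishing f"
    unfolding f_def c_def h_def m_def
    by (intro vanishing_add vanishing_sum vanishing_cmult vanishing_abs vanishing_noise_cube
        vanishing_hessian_noise vanishing_hessian_target finite)
  then show ?thesis
  proof (rule vanishing_bound)
    fix D :: nat
    show "?e D \<in> borel_measurable (joint D)"
      by (intro borel_measurable_diff measurable_joint_log_ratio measurable_potential measurable_joint_score_sum borel_measurable_const)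
    fix z :: "(nat \<Rightarrow> real^'t) \<times> ('t \<times> nat \<Rightarrow> real^'n)" assume D: "D > 0"
    obtain x u where z: "z = (x, u)" by (cases z)
    let ?v = "\<lambda>d. (\<chi> s. displacement l D u k d s)"
    let ?R = "\<lambda>d. \<phi> (x d + ?v d) - \<phi> (x d) - (\<Sum>s\<in>UNIV. displacement l D u k d s * \<phi>1 s (x d))
        - (1/2) * (\<Sum>s\<in>UNIV. \<Sum>r\<in>UNIV. displacement l D u k d s * displacement l D u k d r * \<phi>2 r s (x d))"
    have sq3: "\<bar>displacement l D u k d s\<bar> ^ 3 = sqrt (l s) ^ 3 * (\<bar>sel k u s d\<bar> ^ 3 / (real D * sqrt (real D)))" for d s
    proof -
      have "\<bar>sqrt (l s / real D)\<bar> ^ 3 = sqrt (l s) ^ 3 / (real D * sqrt (real D))"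
        using l_pos[of s] D by (simp add: real_sqrt_divide power_divide power3_eq_cube less_imp_le)
      then show ?thesis unfolding displacement_eq abs_mult power_mult_distrib by simp
    qed
    have R: "\<bar>?R d\<bar> \<le> (\<Sum>s\<in>UNIV. (L * T ^ 3 * sqrt (l s) ^ 3) * (\<bar>sel k u s d\<bar> ^ 3 / (real D * sqrt (real D))))" for d
    proof -
      have "\<bar>?R d\<bar> \<le> L * (\<Sum>s\<in>UNIV. \<bar>displacement l D u k d s\<bar>) ^ 3"
        using taylor[rule_format, of "x d" "?v d"] by (simp only: vec_lambda_beta)
      also have "\<dots> \<le> L * (T ^ 3 * (\<Sum>s\<in>UNIV. \<bar>displacement l D u k d s\<bar> ^ 3))"
        unfolding T_def by (intro mult_left_mono cube_sum_le L) simp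
      finally show ?thesis unfolding sq3 by (simp add: sum_distrib_left mult.assoc)
    qed
    have "\<bar>\<Sum>d\<in>{1..D}. ?R d\<bar> \<le> (\<Sum>d\<in>{1..D}. \<Sum>s\<in>UNIV. (L * T ^ 3 * sqrt (l s) ^ 3) * (\<bar>sel k u s d\<bar> ^ 3 / (real D * sqrt (real D))))"
      by (intro order_trans[OF sum_abs] sum_mono R)
    also have "\<dots> = (\<Sum>s\<in>UNIV. \<Sum>d\<in>{1..D}. (L * T ^ 3 * sqrt (l s) ^ 3) * (\<bar>sel k u s d\<bar> ^ 3 / (real D * sqrt (real D))))"
      by (rule sum.swap)
    also have "\<dots> = (\<Sum>s\<in>UNIV. (L * T ^ 3 * sqrt (l s) ^ 3) * c s D z)"
      unfolding c_def z snd_conv sum_distrib_left[symmetric] sum_divide_distrib ..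
    finally have bound1: "\<bar>\<Sum>d\<in>{1..D}. ?R d\<bar> \<le> (\<Sum>s\<in>UNIV. (L * T ^ 3 * sqrt (l s) ^ 3) * c s D z)" .
    let ?Q = "\<lambda>s r. sqrt (l s) * sqrt (l r) * (h s r D z + (if s = r then moved k s * m s D z else 0))"
    have Q: "\<bar>1/2 * ?Q s r\<bar> \<le> (1/2 * (sqrt (l s) * sqrt (l r))) * (\<bar>h s r D z\<bar> + (if s = r then 1 else 0) * \<bar>m s D z\<bar>)" for s r
    proof -
      have "\<bar>h s r D z + (if s = r then moved k s * m s D z else 0)\<bar> \<le> \<bar>h s r D z\<bar> + (if s = r then 1 else 0) * \<bar>m s D z\<bar>"
        by (auto simp: moved_def intro: order_trans[OF abs_triangle_ineq])
      then show ?thesis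
        using l_pos[of s] l_pos[of r] by (simp add: abs_mult mult_left_mono less_imp_le mult.assoc)
    qed
    have "\<bar>(1/2) * (\<Sum>s\<in>UNIV. \<Sum>r\<in>UNIV. ?Q s r)\<bar> \<le> (\<Sum>s\<in>UNIV. \<Sum>r\<in>UNIV.
        (1/2 * (sqrt (l s) * sqrt (l r))) * (\<bar>h s r D z\<bar> + (if s = r then 1 else 0) * \<bar>m s D z\<bar>))"
      unfolding sum_distrib_left by (intro order_trans[OF sum_abs] sum_mono Q)
    moreover have "?e D z =
      (\<Sum>d\<in>{1..D}. ?R d) + (1/2) * (\<Sum>s\<in>UNIV. \<Sum>r\<in>UNIV. ?Q s r)"
      unfolding z fst_conv snd_conv h_def m_def by (rule log_ratio_minus_potential_eq[OF D])
    ultimately have "\<bar>?e D z\<bar> \<le> f D z"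
      using bound1 unfolding f_def by linarith
    then show "\<bar>?e D z\<bar> \<le> \<bar>f D z\<bar>"
      by linarith
  qed
qed

text \<open>The same functional is applied to the true log-ratios and to the limiting potentials, so
  both acceptance probabilities come from one Lipschitz function of the weights.\<close>

definition move_prob :: "'t \<Rightarrow> (('t \<Rightarrow> 'n option) \<Rightarrow> real) \<Rightarrow> real" where
  "move_prob t h = (\<Sum>k\<in>{k. k t \<noteq> None}. softmax h k)"

lemma measurable_move_prob:
  assumes "\<And>k. (\<lambda>z. h z k) \<in> borel_measurable M"
  shows "(\<lambda>z. move_prob t (h z)) \<in> borel_measurable M"
  unfolding move_prob_def by (intro borel_measurable_sum measurable_softmax assms)

lemma move_prob_nonneg: "move_prob t h \<ge> 0"
  unfolding move_prob_def by (intro sum_nonneg less_imp_le softmax_pos)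

lemma move_prob_le_1: "move_prob t h \<le> 1"
proof -
  have "move_prob t h \<le> (\<Sum>k\<in>UNIV. softmax h k)"
    unfolding move_prob_def by (rule sum_mono2) (auto intro: less_imp_le softmax_pos)
  then show ?thesis by (simp add: sum_softmax)
qed

lemma move_prob_diff_le:
  "\<bar>move_prob t h - move_prob t g\<bar> \<le> 2 * real (card {k :: 't \<Rightarrow> 'n option. k t \<noteq> None}) * (\<Sum>k\<in>UNIV. \<bar>h k - g k\<bar>)"
proof -
  have "\<bar>move_prob t h - move_prob t g\<bar> \<le> (\<Sum>k\<in>{k. k t \<noteq> None}. \<bar>softmax h k - softmax g k\<bar>)"
    unfolding move_prob_def sum_subtractf[symmetric] by (rule sum_abs)
  also have "\<dots> \<le> (\<Sum>k\<in>{k :: 't \<Rightarrow> 'n option. k t \<noteq> None}. 2 * (\<Sum>k\<in>UNIV. \<bar>h k - g k\<bar>))"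
    by (intro sum_mono softmax_diff_le)
  finally show ?thesis by (simp add: mult_ac)
qed

lemma integrable_move_prob:
  assumes "prob_space M" "\<And>k. (\<lambda>z. h z k) \<in> borel_measurable M"
  shows "integrable M (\<lambda>z. move_prob t (h z))"
proof -
  interpret prob_space M by fact
  have "AE z in M. norm (move_prob t (h z)) \<le> 1"
    by (rule AE_I2) (simp add: move_prob_nonneg move_prob_le_1)
  then show ?thesis by (rule integrable_const_bound) (rule measurable_move_prob[OF assms(2)])
qed

text \<open>Only paths moving time \<open>t\<close> contribute, and for these the squared jump
  differs from \<open>l t\<close> by \<open>l t\<close> times the average over \<open>d\<close> of
  the squared noise minus 1. The selection weights depend on the same noise, but they lie between 0
  and 1 and can simply be dropped after taking absolute values.\<close>

lemma vanishing_squared_jump: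
  "vanishing (\<lambda>D z. squared_jump l D t (fst z) (snd z) - l t * move_prob t (log_ratio l D (fst z) (snd z)))"
  (is "vanishing ?e")
proof -
  define a where "a = (\<lambda>n D (z :: (nat \<Rightarrow> real^'t) \<times> ('t \<times> nat \<Rightarrow> real^'n)).
    (\<Sum>d\<in>{1..D}. (snd z (t, d) $ n)\<^sup>2 - 1) / real D)"
  \<comment> \<open>The sum ranges over paths with \<open>k t \<noteq> None\<close>, so
    \<open>the (k t)\<close> is a genuine label.\<close>
  define f where "f = (\<lambda>D z. \<Sum>k\<in>{k :: 't \<Rightarrow> 'n option. k t \<noteq> None}. l t * \<bar>a (the (k t)) D z\<bar>)"
  have "vanishing f"
    unfolding f_def a_def by (intro vanishing_sum vanishing_cmult vanishing_abs vanishing_noise_square finite)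
  then show ?thesis
  proof (rule vanishing_bound)
    fix D :: nat
    have "(\<lambda>z. squared_jump l D t (fst z) (snd z :: 't \<times> nat \<Rightarrow> real^'n)) \<in> borel_measurable (joint D)"
      unfolding measurable_cong_sets[OF sets_joint refl] by (rule measurable_squared_jump)
    then show "?e D \<in> borel_measurable (joint D)"
      by (intro borel_measurable_diff borel_measurable_times borel_measurable_const measurable_move_prob measurable_joint_log_ratio)
    fix z :: "(nat \<Rightarrow> real^'t) \<times> ('t \<times> nat \<Rightarrow> real^'n)" assume D: "D > 0"
    obtain x u where z: "z = (x, u)" by (cases z)
    let ?p = "softmax (log_ratio l D x u)"
    let ?d = "\<lambda>k :: 't \<Rightarrow> 'n option. \<Sum>d\<in>{1..D}. (displacement l D u k d t)\<^sup>2"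
    have "squared_jump l D t x u = (\<Sum>k\<in>{k. k t \<noteq> None}. ?p k * ?d k)"
      unfolding squared_jump_def by (rule sum.mono_neutral_right) (auto simp: displacement_def)
    then have "squared_jump l D t x u - l t * move_prob t (log_ratio l D x u) = (\<Sum>k\<in>{k. k t \<noteq> None}. ?p k * (?d k - l t))"
      unfolding move_prob_def by (simp add: sum_distrib_left sum_subtractf right_diff_distrib mult_ac)
    also have "\<bar>\<dots>\<bar> \<le> f D z"
      unfolding f_def
    proof (intro order_trans[OF sum_abs] sum_mono)
      fix k :: "'t \<Rightarrow> 'n option" assume "k \<in> {k. k t \<noteq> None}"
      then obtain n where n: "k t = Some n" by auto
      have "?d k = (\<Sum>d\<in>{1..D}. (l t / real D) * (u (t, d) $ n)\<^sup>2)"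
        using l_pos[of t] by (intro sum.cong refl) (simp add: displacement_def n power_mult_distrib less_imp_le)
      also have "\<dots> - l t = l t * a n D z"
        unfolding a_def z snd_conv using scaled_average_diff[OF D, of "l t" _ 1] by (simp only: mult_1_right)
      finally have "\<bar>?d k - l t\<bar> = l t * \<bar>a n D z\<bar>"
        using l_pos[of t] by (simp add: abs_mult)
      moreover have "\<bar>?p k * (?d k - l t)\<bar> \<le> \<bar>?d k - l t\<bar>"
        unfolding abs_mult using softmax_pos[of "log_ratio l D x u" k] softmax_le_1[of "log_ratio l D x u" k]
        by (intro mult_left_le_one_le) auto
      ultimately show "\<bar>?p k * (?d k - l t)\<bar> \<le> l t * \<bar>a (the (k t)) D z\<bar>" by (simp add: n)
    qed
    finally show "\<bar>?e D z\<bar> \<le> \<bar>f D z\<bar>"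
      by (simp add: z)
  qed
qed

lemma vanishing_move_prob:
  "vanishing (\<lambda>D z. move_prob t (log_ratio l D (fst z) (snd z)) -
     move_prob t (potential half_info (\<lambda>_. 1) (score_sum D (fst z) (snd z))))"
proof -
  let ?e = "\<lambda>k D z. log_ratio l D (fst z) (snd z) k - potential half_info (\<lambda>_. 1) (score_sum D (fst z) (snd z)) k"
  let ?c = "2 * real (card {k :: 't \<Rightarrow> 'n option. k t \<noteq> None})"
  have "vanishing (\<lambda>D z. ?c * (\<Sum>k\<in>UNIV. \<bar>?e k D z\<bar>))"
    by (intro vanishing_cmult vanishing_sum vanishing_abs vanishing_log_ratio finite)
  then show ?thesis
  proof (rule vanishing_bound)
    fix D :: nat
    show "(\<lambda>z. move_prob t (log_ratio l D (fst z) (snd z)) -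
        move_prob t (potential half_info (\<lambda>_. 1) (score_sum D (fst z) (snd z)))) \<in> borel_measurable (joint D)"
      by (intro borel_measurable_diff measurable_move_prob measurable_joint_log_ratio measurable_potential
          measurable_joint_score_sum borel_measurable_const)
    fix z :: "(nat \<Rightarrow> real^'t) \<times> ('t \<times> nat \<Rightarrow> real^'n)"
    show "\<bar>move_prob t (log_ratio l D (fst z) (snd z)) - move_prob t (potential half_info (\<lambda>_. 1) (score_sum D (fst z) (snd z)))\<bar>
       \<le> \<bar>?c * (\<Sum>k\<in>UNIV. \<bar>?e k D z\<bar>)\<bar>"
      by (rule order_trans[OF move_prob_diff_le abs_ge_self])
  qed
qed

section \<open>The random conditional scale against its limit\<close>

definition \<sigma> :: "'t \<Rightarrow> real" where "\<sigma> s = sqrt (l s * info p s)"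

text \<open>Given the state, \<open>score_sum D x u s\<close> has exactly the law of a
  \<open>noise\<close> vector multiplied by this scale.\<close>

definition \<sigma>_hat :: "nat \<Rightarrow> (nat \<Rightarrow> real^'t) \<Rightarrow> 't \<Rightarrow> real" where
  "\<sigma>_hat D x s = sqrt (\<Sum>d\<in>{1..D}. (sqrt (l s / real D) * \<phi>1 s (x d))\<^sup>2)"

abbreviation W :: "('t \<Rightarrow> real^'n) measure" where "W \<equiv> standard_noise"

lemma measurable_W_potential: "(\<lambda>w. potential b \<tau> w k) \<in> borel_measurable W"
  by (rule measurable_potential) measurable

lemma \<sigma>_hat_diff_le:
  assumes "D > 0"
  shows "\<bar>\<sigma>_hat D x s - \<sigma> s\<bar> \<le> l s / \<sigma> s * \<bar>(\<Sum>d\<in>{1..D}. (\<phi>1 s (x d))\<^sup>2 - info p s) / real D\<bar>"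
proof -
  have "(\<Sum>d\<in>{1..D}. (sqrt (l s / real D) * \<phi>1 s (x d))\<^sup>2) - l s * info p s =
      (\<Sum>d\<in>{1..D}. (l s / real D) * (\<phi>1 s (x d))\<^sup>2) - l s * info p s"
    using l_pos[of s] by (simp add: power_mult_distrib less_imp_le)
  also have "\<dots> = l s * ((\<Sum>d\<in>{1..D}. (\<phi>1 s (x d))\<^sup>2 - info p s) / real D)"
    by (rule scaled_average_diff[OF assms])
  finally have eq: "(\<Sum>d\<in>{1..D}. (sqrt (l s / real D) * \<phi>1 s (x d))\<^sup>2) - l s * info p s =
    l s * ((\<Sum>d\<in>{1..D}. (\<phi>1 s (x d))\<^sup>2 - info p s) / real D)" .
  have "\<bar>\<sigma>_hat D x s - \<sigma> s\<bar> \<le> \<bar>(\<Sum>d\<in>{1..D}. (sqrt (l s / real D) * \<phi>1 s (x d))\<^sup>2) - l s * info p s\<bar> / \<sigma> s"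
    unfolding \<sigma>_hat_def \<sigma>_def using l_pos[of s] info_pos[of s] by (intro sqrt_diff_le sum_nonneg) auto
  also have "\<dots> = l s / \<sigma> s * \<bar>(\<Sum>d\<in>{1..D}. (\<phi>1 s (x d))\<^sup>2 - info p s) / real D\<bar>"
    unfolding eq abs_mult using l_pos[of s] by simp
  finally show ?thesis .
qed

lemma integrable_W_norm: "integrable W (\<lambda>w. \<bar>w s $ n\<bar>)"
proof -
  have d: "distr W noise (\<lambda>w. w s) = noise"
    unfolding standard_noise_def by (rule distr_PiM_component[OF prob_space_noise]) simp
  have m: "(\<lambda>w. w s) \<in> measurable W noise"
    unfolding standard_noise_def by (rule measurable_component_singleton) simp
  have n: "(\<lambda>v. v $ n) \<in> borel_measurable (noise :: (real^'n) measure)"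
    by (rule borel_measurable_vec_nth[OF measurable_ident_multivariate_normal])
  have "integrable (distr (noise :: (real^'n) measure) borel (\<lambda>v. v $ n)) (\<lambda>x. \<bar>x\<bar>)"
    unfolding distr_noise_component using integrable_std_gauss_abs_power[of 1] by (simp only: power_one_right)
  then have "integrable (noise :: (real^'n) measure) (\<lambda>v. \<bar>v $ n\<bar>)"
    by (rule integrable_distr[OF n])
  then show ?thesis
    using integrable_distr[OF m, of "\<lambda>v. \<bar>v $ n\<bar>"] unfolding d by simp
qed

text \<open>A coupling: with the state frozen, \<open>score_sum\<close> has the law of
  \<open>\<sigma>_hat\<close> times standard noise, and the limit is \<open>\<sigma>\<close> times
  standard noise. Using the same \<open>w\<close> for both leaves only the difference of the scales,
  which the law of large numbers for the squared score controls. The error depends on the state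
  alone, since the noise is integrated inside.\<close>

lemma vanishing_conditional_move_prob:
  "vanishing (\<lambda>D z. (\<integral>u. move_prob t (potential half_info (\<lambda>_. 1) (score_sum D (fst z) u)) \<partial>U D) -
     (\<integral>w. move_prob t (potential half_info \<sigma> w) \<partial>W))"
proof -
  interpret W: prob_space W by (rule prob_space_standard_noise)
  define \<kappa> where "\<kappa> = (\<lambda>s. \<integral>w. (\<Sum>n\<in>UNIV. \<bar>w s $ n\<bar>) \<partial>W)"
  \<comment> \<open>The Lipschitz constant of \<open>move_prob\<close> times the number of paths, as
    \<open>potential_diff_le\<close> gives the same bound for each path. The mean absolute noise
    \<open>\<kappa>\<close> is the other constant, left after integrating that bound over
    \<open>w\<close>.\<close>
  define c where "c = 2 * real (card {k :: 't \<Rightarrow> 'n option. k t \<noteq> None}) * real CARD('t \<Rightarrow> 'n option)"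
  define a where "a = (\<lambda>s D (z :: (nat \<Rightarrow> real^'t) \<times> ('t \<times> nat \<Rightarrow> real^'n)). (\<Sum>d\<in>{1..D}. (\<phi>1 s (fst z d))\<^sup>2 - info p s) / real D)"
  define f where "f = (\<lambda>D z. c * (\<Sum>s\<in>UNIV. (\<kappa> s * (l s / \<sigma> s)) * \<bar>a s D z\<bar>))"
  have \<kappa>: "\<kappa> s \<ge> 0" for s unfolding \<kappa>_def by (intro Bochner_Integration.integral_nonneg sum_nonneg) simp
  have "vanishing f"
    unfolding f_def a_def by (intro vanishing_cmult vanishing_sum vanishing_abs vanishing_score_target finite)
  then show ?thesis
  proof (rule vanishing_bound)
    fix D :: nat
    interpret U: prob_space "U D" by (rule prob_space_noise_law)
    let ?g = "\<lambda>z. move_prob t (potential half_info (\<lambda>_. 1) (score_sum D (fst z) (snd z)))"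
    have "?g \<in> borel_measurable (joint D)"
      by (intro measurable_move_prob measurable_potential measurable_joint_score_sum borel_measurable_const)
    then have "case_prod (\<lambda>x u. ?g (x, u)) \<in> borel_measurable (X D \<Otimes>\<^sub>M U D)"
      unfolding joint_def by (simp add: split_beta')
    from U.borel_measurable_lebesgue_integral[OF this]
    have "(\<lambda>x. \<integral>u. move_prob t (potential half_info (\<lambda>_. 1) (score_sum D x u)) \<partial>U D) \<in> borel_measurable (X D)"
      by simp
    from measurable_compose[OF measurable_fst this]
    show "(\<lambda>z. (\<integral>u. move_prob t (potential half_info (\<lambda>_. 1) (score_sum D (fst z) u)) \<partial>U D) -
       (\<integral>w. move_prob t (potential half_info \<sigma> w) \<partial>W)) \<in> borel_measurable (joint D)"
      unfolding joint_def by (intro borel_measurable_diff borel_measurable_const)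
    fix z :: "(nat \<Rightarrow> real^'t) \<times> ('t \<times> nat \<Rightarrow> real^'n)" assume D: "D > 0"
    obtain x u where z: "z = (x, u)" by (cases z)
    let ?B = "PiM UNIV (\<lambda>_. borel) :: ('t \<Rightarrow> real^'n) measure"
    let ?h = "\<lambda>w. move_prob t (potential half_info (\<lambda>_. 1) w)"
    have h: "?h \<in> borel_measurable ?B"
      by (intro measurable_move_prob measurable_potential) measurable
    have ms: "(\<lambda>u. score_sum D x u) \<in> measurable (U D) ?B"
    proof (rule measurable_PiM_single')
      fix s
      show "(\<lambda>u. score_sum D x u s) \<in> borel_measurable (U D)"
        unfolding score_sum_def
        by (intro borel_measurable_sum borel_measurable_scaleR borel_measurable_const measurable_noise_law_coordinate) simp
    qed simp
    have mw: "(\<lambda>w s. \<sigma>_hat D x s *\<^sub>R w s) \<in> measurable W ?B"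
    proof (rule measurable_PiM_single')
      fix s
      have "(\<lambda>w. w s) \<in> borel_measurable W"
        unfolding measurable_cong_sets[OF sets_standard_noise refl] by (rule measurable_component_singleton) simp
      then show "(\<lambda>w. \<sigma>_hat D x s *\<^sub>R w s) \<in> borel_measurable W"
        by (intro borel_measurable_scaleR borel_measurable_const)
    qed simp
    have "(\<integral>u. ?h (score_sum D x u) \<partial>U D) = (\<integral>v. ?h v \<partial>distr (U D) ?B (score_sum D x))"
      by (rule integral_distr[OF ms h, symmetric])
    also have "distr (U D) ?B (score_sum D x) = distr W ?B (\<lambda>w s. \<sigma>_hat D x s *\<^sub>R w s)"
      unfolding score_sum_def[abs_def] \<sigma>_hat_def by (rule distr_noise_law_weighted_sums)
    also have "(\<integral>v. ?h v \<partial>\<dots>) = (\<integral>w. ?h (\<lambda>s. \<sigma>_hat D x s *\<^sub>R w s) \<partial>W)"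
      by (rule integral_distr[OF mw h])
    also have "\<dots> = (\<integral>w. move_prob t (potential half_info (\<sigma>_hat D x) w) \<partial>W)"
      unfolding potential_scaleR[abs_def] ..
    finally have eq: "(\<integral>u. ?h (score_sum D x u) \<partial>U D) = (\<integral>w. move_prob t (potential half_info (\<sigma>_hat D x) w) \<partial>W)" .
    have int: "integrable W (\<lambda>w. move_prob t (potential half_info \<tau> w))" for \<tau>
      by (rule integrable_move_prob[OF prob_space_standard_noise measurable_W_potential])
    let ?bd = "\<lambda>w. c * (\<Sum>s\<in>UNIV. \<bar>\<sigma>_hat D x s - \<sigma> s\<bar> * (\<Sum>n\<in>UNIV. \<bar>w s $ n\<bar>))"
    have ptw: "\<bar>move_prob t (potential half_info (\<sigma>_hat D x) w) - move_prob t (potential half_info \<sigma> w)\<bar> \<le> ?bd w" for w :: "'t \<Rightarrow> real^'n"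
    proof -
      let ?s = "\<Sum>s\<in>UNIV. \<bar>\<sigma>_hat D x s - \<sigma> s\<bar> * (\<Sum>n\<in>UNIV. \<bar>w s $ n\<bar>)"
      have "(\<Sum>k\<in>(UNIV :: ('t \<Rightarrow> 'n option) set). \<bar>potential half_info (\<sigma>_hat D x) w k - potential half_info \<sigma> w k\<bar>) \<le>
          real CARD('t \<Rightarrow> 'n option) * ?s"
        by (rule sum_bounded_above) (rule potential_diff_le)
      then have "2 * real (card {k :: 't \<Rightarrow> 'n option. k t \<noteq> None}) *
          (\<Sum>k\<in>UNIV. \<bar>potential half_info (\<sigma>_hat D x) w k - potential half_info \<sigma> w k\<bar>) \<le> ?bd w"
        unfolding c_def mult.assoc by (intro mult_left_mono) simp_all
      then show ?thesis by (rule order_trans[OF move_prob_diff_le])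
    qed
    have intbd: "integrable W ?bd"
      by (intro integrable_mult_right Bochner_Integration.integrable_sum integrable_W_norm)
    have "\<bar>(\<integral>w. move_prob t (potential half_info (\<sigma>_hat D x) w) \<partial>W) - (\<integral>w. move_prob t (potential half_info \<sigma> w) \<partial>W)\<bar>
        = \<bar>\<integral>w. move_prob t (potential half_info (\<sigma>_hat D x) w) - move_prob t (potential half_info \<sigma> w) \<partial>W\<bar>"
      by (simp add: Bochner_Integration.integral_diff[OF int int])
    also have "\<dots> \<le> (\<integral>w. \<bar>move_prob t (potential half_info (\<sigma>_hat D x) w) - move_prob t (potential half_info \<sigma> w)\<bar> \<partial>W)"
      by (rule integral_abs_bound)
    also have "\<dots> \<le> (\<integral>w. ?bd w \<partial>W)"
      by (rule integral_mono[OF integrable_abs[OF Bochner_Integration.integrable_diff[OF int int]] intbd ptw])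
    also have "\<dots> = c * (\<Sum>s\<in>UNIV. \<bar>\<sigma>_hat D x s - \<sigma> s\<bar> * \<kappa> s)"
      unfolding \<kappa>_def integral_mult_right_zero
      by (subst Bochner_Integration.integral_sum) (auto intro!: integrable_mult_right Bochner_Integration.integrable_sum integrable_W_norm)
    also have "\<dots> \<le> c * (\<Sum>s\<in>UNIV. (l s / \<sigma> s * \<bar>a s D z\<bar>) * \<kappa> s)"
      unfolding a_def z fst_conv
      by (intro mult_left_mono sum_mono mult_right_mono \<sigma>_hat_diff_le[OF D] \<kappa>) (simp add: c_def)
    also have "\<dots> = f D z" unfolding f_def by (simp add: mult_ac)
    finally show "\<bar>(\<integral>u. move_prob t (potential half_info (\<lambda>_. 1) (score_sum D (fst z) u)) \<partial>U D) -
       (\<integral>w. move_prob t (potential half_info \<sigma> w) \<partial>W)\<bar> \<le> \<bar>f D z\<bar>"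
      using eq by (simp add: z)
  qed
qed

text \<open>Telescoping through the move probability of the true log-ratios and that of the normal
  potentials. The first two differences are small in L1 as they stand; the third is so only after
  averaging over the noise given the state, which leaves the expectation unchanged.\<close>

lemma ESJD_tendsto:
  "(\<lambda>D. ESJD (Sigma_N :: real^'n^'n) l p D t - l t * limit_acceptance (Sigma_N :: real^'n^'n) l p t) \<longlonglongrightarrow> 0"
proof -
  let ?S = "\<integral>w. move_prob t (potential half_info \<sigma> w) \<partial>W"
  let ?H = "\<lambda>D z. move_prob t (log_ratio l D (fst z) (snd z))"
  let ?G = "\<lambda>D x u. move_prob t (potential half_info (\<lambda>_. 1) (score_sum D x u))"
  let ?v1 = "\<lambda>D z. squared_jump l D t (fst z) (snd z) - l t * ?H D z"
  let ?v2 = "\<lambda>D z. ?H D z - ?G D (fst z) (snd z)"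
  let ?v3 = "\<lambda>D z. (\<integral>u. ?G D (fst z) u \<partial>U D) - ?S"
  have limit: "limit_acceptance (Sigma_N :: real^'n^'n) l p t = ?S"
    using limit_acceptance_eq_integral[of l p, where 'n='n] l_pos info_pos
    unfolding move_prob_def half_info_def[abs_def] \<sigma>_def[abs_def] by simp
  have eq: "ESJD (Sigma_N :: real^'n^'n) l p D t - l t * limit_acceptance (Sigma_N :: real^'n^'n) l p t =
     (\<integral>z. ?v1 D z \<partial>joint D) + l t * (\<integral>z. ?v2 D z \<partial>joint D) + l t * (\<integral>z. ?v3 D z \<partial>joint D)" if D: "D > 0" for D
  proof -
    interpret J: prob_space "joint D" by (rule prob_space_joint)
    interpret X: prob_space "X D" by (rule prob_space_target_measure_D)
    interpret U: prob_space "U D" by (rule prob_space_noise_law)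
    interpret XU: pair_sigma_finite "X D" "U D" ..
    have intH: "integrable (joint D) (?H D)"
      by (rule integrable_move_prob[OF prob_space_joint measurable_joint_log_ratio])
    have intG: "integrable (joint D) (\<lambda>z. ?G D (fst z) (snd z))"
      by (rule integrable_move_prob[OF prob_space_joint])
         (intro measurable_potential measurable_joint_score_sum borel_measurable_const)
    have int1: "integrable (joint D) (?v1 D)" by (rule integrable_vanishing[OF vanishing_squared_jump D])
    have int3: "integrable (joint D) (?v3 D)" by (rule integrable_vanishing[OF vanishing_conditional_move_prob D])
    have G: "(\<integral>z. ?G D (fst z) (snd z) \<partial>joint D) = (\<integral>x. \<integral>u. ?G D x u \<partial>U D \<partial>X D)"
      using XU.integral_fst'[of "\<lambda>z. ?G D (fst z) (snd z)"] intG unfolding joint_def by simp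
    have intG': "integrable (joint D) (\<lambda>z. \<integral>u. ?G D (fst z) u \<partial>U D)"
      using Bochner_Integration.integrable_add[OF int3 J.integrable_const[of ?S]] by simp
    \<comment> \<open>The inner integral is a function of the state alone, so integrating it once
      more over the noise multiplies it by total mass one.\<close>
    have G': "(\<integral>z. (\<integral>u. ?G D (fst z) u \<partial>U D) \<partial>joint D) = (\<integral>x. \<integral>u. ?G D x u \<partial>U D \<partial>X D)"
      using XU.integral_fst'[of "\<lambda>z. \<integral>u. ?G D (fst z) u \<partial>U D"] intG' unfolding joint_def
      by (simp add: U.prob_space)
    have "ESJD (Sigma_N :: real^'n^'n) l p D t = (\<integral>z. squared_jump l D t (fst z) (snd z) \<partial>joint D)"
      unfolding joint_def by (rule ESJD_eq_integral)
    also have "\<dots> = (\<integral>z. ?v1 D z + l t * ?H D z \<partial>joint D)" by simp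
    also have "\<dots> = (\<integral>z. ?v1 D z \<partial>joint D) + l t * (\<integral>z. ?H D z \<partial>joint D)"
      using int1 intH by (subst Bochner_Integration.integral_add) simp_all
    finally have e1: "ESJD (Sigma_N :: real^'n^'n) l p D t = (\<integral>z. ?v1 D z \<partial>joint D) + l t * (\<integral>z. ?H D z \<partial>joint D)" .
    have e2: "(\<integral>z. ?v2 D z \<partial>joint D) = (\<integral>z. ?H D z \<partial>joint D) - (\<integral>z. ?G D (fst z) (snd z) \<partial>joint D)"
      by (rule Bochner_Integration.integral_diff[OF intH intG])
    have e3: "(\<integral>z. ?v3 D z \<partial>joint D) = (\<integral>z. ?G D (fst z) (snd z) \<partial>joint D) - ?S"
      unfolding G G'[symmetric] using Bochner_Integration.integral_diff[OF intG' J.integrable_const[of ?S]] J.prob_space by simp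
    show ?thesis unfolding e1 e2 e3 limit by (simp add: algebra_simps)
  qed
  have "(\<lambda>D. (\<integral>z. ?v1 D z \<partial>joint D) + l t * (\<integral>z. ?v2 D z \<partial>joint D) + l t * (\<integral>z. ?v3 D z \<partial>joint D)) \<longlonglongrightarrow> 0 + l t * 0 + l t * 0"
    by (intro tendsto_add tendsto_mult tendsto_const vanishing_tendsto vanishing_squared_jump vanishing_move_prob vanishing_conditional_move_prob)
  then have "(\<lambda>D. (\<integral>z. ?v1 D z \<partial>joint D) + l t * (\<integral>z. ?v2 D z \<partial>joint D) + l t * (\<integral>z. ?v3 D z \<partial>joint D)) \<longlonglongrightarrow> 0"
    by simp
  moreover have "\<forall>\<^sub>F D in sequentially. (\<integral>z. ?v1 D z \<partial>joint D) + l t * (\<integral>z. ?v2 D z \<partial>joint D) + l t * (\<integral>z. ?v3 D z \<partial>joint D)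
      = ESJD (Sigma_N :: real^'n^'n) l p D t - l t * limit_acceptance (Sigma_N :: real^'n^'n) l p t"
    by (rule eventually_mono[OF eventually_gt_at_top[of 0]]) (rule eq[symmetric])
  ultimately show ?thesis by (rule Lim_transform_eventually)
qed

end

theorem proposition3p4:
  fixes m1 :: "real \<Rightarrow> real"
    and m :: "'t::{finite,linorder} \<Rightarrow> real \<Rightarrow> real \<Rightarrow> real"
    and G :: "'t \<Rightarrow> real \<Rightarrow> real"
    and l :: "'t \<Rightarrow> real"
    and p :: "real^'t::{finite,linorder} \<Rightarrow> real"
    and t :: "'t"
  assumes m1_measurable: "m1 \<in> borel_measurable borel"
    and m1_nonneg: "\<And>x. m1 x \<ge> 0"
    and m1_prob: "prob_space (density lborel (\<lambda>x. ennreal (m1 x)))"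
    and m_measurable:
      "\<And>s. s \<noteq> first_time \<Longrightarrow> (\<lambda>(x, y). m s x y) \<in> borel_measurable (borel \<Otimes>\<^sub>M borel)"
    and m_nonneg: "\<And>s x y. s \<noteq> first_time \<Longrightarrow> m s x y \<ge> 0"
    and m_prob:
      "\<And>s x. s \<noteq> first_time \<Longrightarrow> prob_space (density lborel (\<lambda>y. ennreal (m s x y)))"
    and G_measurable: "\<And>s. G s \<in> borel_measurable borel"
    and G_pos: "\<And>s x. G s x > 0"
    and normalisable: "integrable lborel (unnormalised_density m1 m G)"
    and p_eq: "p = target_density m1 m G"
    and p_pos: "\<And>x. p x > 0"
    and l_pos: "\<And>s. l s > 0"
    and p_C2: "twice_continuously_differentiable p"
    and second_lipschitz:
      "\<And>r s. \<exists>L. L-lipschitz_on UNIV (partial r (partial s (\<lambda>x. ln (p x))))"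
    and second_bounded:
      "\<And>r s. bounded (range (partial r (partial s (\<lambda>x. ln (p x)))))"
    and fourth_moment:
      "\<And>s. integrable (target_measure p) (\<lambda>x. \<bar>partial s (\<lambda>y. ln (p y)) x\<bar> ^ 4)"
  shows "(\<lambda>D. \<bar>ESJD (Sigma_N :: real^'n::finite^'n) l p D t
                - l t * limit_acceptance (Sigma_N :: real^'n^'n) l p t\<bar>) \<longlonglongrightarrow> 0"
proof -
  let ?Z = "\<integral>y. unnormalised_density m1 m G y \<partial>lborel"
  have p: "p = (\<lambda>x. unnormalised_density m1 m G x / ?Z)"
    unfolding p_eq target_density_def[abs_def] ..
  \<comment> \<open>Division by 0 yields 0, so a zero normaliser would make \<open>p\<close> vanish
    everywhere, against its positivity.\<close>
  have "?Z \<noteq> 0" using p_pos[of 0] p by auto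
  then have "integrable lborel p" "(\<integral>x. p x \<partial>lborel) = 1"
    unfolding p using normalisable by simp_all
  then interpret rw_ehmm p l "TYPE('n)"
    by unfold_locales (use p_pos p_C2 second_lipschitz second_bounded fourth_moment l_pos in auto)
  show ?thesis
    by (rule tendsto_rabs_zero[OF ESJD_tendsto])
qed

end
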